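(* Let $\mathcal V$ be an algebra of differential functions in $u_1,\dots,u_\ell$, which is a domain, and let $H,K\in\mathrm{Mat}_{\ell\times\ell}\mathcal V(\partial)$ be compatible non-local Hamiltonian structures on $\mathcal V$. Assume that $K$ is an invertible element of the algebra $\mathrm{Mat}_{\ell\times\ell}\mathcal V(\partial)$. Then the sequence of rational matrix pseudodifferential operators with coefficients in $\mathcal V$ $$H^{[0]}=K,\qquad H^{[n]}:=(H\circ K^{-1})^{n-1}\circ H\in\mathrm{Mat}_{\ell\times\ell}\mathcal V(\partial),\quad n\ge1,$$ forms a compatible family of non-local Hamiltonian structures on $\mathcal V$.
   Context: All vector spaces are over a field $\mathbb F$ of characteristic zero; $I=\{1,\dots,\ell\}$. A differential algebra is a unital commutative associative algebra with a derivation $\partial$. Let $R_\ell=\mathbb F[u_i^{(n)}\mid i\in I,n\in\mathbb Z_+]$ with $\partial u_i^{(n)}=u_i^{(n+1)}$. An algebra of differential functions is a differential algebra extension $\mathcal V$ of $R_\ell$ with commuting derivations $\frac{\partial}{\partial u_i^{(n)}}$ extending the usual partial derivatives of $R_\ell$, such that for each $f\in\mathcal V$ only finitely many $\frac{\partial f}{\partial u_i^{(n)}}$ are nonzero, and $[\frac{\partial}{\partial u_i^{(n)}},\partial]=\frac{\partial}{\partial u_i^{(n-1)}}$ (zero if $n=0$). $\mathcal K$ is the field of fractions of $\mathcal V$. $\mathcal V((\partial^{-1}))$ is the algebra of pseudodifferential operators $\sum_{n\le N}a_n\partial^n$ with product determined by $\partial^n\circ a=\sum_{j\ge0}\binom nj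 a^{(j)}\partial^{n-j}$; the symbol of $A=\sum a_n\partial^n$ is $A(\lambda)=\sum a_n\lambda^n$; the adjoint is $(a\partial^n)^*=(-\partial)^n\circ a$, $(H^* )_{ij}=(H_{ji})^*$; $H$ is skewadjoint if $H^*=-H$. $\mathcal K(\partial)$ is the smallest subskewfield of $\mathcal K((\partial^{-1}))$ containing $\mathcal V[\partial]$, and $\mathcal V(\partial)=\mathcal K(\partial)\cap\mathcal V((\partial^{-1}))$ (rational pseudodifferential operators with coefficients in $\mathcal V$). $(\lambda+\partial)^n$ is always expanded in non-negative powers of $\partial$. For $H\in\mathrm{Mat}_{\ell\times\ell}\mathcal V(\partial)$ define $\{f_\lambda g\}_H=\sum_{i,j\in I;\,m,n\in\mathbb Z_+}\frac{\partial g}{\partial u_j^{(n)}}(\lambda+\partial)^nH_{ji}(\lambda+\partial)(-\lambda-\partial)^m\frac{\partial f}{\partial u_i^{(m)}}\in\mathcal V((\lambda^{-1}))$, so $\{{u_i}_\lambda u_j\}_H=H_{ji}(\lambda)$. Brackets with Laurent series are taken coefficientwise. $\mathcal V_{\lambda,\mu}=\mathcal V[[\lambda^{-1},\mu^{-1},(\lambda+\mu)^{-1}]][\lambda,\mu]$ is the quotient of $\mathcal V[[\lambda^{-1},\mu^{-1},\nu^{-1}]][\lambda,\mu,\nu]$ by the submodule generated by multiplication by $\nu-\lambda-\mu$; it embeds in $\mathcal V((\lambda^{-1}))((\mu^{-1}))$, $\mathcal V((\mu^{-1}))((\lambda^{-1}))$ and $\mathcal V(((\lambda+\mu)^{-1}))((\lambda^{-1}))$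 by expanding, respectively, $(\lambda+\mu)^{-1}$ for $|\mu|>|\lambda|$, $(\lambda+\mu)^{-1}$ for $|\lambda|>|\mu|$, and $\mu^{-1}=((\lambda+\mu)-\lambda)^{-1}$ for $|\lambda|>|\lambda+\mu|$. For rational skewadjoint $H$ the three terms below lie in $\mathcal V_{\lambda,\mu}$ via these embeddings. A non-local Hamiltonian structure on $\mathcal V$ is a skewadjoint $H\in\mathrm{Mat}_{\ell\times\ell}\mathcal V(\partial)$ such that in $\mathcal V_{\lambda,\mu}$, for all $i,j,k\in I$: $\{{u_i}_\lambda\{{u_j}_\mu u_k\}_H\}_H-\{{u_j}_\mu\{{u_i}_\lambda u_k\}_H\}_H-\{\{{u_i}_\lambda u_j\}_H{}_{\,\lambda+\mu}u_k\}_H=0$. A collection of non-local Hamiltonian structures on $\mathcal V$ is compatible if every finite $\mathbb F$-linear combination of its members is a non-local Hamiltonian structure on $\mathcal V$. *)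

theory Defs
  imports
    "HOL.Binomial_Plus"
    "HOL-Analysis.Finite_Cartesian_Product"
    "HOL-Computational_Algebra.Formal_Laurent_Series"
    "HOL-Computational_Algebra.Fraction_Field"
    "HOL-Library.Poly_Mapping"
begin

no_notation fps_nth (infixl "$" 75)
notation fls_nth (infixl "$$" 75)

section \<open>Differential rings\<close>

class differential_ring = comm_ring_1 +
  fixes der :: "'a \<Rightarrow> 'a"
  assumes der_add: "der (a + b) = der a + der b"
    and der_mult: "der (a * b) = der a * b + a * der b"

class differential_idom = differential_ring + idom

lemma der_0 [simp]: "der (0 :: 'a :: differential_ring) = 0"
  using der_add[of "0 :: 'a" 0] by simp

lemma der_1 [simp]: "der (1 :: 'a :: differential_ring) = 0"
  using der_mult[of "1 :: 'a" 1] by simp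

lemma der_funpow_0 [simp]: "(der ^^ n) (0 :: 'a :: differential_ring) = 0"
  by (induction n) auto

lemma der_quotient_respect:
  fixes a b c d :: "'a :: differential_idom"
  assumes "a * d = c * b"
  shows "(der a * b - a * der b) * (d * d) = (der c * d - c * der d) * (b * b)"
proof -
  have "der (a * d) = der (c * b)"
    using assms by simp
  hence h: "der a * d + a * der d = der c * b + c * der b"
    by (simp add: der_mult)
  hence h: "der a * d = der c * b + c * der b - a * der d"
    by (simp add: algebra_simps)
  have "(der a * b - a * der b) * (d * d) = (der a * d) * (b * d) - (a * d) * (der b * d)"
    by (simp add: algebra_simps)
  also have "\<dots> = (der c * b + c * der b - a * der d) * (b * d) - (c * b) * (der b * d)"
    unfolding h assms ..
  also have "\<dots> = (der c * d) * (b * b) - (a * d) * (der d * b)"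
    by (simp add: algebra_simps)
  also have "\<dots> = (der c * d - c * der d) * (b * b)"
    unfolding assms by (simp add: algebra_simps)
  finally show ?thesis .
qed

instantiation fract :: (differential_idom) differential_idom
begin

lift_definition der_fract :: "'a fract \<Rightarrow> 'a fract"
  is "\<lambda>q. (der (fst q) * snd q - fst q * der (snd q), snd q * snd q)"
  using der_quotient_respect by auto

lemma der_Fract: "b \<noteq> 0 \<Longrightarrow> der (Fract a b) = Fract (der a * b - a * der b) (b * b)"
  by transfer simp

instance
proof
  fix q r :: "'a fract"
  show "der (q + r) = der q + der r"
    by (cases q, cases r) (simp add: der_Fract eq_fract der_add der_mult algebra_simps)
  show "der (q * r) = der q * r + q * der r"
    by (cases q, cases r) (simp add: der_Fract eq_fract der_add der_mult algebra_simps)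
qed

end


section \<open>Algebras of differential functions\<close>

text \<open>
  The polynomial algebra \<open>R\<close> in the variables \<open>u i n\<close>, \<open>i :: 'i\<close>, \<open>n :: nat\<close>, as finitely supported
  functions on monomials, and its evaluation in an \<open>'f\<close>-algebra with scalar
  multiplication \<open>smul\<close>. The number of differential variables is \<open>CARD('i)\<close>.
\<close>

type_synonym ('i, 'f) diff_poly = "(('i \<times> nat) \<Rightarrow>\<^sub>0 nat) \<Rightarrow>\<^sub>0 'f"

definition eval_diff_poly ::
  "('f::field \<Rightarrow> 'v \<Rightarrow> 'v::comm_ring_1) \<Rightarrow> ('i \<Rightarrow> nat \<Rightarrow> 'v) \<Rightarrow> ('i, 'f) diff_poly \<Rightarrow> 'v" where
  "eval_diff_poly smul u p =
     (\<Sum>m\<in>Poly_Mapping.keys p. smul (Poly_Mapping.lookup p m)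
        (\<Prod>x\<in>Poly_Mapping.keys m. u (fst x) (snd x) ^ Poly_Mapping.lookup m x))"

text \<open>
  \<open>pd i n\<close> is the partial derivative with respect to \<open>u i n\<close>. Injectivity of the evaluation says that
  the algebra contains \<open>R\<close>; a derivation of \<open>R\<close> over \<open>'f\<close> is determined by its
  values on the generators, so \<open>der_u\<close> and \<open>pd_u\<close> say that \<open>der\<close> and \<open>pd i n\<close> extend the
  derivations of \<open>R\<close>.
\<close>

locale differential_functions = vector_space smul
  for smul :: "'f::field_char_0 \<Rightarrow> 'v \<Rightarrow> 'v::differential_ring" +
  fixes u :: "'i::finite \<Rightarrow> nat \<Rightarrow> 'v"
    and pd :: "'i \<Rightarrow> nat \<Rightarrow> 'v \<Rightarrow> 'v"
  assumes scale_mult: "smul c (f * g) = smul c f * g"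
    and der_scale: "der (smul c f) = smul c (der f)"
    and inj_eval: "inj (eval_diff_poly smul u)"
    and der_u: "der (u i n) = u i (Suc n)"
    and pd_add: "pd i n (f + g) = pd i n f + pd i n g"
    and pd_scale: "pd i n (smul c f) = smul c (pd i n f)"
    and pd_mult: "pd i n (f * g) = pd i n f * g + f * pd i n g"
    and pd_u: "pd i n (u j m) = (if i = j \<and> n = m then 1 else 0)"
    and pd_commute: "pd i n (pd j m f) = pd j m (pd i n f)"
    and finite_pd: "finite {(i, n). pd i n f \<noteq> 0}"
    and pd_der: "pd i n (der f) - der (pd i n f) = (case n of 0 \<Rightarrow> 0 | Suc m \<Rightarrow> pd i m f)"


section \<open>Pseudodifferential operators\<close>

text \<open>
  The binomial coefficient with an integer upper argument, as an integer; the definition is that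
  of \<open>gchoose\<close>, whose parsing is restricted to fields.
\<close>

definition int_binomial :: "int \<Rightarrow> nat \<Rightarrow> int" where
  "int_binomial m k = (\<Prod>i = 0..<k. m - int i) div fact k"

lemma of_int_int_binomial:
  "of_int (int_binomial m k) = (of_int m gchoose k :: 'a::field_char_0)"
  using of_int_gbinomial[of m k, where 'a = 'a]
  by (simp add: int_binomial_def gbinomial_prod_rev[where 'a = int])

text \<open>
  A pseudodifferential operator is identified with its symbol, a Laurent series in the
  inverse of \<open>\<lambda>\<close>. The indeterminate of \<open>'a fls\<close> thus stands for \<open>1/\<lambda>\<close>, and \<open>fls_X_inv\<close> for
  \<open>\<lambda>\<close>. The product \<open>*\<close> of \<open>'a fls\<close> is the commutative product of symbols, not the
  composition of operators.
\<close>

abbreviation psd_coeff :: "'a::zero fls \<Rightarrow> int \<Rightarrow> 'a" where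
  "psd_coeff A n \<equiv> A $$ (- n)"

lemma psd_comp_finite:
  fixes A B :: "'a::zero fls"
  shows "finite {(m, j). psd_coeff A m \<noteq> 0 \<and> psd_coeff B (n - m + int j) \<noteq> 0}"
proof -
  obtain M where M: "\<forall>k<M. A $$ k = 0" by (rule fls_nth_vanishes_belowE)
  obtain N where N: "\<forall>k<N. B $$ k = 0" by (rule fls_nth_vanishes_belowE)
  have "m \<in> {n + N..- M} \<and> j \<in> {..nat (- N - n - M)}"
    if *: "psd_coeff A m \<noteq> 0" "psd_coeff B (n - m + int j) \<noteq> 0" for m j
  proof -
    have "- m \<ge> M" using * M by (metis not_le)
    moreover have "- (n - m + int j) \<ge> N" using * N by (metis not_le)
    ultimately show ?thesis by auto
  qed
  hence "{(m, j). psd_coeff A m \<noteq> 0 \<and> psd_coeff B (n - m + int j) \<noteq> 0}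
      \<subseteq> {n + N..- M} \<times> {..nat (- N - n - M)}"
    by blast
  thus ?thesis by (rule finite_subset) auto
qed

text \<open>
  The series \<open>A(\<lambda>+\<partial>) B(\<lambda>)\<close>, with \<open>(\<lambda>+\<partial>)\<^sup>m\<close> expanded in non-negative powers
  of \<open>\<partial>\<close> and \<open>\<partial>\<close> acting on the coefficients of \<open>B\<close>. It is also the symbol of
  the composition of \<open>A\<close> and \<open>B\<close>: both are determined by
  \<open>a \<partial>\<^sup>m \<circ> b \<partial>\<^sup>l = (\<Sum>j. (m choose j) a b\<^sup>(\<^sup>j\<^sup>) \<partial>\<^bsup>m+l-j\<^esup>)\<close>.
\<close>

lift_definition psd_comp ::
  "'a::differential_ring fls \<Rightarrow> 'a fls \<Rightarrow> 'a fls" (infixl "\<odot>" 75)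
  is "\<lambda>A B (r::int). \<Sum>(m::int, j::nat) | A (- m) \<noteq> 0 \<and> B (- (- r - m + int j)) \<noteq> 0.
        of_int (int_binomial m j) * A (- m) * (der ^^ j) (B (- (- r - m + int j)))"
proof -
  fix A B :: "int \<Rightarrow> 'a"
  assume "\<forall>\<^sub>\<infinity>n. A (- int n) = 0" "\<forall>\<^sub>\<infinity>n. B (- int n) = 0"
  then obtain M N where M: "\<forall>n>M. A (- int n) = 0" and N: "\<forall>n>N. B (- int n) = 0"
    by (auto simp: MOST_nat)
  show "\<forall>\<^sub>\<infinity>n. (\<Sum>(m::int, j::nat) | A (- m) \<noteq> 0 \<and> B (- (- (- int n) - m + int j)) \<noteq> 0.
        of_int (int_binomial m j) * A (- m) * (der ^^ j) (B (- (- (- int n) - m + int j)))) = 0"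
    unfolding MOST_nat
  proof (intro exI allI impI)
    fix n assume n: "n > M + N"
    have "A (- m) = 0 \<or> B (- (- (- int n) - m + int j)) = 0" for m :: int and j :: nat
    proof (cases "m > int M")
      case True
      with M[rule_format, of "nat m"] show ?thesis by auto
    next
      case False
      hence "int n - m + int j > int N" using n by linarith
      with N[rule_format, of "nat (int n - m + int j)"] show ?thesis by simp
    qed
    hence "{(m::int, j::nat). A (- m) \<noteq> 0 \<and> B (- (- (- int n) - m + int j)) \<noteq> 0} = {}" by auto
    thus "(\<Sum>(m::int, j::nat) | A (- m) \<noteq> 0 \<and> B (- (- (- int n) - m + int j)) \<noteq> 0.
        of_int (int_binomial m j) * A (- m) * (der ^^ j) (B (- (- (- int n) - m + int j)))) = 0"
      by (simp only: sum.empty)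
  qed
qed

lemma psd_coeff_comp:
  "psd_coeff (A \<odot> B) n =
     (\<Sum>(m, j) | psd_coeff A m \<noteq> 0 \<and> psd_coeff B (n - m + int j) \<noteq> 0.
        of_int (int_binomial m j) * psd_coeff A m * (der ^^ j) (psd_coeff B (n - m + int j)))"
  by transfer simp

text \<open>
  The adjoint: the sum over \<open>m\<close> of \<open>(-\<partial>)\<^sup>m \<circ> a\<^sub>m\<close>, where
  \<open>(-\<partial>)\<^sup>m = (-1)\<^sup>m \<partial>\<^sup>m\<close> also for negative \<open>m\<close>; the index \<open>j\<close> below is \<open>m - n\<close>.
\<close>

lift_definition psd_adjoint :: "'a::differential_ring fls \<Rightarrow> 'a fls"
  is "\<lambda>A (r::int). \<Sum>j::nat | A (- (- r + int j)) \<noteq> 0.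
        (if even (- r + int j) then 1 else - 1) *
        of_int (int_binomial (- r + int j) j) * (der ^^ j) (A (- (- r + int j)))"
proof -
  fix A :: "int \<Rightarrow> 'a"
  assume "\<forall>\<^sub>\<infinity>n. A (- int n) = 0"
  then obtain M where M: "\<forall>n>M. A (- int n) = 0" by (auto simp: MOST_nat)
  show "\<forall>\<^sub>\<infinity>n. (\<Sum>j::nat | A (- (- (- int n) + int j)) \<noteq> 0.
        (if even (- (- int n) + int j) then 1 else - 1) *
        of_int (int_binomial (- (- int n) + int j) j) * (der ^^ j) (A (- (- (- int n) + int j)))) = 0"
    unfolding MOST_nat
  proof (intro exI allI impI)
    fix n assume n: "n > M"
    have "A (- (- (- int n) + int j)) = 0" for j :: nat
      using M[rule_format, of "n + j"] n by simp
    hence "{j::nat. A (- (- (- int n) + int j)) \<noteq> 0} = {}" by auto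
    thus "(\<Sum>j::nat | A (- (- (- int n) + int j)) \<noteq> 0.
        (if even (- (- int n) + int j) then 1 else - 1) *
        of_int (int_binomial (- (- int n) + int j) j) * (der ^^ j) (A (- (- (- int n) + int j)))) = 0"
      by (simp only: sum.empty)
  qed
qed

lemma psd_coeff_adjoint:
  "psd_coeff (psd_adjoint A) n =
     (\<Sum>j | psd_coeff A (n + int j) \<noteq> 0.
        (if even (n + int j) then 1 else - 1) *
        of_int (int_binomial (n + int j) j) * (der ^^ j) (psd_coeff A (n + int j)))"
  by transfer simp

lemma psd_adjoint_finite:
  fixes A :: "'a::zero fls"
  shows "finite {j. psd_coeff A (n + int j) \<noteq> 0}"
proof -
  obtain M where M: "\<forall>k<M. A $$ k = 0" by (rule fls_nth_vanishes_belowE)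
  have "j \<in> {..nat (- M - n)}" if "psd_coeff A (n + int j) \<noteq> 0" for j
  proof -
    have "- (n + int j) \<ge> M" using that M by (metis not_le)
    thus ?thesis by auto
  qed
  hence "{j. psd_coeff A (n + int j) \<noteq> 0} \<subseteq> {..nat (- M - n)}"
    by blast
  thus ?thesis by (rule finite_subset) auto
qed

text \<open>Meaningful only for \<open>f 0 = 0\<close>.\<close>

definition fls_map :: "('a::zero \<Rightarrow> 'b::zero) \<Rightarrow> 'a fls \<Rightarrow> 'b fls" where
  "fls_map f A = Abs_fls (\<lambda>n. f (A $$ n))"

lemma fls_map_nth [simp]:
  assumes "f 0 = 0"
  shows "fls_map f A $$ n = f (A $$ n)"
proof -
  obtain N where "\<forall>k<N. A $$ k = 0" by (rule fls_nth_vanishes_belowE)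
  with assms show ?thesis
    unfolding fls_map_def by (intro nth_Abs_fls_lower_bound[of N]) simp
qed


section \<open>Rational pseudodifferential operators\<close>

text \<open>A subskewfield of the skewfield of all pseudodifferential operators over \<open>'k\<close>, with product \<open>\<odot>\<close>.\<close>

definition subskewfield :: "'k::{differential_idom, field} fls set \<Rightarrow> bool" where
  "subskewfield S \<longleftrightarrow>
     1 \<in> S \<and> (\<forall>A\<in>S. \<forall>B\<in>S. A - B \<in> S \<and> A \<odot> B \<in> S) \<and>
     (\<forall>A\<in>S. A \<noteq> 0 \<longrightarrow> (\<exists>B\<in>S. A \<odot> B = 1 \<and> B \<odot> A = 1))"

definition to_fraction_psd :: "'v::idom fls \<Rightarrow> 'v fract fls" where
  "to_fraction_psd = fls_map (\<lambda>a. Fract a 1)"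

definition differential_operators :: "'v::zero fls set" where
  "differential_operators = {A. \<forall>n<0. psd_coeff A n = 0}"

definition rational_over_fractions :: "'v::differential_idom fract fls set" where
  "rational_over_fractions =
     \<Inter>{S. subskewfield S \<and> to_fraction_psd ` differential_operators \<subseteq> S}"

definition rational_psd :: "'v::differential_idom fls set" where
  "rational_psd = {A. to_fraction_psd A \<in> rational_over_fractions}"


section \<open>Matrix pseudodifferential operators\<close>

type_synonym ('v, 'i) psd_matrix = "(('v fls, 'i) vec, 'i) vec"

definition rational_matrices :: "('v::differential_idom, 'i::finite) psd_matrix set" where
  "rational_matrices = {A. \<forall>i j. A $ i $ j \<in> rational_psd}"

definition psdm_comp :: "('v::differential_ring, 'i::finite) psd_matrix \<Rightarrow>
    ('v, 'i) psd_matrix \<Rightarrow> ('v, 'i) psd_matrix" (infixl "\<odot>\<^sub>M" 75) where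
  "A \<odot>\<^sub>M B = (\<chi> i j. \<Sum>k\<in>UNIV. A $ i $ k \<odot> B $ k $ j)"

definition psdm_one :: "('v::differential_ring, 'i::finite) psd_matrix" where
  "psdm_one = (\<chi> i j. if i = j then 1 else 0)"

primrec psdm_power :: "('v::differential_ring, 'i::finite) psd_matrix \<Rightarrow> nat \<Rightarrow>
    ('v, 'i) psd_matrix" where
  "psdm_power A 0 = psdm_one"
| "psdm_power A (Suc n) = A \<odot>\<^sub>M psdm_power A n"

definition psdm_adjoint ::
  "('v::differential_ring, 'i::finite) psd_matrix \<Rightarrow> ('v, 'i) psd_matrix" where
  "psdm_adjoint A = (\<chi> i j. psd_adjoint (A $ j $ i))"

definition psdm_scale :: "('f \<Rightarrow> 'v \<Rightarrow> 'v) \<Rightarrow> 'f \<Rightarrow>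
    ('v::differential_ring, 'i::finite) psd_matrix \<Rightarrow> ('v, 'i) psd_matrix" where
  "psdm_scale smul c A = (\<chi> i j. fls_map (smul c) (A $ i $ j))"

definition rational_inverse_of :: "('v::differential_idom, 'i::finite) psd_matrix \<Rightarrow>
    ('v, 'i) psd_matrix \<Rightarrow> bool" where
  "rational_inverse_of A B \<longleftrightarrow>
     B \<in> rational_matrices \<and> A \<odot>\<^sub>M B = psdm_one \<and> B \<odot>\<^sub>M A = psdm_one"

definition rational_invertible :: "('v::differential_idom, 'i::finite) psd_matrix \<Rightarrow> bool" where
  "rational_invertible A \<longleftrightarrow> A \<in> rational_matrices \<and> (\<exists>B. rational_inverse_of A B)"

definition rational_inverse ::
  "('v::differential_idom, 'i::finite) psd_matrix \<Rightarrow> ('v, 'i) psd_matrix" where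
  "rational_inverse A = (SOME B. rational_inverse_of A B)"


section \<open>The non-local lambda-bracket\<close>

text \<open>
  The bracket of \<open>f\<close> and \<open>g\<close> in the indeterminate \<open>\<lambda>\<close>. Since \<open>A(\<lambda>+\<partial>) F(\<lambda>)\<close> is
  \<open>A \<odot> F\<close>, the operators \<open>(\<lambda>+\<partial>)\<^sup>n\<close> and \<open>(-\<lambda>-\<partial>)\<^sup>m\<close> act as \<open>\<odot>\<close> with
  the symbols \<open>\<lambda>\<^sup>n\<close> and \<open>(-\<lambda>)\<^sup>m\<close>.
\<close>

definition lambda_bracket ::
  "('i::finite \<Rightarrow> nat \<Rightarrow> 'v \<Rightarrow> 'v) \<Rightarrow> ('v::differential_ring, 'i) psd_matrix \<Rightarrow>
    'v \<Rightarrow> 'v \<Rightarrow> 'v fls" where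
  "lambda_bracket pd H f g =
     (\<Sum>i\<in>UNIV. \<Sum>j\<in>UNIV. \<Sum>m | pd i m f \<noteq> 0. \<Sum>n | pd j n g \<noteq> 0.
        fls_const (pd j n g) *
          (fls_X_inv ^ n \<odot> (H $ j $ i \<odot> ((- fls_X_inv) ^ m \<odot> fls_const (pd i m f)))))"


section \<open>The space of series in two variables and the Jacobi identity\<close>

text \<open>
  Series in \<open>V[[1/\<lambda>, 1/\<mu>, 1/\<nu>]][\<lambda>, \<mu>, \<nu>]\<close> are given by their coefficients:
  \<open>P a b c\<close> is the coefficient of \<open>\<lambda>\<^sup>a \<mu>\<^sup>b \<nu>\<^sup>c\<close>. The space \<open>V\<^sub>\<lambda>\<^sub>\<mu>\<close> is the
  quotient by the multiples of \<open>\<nu> - \<lambda> - \<mu>\<close>; its elements are handled through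
  representatives.
\<close>

definition three_var_series :: "(int \<Rightarrow> int \<Rightarrow> int \<Rightarrow> 'v::zero) set" where
  "three_var_series =
     {P. \<exists>N. \<forall>a b c. P a b c \<noteq> 0 \<longrightarrow> a \<le> N \<and> b \<le> N \<and> c \<le> N}"

definition mult_nu_minus_lambda_minus_mu ::
  "(int \<Rightarrow> int \<Rightarrow> int \<Rightarrow> 'v) \<Rightarrow> int \<Rightarrow> int \<Rightarrow> int \<Rightarrow> 'v::ab_group_add" where
  "mult_nu_minus_lambda_minus_mu G a b c = G a b (c - 1) - G (a - 1) b c - G a (b - 1) c"

definition zero_in_quotient :: "(int \<Rightarrow> int \<Rightarrow> int \<Rightarrow> 'v::ab_group_add) \<Rightarrow> bool" where
  "zero_in_quotient P \<longleftrightarrow> (\<exists>G\<in>three_var_series. P = mult_nu_minus_lambda_minus_mu G)"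

text \<open>
  The embeddings of \<open>V\<^sub>\<lambda>\<^sub>\<mu>\<close>, given by the coefficients of the image of a representative.

  In \<open>V((1/\<lambda>))((1/\<mu>))\<close>: the coefficient of \<open>\<lambda>\<^sup>p \<mu>\<^sup>q\<close>, with
  \<open>\<nu>\<^sup>c = (\<Sum>k. (c choose k) \<lambda>\<^sup>k \<mu>\<^bsup>c-k\<^esup>)\<close>.

  In \<open>V((1/\<mu>))((1/\<lambda>))\<close>: the coefficient of \<open>\<mu>\<^sup>p \<lambda>\<^sup>q\<close>, with
  \<open>\<nu>\<^sup>c = (\<Sum>k. (c choose k) \<mu>\<^sup>k \<lambda>\<^bsup>c-k\<^esup>)\<close>.

  In \<open>V((1/\<nu>))((1/\<lambda>))\<close>: the coefficient of \<open>\<nu>\<^sup>p \<lambda>\<^sup>q\<close>, with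
  \<open>\<mu>\<^sup>b = (\<nu> - \<lambda>)\<^sup>b = (\<Sum>k. (b choose k) \<nu>\<^sup>k (-\<lambda>)\<^bsup>b-k\<^esup>)\<close>.
\<close>

definition expand_lambda_mu ::
  "(int \<Rightarrow> int \<Rightarrow> int \<Rightarrow> 'v::comm_ring_1) \<Rightarrow> int \<Rightarrow> int \<Rightarrow> 'v" where
  "expand_lambda_mu P p q =
     (\<Sum>(b, c, k) | P (p - int k) b c \<noteq> 0 \<and> b + c - int k = q.
        of_int (int_binomial c k) * P (p - int k) b c)"

definition expand_mu_lambda ::
  "(int \<Rightarrow> int \<Rightarrow> int \<Rightarrow> 'v::comm_ring_1) \<Rightarrow> int \<Rightarrow> int \<Rightarrow> 'v" where
  "expand_mu_lambda P p q =
     (\<Sum>(a, c, k) | P a (p - int k) c \<noteq> 0 \<and> a + c - int k = q.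
        of_int (int_binomial c k) * P a (p - int k) c)"

definition expand_nu_lambda ::
  "(int \<Rightarrow> int \<Rightarrow> int \<Rightarrow> 'v::comm_ring_1) \<Rightarrow> int \<Rightarrow> int \<Rightarrow> 'v" where
  "expand_nu_lambda P p q =
     (\<Sum>(a, b, k) | P a b (p - int k) \<noteq> 0 \<and> a + b - int k = q.
        (if even (b - int k) then 1 else - 1) * of_int (int_binomial b k) * P a b (p - int k))"

text \<open>In \<open>V((1/x))((1/y)) = 'v fls fls\<close>, the coefficient of \<open>x\<^sup>p y\<^sup>q\<close>; the outer series is the one in \<open>y\<close>.\<close>

definition coeff2 :: "'v::zero fls fls \<Rightarrow> int \<Rightarrow> int \<Rightarrow> 'v" where
  "coeff2 T p q = T $$ (- q) $$ (- p)"

text \<open>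
  In the three terms below the outer series is in \<open>\<mu>\<close>, \<open>\<lambda>\<close>, \<open>\<lambda>\<close> and the inner one in
  \<open>\<lambda>\<close>, \<open>\<mu>\<close>, \<open>\<nu> = \<lambda> + \<mu>\<close> respectively.
\<close>

definition jacobi_identity ::
  "('i::finite \<Rightarrow> nat \<Rightarrow> 'v) \<Rightarrow> ('i \<Rightarrow> nat \<Rightarrow> 'v \<Rightarrow> 'v) \<Rightarrow>
    ('v::differential_ring, 'i) psd_matrix \<Rightarrow> 'i \<Rightarrow> 'i \<Rightarrow> 'i \<Rightarrow> bool" where
  "jacobi_identity u pd H i j k \<longleftrightarrow>
     (\<exists>P\<in>three_var_series. \<exists>Q\<in>three_var_series. \<exists>R\<in>three_var_series.
        coeff2 (fls_map (\<lambda>g. lambda_bracket pd H (u i 0) g)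
                  (lambda_bracket pd H (u j 0) (u k 0))) = expand_lambda_mu P \<and>
        coeff2 (fls_map (\<lambda>g. lambda_bracket pd H (u j 0) g)
                  (lambda_bracket pd H (u i 0) (u k 0))) = expand_mu_lambda Q \<and>
        coeff2 (fls_map (\<lambda>f. lambda_bracket pd H f (u k 0))
                  (lambda_bracket pd H (u i 0) (u j 0))) = expand_nu_lambda R \<and>
        zero_in_quotient (\<lambda>a b c. P a b c - Q a b c - R a b c))"


section \<open>Non-local Hamiltonian structures\<close>

definition nonlocal_hamiltonian ::
  "('i::finite \<Rightarrow> nat \<Rightarrow> 'v) \<Rightarrow> ('i \<Rightarrow> nat \<Rightarrow> 'v \<Rightarrow> 'v) \<Rightarrow>
    ('v::differential_idom, 'i) psd_matrix \<Rightarrow> bool" where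
  "nonlocal_hamiltonian u pd H \<longleftrightarrow>
     H \<in> rational_matrices \<and> psdm_adjoint H = - H \<and> (\<forall>i j k. jacobi_identity u pd H i j k)"

definition compatible_structures ::
  "('f \<Rightarrow> 'v \<Rightarrow> 'v) \<Rightarrow> ('i::finite \<Rightarrow> nat \<Rightarrow> 'v) \<Rightarrow> ('i \<Rightarrow> nat \<Rightarrow> 'v \<Rightarrow> 'v) \<Rightarrow>
    ('v::differential_idom, 'i) psd_matrix set \<Rightarrow> bool" where
  "compatible_structures smul u pd \<H> \<longleftrightarrow>
     (\<forall>A\<in>\<H>. nonlocal_hamiltonian u pd A) \<and>
     (\<forall>S c. finite S \<and> S \<subseteq> \<H> \<longrightarrow>
        nonlocal_hamiltonian u pd (\<Sum>A\<in>S. psdm_scale smul (c A) A))"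

definition hierarchy :: "('v::differential_idom, 'i::finite) psd_matrix \<Rightarrow>
    ('v, 'i) psd_matrix \<Rightarrow> nat \<Rightarrow> ('v, 'i) psd_matrix" where
  "hierarchy H K n =
     (if n = 0 then K else psdm_power (H \<odot>\<^sub>M rational_inverse K) (n - 1) \<odot>\<^sub>M H)"

end

theory Submission
  imports Defs
begin

text \<open>
  Let \<open>S = K\<^bsup>-1\<^esup>\<close> and \<open>N = H K\<^bsup>-1\<^esup>\<close>. An invertible skewadjoint operator satisfies the Jacobi
  identity iff its inverse is closed as a two-form, and closedness is linear. The Jacobi identities
  of \<open>K\<close>, \<open>H\<close> and \<open>K + H\<close> imply that \<open>S\<close> and \<open>S N\<close> are closed and that \<open>N\<close> has zero Nijenhuis
  torsion. A recursion expressing the derivative of \<open>S N\<^bsup>n+2\<^esup>\<close> by those of \<open>S N\<^bsup>n+1\<^esup>\<close> and \<open>S N\<^sup>n\<close>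
  shows that all \<open>S N\<^sup>n\<close> are closed. Hence for every polynomial \<open>A\<close> in \<open>N\<close> with constant
  coefficients \<open>S A\<close> and \<open>S A\<^sup>2\<close> are closed, so that \<open>A\<close> has zero torsion, and this is the Jacobi
  identity of \<open>A K\<close>.

  This computation only uses the Leibniz rule for derivatives of operators. Expanded in one
  common domain, the terms of the Jacobi identity become bidifferential operators, on which
  operators act from the left and through each of the two arguments, and these three actions
  commute. That each term for a rational operator has such an expansion, compatible with its
  natural one, follows by induction over the skewfield generated by the differential operators. The
  induction takes place over the field of fractions; an additive retraction onto the domain, applied
  coefficientwise, leads back.
\<close>

section \<open>Pseudodifferential operators\<close>

text \<open>The obstacle is that the three terms of the Jacobi identity are given as series expanded
  in three different domains, and a rational operator is known only by its Laurent series, from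
  which no other expansion can be read off. Each of the three expansions is injective on the
  quotient by nu - lambda - mu. Hence a term has at most one re-expansion, and the Leibniz rules
  carry over because they hold for representatives. Inverses leave V even when the operator of
  interest has coefficients in V; this forces the passage to fractions. A merely additive way back
  suffices because expansions have integer coefficients and the identity only asks that some
  representatives exist. Zero torsion comes from a subtraction: for A = N and for A = 1 + N the
  Jacobi identity of A K reads torsion A + A K d(S A) = 0, with equal torsions and equal d(S A), so
  the difference is K d(S N). Polynomials in N are treated together because compatibility concerns
  linear combinations and because the square of a polynomial is again one.\<close>

lemma int_binomial_0 [simp]: "int_binomial m 0 = 1"
  by (simp add: int_binomial_def)

lemma int_binomial_0_left: "int_binomial 0 k = (if k = 0 then 1 else 0)"
  using of_int_int_binomial[of 0 k, where 'a = real] by (cases k) simp_all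

lemma int_binomial_Suc_Suc: "int_binomial (m + 1) (Suc k) = int_binomial m (Suc k) + int_binomial m k"
proof -
  have "real_of_int (int_binomial (m + 1) (Suc k)) = of_int (int_binomial m (Suc k) + int_binomial m k)"
    using gbinomial_Suc_Suc[of "real_of_int m" k] by (simp add: of_int_int_binomial add.commute)
  thus ?thesis by (simp only: of_int_eq_iff)
qed

lemma psd_eqI: "(\<And>n. psd_coeff A n = psd_coeff B n) \<Longrightarrow> A = B"
  by (rule fls_eqI) (metis minus_minus)

lemma psd_coeff_shift [simp]: "psd_coeff (fls_shift n A) m = psd_coeff A (m - n)"
  by simp

text \<open>Order at most n; the zero operator has every order. All convergence arguments below are
  expressed through this filtration.\<close>

definition deg_le :: "int \<Rightarrow> 'a::zero fls \<Rightarrow> bool" where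
  "deg_le n A \<longleftrightarrow> (\<forall>m>n. psd_coeff A m = 0)"

lemma deg_leD: "deg_le n A \<Longrightarrow> m > n \<Longrightarrow> psd_coeff A m = 0"
  by (simp add: deg_le_def)

lemma deg_le_mono: "deg_le n A \<Longrightarrow> n \<le> m \<Longrightarrow> deg_le m A"
  by (simp add: deg_le_def)

lemma deg_le_shift: "deg_le n A \<Longrightarrow> deg_le (n + k) (fls_shift k A)"
  unfolding deg_le_def psd_coeff_shift by (simp del: minus_diff_eq)

lemma ex_deg_le: "\<exists>n. deg_le n A"
proof -
  obtain M where "\<forall>k<M. A $$ k = 0" by (rule fls_nth_vanishes_belowE)
  hence "deg_le (- M) A" by (simp add: deg_le_def)
  thus ?thesis ..
qed

lemma deg_le_obtain:
  obtains n where "deg_le n A" "deg_le n B" "n \<ge> c"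
proof -
  obtain k l where "deg_le k A" "deg_le l B" using ex_deg_le by metis
  hence "deg_le (max c (max k l)) A" "deg_le (max c (max k l)) B" by (auto intro: deg_le_mono)
  thus ?thesis using that by fastforce
qed

lemma fls_map_id: "fls_map (\<lambda>x. x) A = A"
  by (rule fls_eqI) simp

text \<open>With the derivation acting on coefficients, series whose coefficients are series again
  have a composition \<open>\<odot>\<close>, in the outer variable. The whole calculus thus applies
  a second time, to bidifferential operators.\<close>

instantiation fls :: (differential_ring) differential_ring
begin

definition der_fls :: "'a fls \<Rightarrow> 'a fls" where
  "der_fls = fls_map der"

lemma der_fls_nth [simp]: "der A $$ n = der (A $$ n)"
  by (simp add: der_fls_def)

lemma der_sum: "der (sum f S) = (\<Sum>x\<in>S. der (f x :: 'b::differential_ring))"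
  by (induction S rule: infinite_finite_induct) (simp_all add: der_add)

instance
proof
  fix A B :: "'a fls"
  show "der (A + B) = der A + der B"
    by (rule fls_eqI) (simp add: der_add)
  obtain n where n: "deg_le n A" "deg_le n B" by (rule deg_le_obtain[where c=0])
  have z: "A $$ k = 0" "B $$ k = 0" if "k < - n" for k
    using n[unfolded deg_le_def] that by (metis minus_less_iff minus_minus)+
  \<comment> \<open>The subdegrees of A, B and their derivatives may differ; a common range of
    summation lets the Leibniz rule be checked summand by summand.\<close>
  have *: "(C * D) $$ k = (\<Sum>i=-n..k+n. C $$ i * D $$ (k - i))"
    if C: "\<And>k. k < - n \<Longrightarrow> C $$ k = 0" and D: "\<And>k. k < - n \<Longrightarrow> D $$ k = 0" for C D :: "'a fls" and k
  proof -
    have "(C * D) $$ k = (\<Sum>i=fls_subdegree C..k - fls_subdegree D. C $$ i * D $$ (k - i))"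
      by (rule fls_times_nth)
    also have "\<dots> = (\<Sum>i=-n..k+n. C $$ i * D $$ (k - i))"
    proof (rule sum.mono_neutral_cong)
      fix i assume "i \<in> {-n..k+n} - {fls_subdegree C..k - fls_subdegree D}"
      hence "i < fls_subdegree C \<or> k - i < fls_subdegree D" by auto
      thus "C $$ i * D $$ (k - i) = 0" by (auto simp: fls_eq0_below_subdegree)
    next
      fix i assume "i \<in> {fls_subdegree C..k - fls_subdegree D} - {-n..k+n}"
      hence "i < - n \<or> k - i < - n" by auto
      thus "C $$ i * D $$ (k - i) = 0" using C D by auto
    qed auto
    finally show ?thesis .
  qed
  show "der (A * B) = der A * B + A * der B"
    by (rule fls_eqI) (simp add: * z der_sum der_mult sum.distrib)
qed

end

instance fls :: (differential_idom) differential_idom ..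

text \<open>The defining sum runs over a support that depends on both operators. On a rectangle
  depending only on bounds for the orders, identities of compositions reduce to identities of
  summands.\<close>

lemma psd_coeff_comp_box:
  assumes "deg_le M A" "deg_le N B" "l \<le> n - N" "u \<ge> M" "int J \<ge> M + N - n"
  shows "psd_coeff (A \<odot> B) n =
    (\<Sum>m=l..u. \<Sum>j\<le>J. of_int (int_binomial m j) * psd_coeff A m * (der ^^ j) (psd_coeff B (n - m + int j)))"
proof -
  let ?S = "{(m, j). psd_coeff A m \<noteq> 0 \<and> psd_coeff B (n - m + int j) \<noteq> 0}"
  have "m \<in> {l..u} \<and> j \<in> {..J}"
    if "psd_coeff A m \<noteq> 0" "psd_coeff B (n - m + int j) \<noteq> 0" for m j
  proof -
    have "m \<le> M" "n - m + int j \<le> N" using that assms(1,2) by (meson deg_leD not_le)+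
    thus ?thesis using assms(3,4,5) by auto
  qed
  hence "?S \<subseteq> {l..u} \<times> {..J}" by blast
  hence "psd_coeff (A \<odot> B) n = (\<Sum>(m, j)\<in>{l..u} \<times> {..J}.
      of_int (int_binomial m j) * psd_coeff A m * (der ^^ j) (psd_coeff B (n - m + int j)))"
    unfolding psd_coeff_comp by (intro sum.mono_neutral_left) auto
  thus ?thesis by (simp add: sum.cartesian_product)
qed

lemma psd_coeff_comp_box':
  assumes "deg_le M A" "deg_le N B"
  shows "psd_coeff (A \<odot> B) n = (\<Sum>m=n-N..M. \<Sum>j\<le>nat (M + N - n).
    of_int (int_binomial m j) * psd_coeff A m * (der ^^ j) (psd_coeff B (n - m + int j)))"
  by (rule psd_coeff_comp_box[OF assms order_refl order_refl]) simp

lemma deg_le_comp: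
  assumes "deg_le M A" "deg_le N B"
  shows "deg_le (M + N) (A \<odot> B)"
  unfolding deg_le_def
proof (intro allI impI)
  fix n assume n: "n > M + N"
  show "psd_coeff (A \<odot> B) n = 0"
    by (subst psd_coeff_comp_box[OF assms order_refl order_refl, where J = 0])
      (use n assms(1) in \<open>auto intro!: sum.neutral dest: deg_leD\<close>)
qed

lemma fls_map_deg_le: "f 0 = 0 \<Longrightarrow> deg_le n A \<Longrightarrow> deg_le n (fls_map f A)"
  by (simp add: deg_le_def)

lemma der_pow_add: "(der ^^ j) (a + b) = (der ^^ j) a + (der ^^ j) (b :: 'a::differential_ring)"
  by (induction j) (simp_all add: der_add)

lemma comp_add_left: "(A + B) \<odot> C = A \<odot> C + B \<odot> C"
proof (rule psd_eqI)
  fix n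
  obtain N where N: "deg_le N A" "deg_le N B" by (rule deg_le_obtain[where c=0])
  obtain M where M: "deg_le M C" using ex_deg_le by blast
  have N': "deg_le N (A + B)" using N by (simp add: deg_le_def)
  show "psd_coeff ((A + B) \<odot> C) n = psd_coeff (A \<odot> C + B \<odot> C) n"
    using psd_coeff_comp_box'[OF N' M, of n]
      psd_coeff_comp_box'[OF N(1) M, of n]
      psd_coeff_comp_box'[OF N(2) M, of n]
    by (simp add: sum.distrib algebra_simps)
qed

lemma comp_add_right: "A \<odot> (B + C) = A \<odot> B + A \<odot> C"
proof (rule psd_eqI)
  fix n
  obtain N where N: "deg_le N B" "deg_le N C" by (rule deg_le_obtain[where c=0])
  obtain M where M: "deg_le M A" using ex_deg_le by blast
  have N': "deg_le N (B + C)" using N by (simp add: deg_le_def)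
  show "psd_coeff (A \<odot> (B + C)) n = psd_coeff (A \<odot> B + A \<odot> C) n"
    using psd_coeff_comp_box'[OF M N', of n]
      psd_coeff_comp_box'[OF M N(1), of n]
      psd_coeff_comp_box'[OF M N(2), of n]
    by (simp add: sum.distrib algebra_simps der_pow_add)
qed

lemma additive_zero: "(\<And>A B. f (A + B) = f A + f B) \<Longrightarrow> f (0::'a::ab_group_add) = (0::'b::ab_group_add)"
  by (metis add_cancel_right_right)

lemma additive_minus:
  "(\<And>A B. f (A + B) = f A + f B) \<Longrightarrow> f (- A :: 'a::ab_group_add) = - (f A :: 'b::ab_group_add)"
  by (metis add.right_inverse additive_zero add_eq_0_iff)

lemma additive_diff:
  "(\<And>A B. f (A + B) = f A + f B) \<Longrightarrow> f (A - B :: 'a::ab_group_add) = (f A - f B :: 'b::ab_group_add)"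
  by (metis add_diff_cancel diff_add_cancel)

lemma additive_sum:
  assumes "\<And>A B. f (A + B :: 'a::ab_group_add) = (f A + f B :: 'b::ab_group_add)"
  shows "f (sum g S) = (\<Sum>x\<in>S. f (g x))"
  by (induction S rule: infinite_finite_induct) (simp_all add: assms additive_zero[of f, OF assms])

lemmas comp_zero_left [simp] = additive_zero[of "\<lambda>A. A \<odot> B", OF comp_add_left] for B
lemmas comp_zero_right [simp] = additive_zero[of "\<lambda>B. A \<odot> B", OF comp_add_right] for A
lemmas comp_minus_left [simp] = additive_minus[of "\<lambda>A. A \<odot> B", OF comp_add_left] for B
lemmas comp_minus_right [simp] = additive_minus[of "\<lambda>B. A \<odot> B", OF comp_add_right] for A
lemmas comp_diff_left = additive_diff[of "\<lambda>A. A \<odot> B", OF comp_add_left] for B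
lemmas comp_diff_right = additive_diff[of "\<lambda>B. A \<odot> B", OF comp_add_right] for A
lemmas comp_sum_left = additive_sum[of "\<lambda>A. A \<odot> B", OF comp_add_left] for B
lemmas comp_sum_right = additive_sum[of "\<lambda>B. A \<odot> B", OF comp_add_right] for A

lemma der_of_int: "der (of_int i :: 'a::differential_ring) = 0"
  by (induction i rule: int_induct[where k = 0]) (simp_all add: der_add additive_diff[of der, OF der_add])

lemma deg_le_const: "deg_le 0 (fls_const a)"
  by (simp add: deg_le_def)

lemma comp_const_mult_left: "(fls_const a * A) \<odot> B = fls_const a * (A \<odot> B)"
proof (rule psd_eqI)
  fix n
  obtain N where N: "deg_le N A" using ex_deg_le by blast
  obtain M where M: "deg_le M B" using ex_deg_le by blast
  have N': "deg_le N (fls_const a * A)" using N by (simp add: deg_le_def)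
  show "psd_coeff ((fls_const a * A) \<odot> B) n = psd_coeff (fls_const a * (A \<odot> B)) n"
    using psd_coeff_comp_box'[OF N' M, of n]
      psd_coeff_comp_box'[OF N(1) M, of n]
    by (simp add: sum_distrib_left algebra_simps)
qed

lemma comp_one_left [simp]: "1 \<odot> B = B"
proof (rule psd_eqI)
  fix n
  obtain M where M: "deg_le M B" using ex_deg_le by blast
  have 1: "deg_le 0 (1 :: 'a fls)" by (simp add: deg_le_def)
  let ?t = "\<lambda>m j. of_int (int_binomial m j) * psd_coeff 1 m * (der ^^ j) (psd_coeff B (n - m + int j))"
  have "psd_coeff (1 \<odot> B) n = (\<Sum>m=min 0 (n - M)..0. \<Sum>j\<le>nat (M - n). ?t m j)"
    by (rule psd_coeff_comp_box[OF 1 M]) auto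
  also have "\<dots> = (\<Sum>m\<in>{0}. \<Sum>j\<le>nat (M - n). ?t m j)"
    by (rule sum.mono_neutral_right) auto
  also have "\<dots> = (\<Sum>j\<le>nat (M - n). if j = 0 then psd_coeff B n else 0)"
  proof -
    have "?t 0 j = (if j = 0 then psd_coeff B n else 0)" for j
      by (simp add: int_binomial_0_left)
    thus ?thesis by (subst sum.insert) (simp_all del: of_int_eq_0_iff)
  qed
  finally show "psd_coeff (1 \<odot> B) n = psd_coeff B n" by simp
qed

lemma comp_const_left: "fls_const a \<odot> B = fls_const a * B"
  using comp_const_mult_left[of a 1 B] by simp

lemma comp_shift_right: "A \<odot> fls_shift k B = fls_shift k (A \<odot> B)"
proof (rule psd_eqI)
  fix n
  obtain N where N: "deg_le N A" using ex_deg_le by blast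
  obtain M where M: "deg_le M B" using ex_deg_le by blast
  note M' = deg_le_shift[OF M, of k]
  show "psd_coeff (A \<odot> fls_shift k B) n = psd_coeff (fls_shift k (A \<odot> B)) n"
    using psd_coeff_comp_box'[OF N M', of n]
      psd_coeff_comp_box'[OF N M, of "n - k"]
    by (simp add: algebra_simps)
qed

lemma comp_const_right: "der c = 0 \<Longrightarrow> A \<odot> (fls_const c * B) = fls_const c * (A \<odot> B)"
proof (rule psd_eqI)
  fix n assume c: "der c = 0"
  obtain N where N: "deg_le N A" using ex_deg_le by blast
  obtain M where M: "deg_le M B" using ex_deg_le by blast
  have M': "deg_le M (fls_const c * B)" using M by (simp add: deg_le_def)
  have d: "(der ^^ j) (c * b) = c * (der ^^ j) b" for j b
    by (induction j) (simp_all add: der_mult c)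
  show "psd_coeff (A \<odot> (fls_const c * B)) n = psd_coeff (fls_const c * (A \<odot> B)) n"
    using psd_coeff_comp_box'[OF N M', of n]
      psd_coeff_comp_box'[OF N M, of n]
    by (simp add: sum_distrib_left algebra_simps d)
qed

text \<open>\<open>psd_E\<close> is composition with \<open>\<partial>\<close> from the left; composition with \<open>\<partial>\<close> from the right is \<open>fls_shift 1\<close>.\<close>

definition psd_E :: "'a::differential_ring fls \<Rightarrow> 'a fls" where
  "psd_E B = fls_shift 1 B + der B"

lemma psd_coeff_E: "psd_coeff (psd_E B) n = psd_coeff B (n - 1) + der (psd_coeff B n)"
  by (simp add: psd_E_def)

text \<open>The two parts of \<open>psd_E B\<close> give binomial sums whose indices j differ by
  one, and Pascal's rule merges them.\<close>

lemma comp_shift_left: "fls_shift 1 A \<odot> B = A \<odot> psd_E B"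
proof (rule psd_eqI)
  fix n
  obtain N where N: "deg_le N A" using ex_deg_le by blast
  obtain M where M: "deg_le M B" using ex_deg_le by blast
  note N' = deg_le_shift[OF N, of 1]
  have M': "deg_le (M + 1) (psd_E B)" using M unfolding deg_le_def psd_coeff_E by (simp del: minus_diff_eq)
  \<comment> \<open>Large enough for \<open>psd_E B\<close>, whose order is at most M + 1, and such
    that the additional summand j = Suc J vanishes for all m up to N.\<close>
  define J where "J = nat (N + M + 1 - n)"
  define c where "c = psd_coeff B"
  have cE: "psd_coeff (psd_E B) k = c (k - 1) + der (c k)" for k
    by (simp only: psd_coeff_E c_def)
  let ?b = "\<lambda>m j. (der ^^ j) (c (n - m - 1 + int j))"
  have step: "(\<Sum>j\<le>J. of_int (int_binomial m j) * (der ^^ j) (psd_coeff (psd_E B) (n - m + int j)))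
    = (\<Sum>j\<le>Suc J. of_int (int_binomial (m + 1) j) * ?b m j)" if "?b m (Suc J) = 0" for m
  proof -
    have "(\<Sum>j\<le>J. of_int (int_binomial m j) * (der ^^ j) (psd_coeff (psd_E B) (n - m + int j)))
      = (\<Sum>j\<le>J. of_int (int_binomial m j) * ?b m j) + (\<Sum>j\<le>J. of_int (int_binomial m j) * ?b m (Suc j))"
      unfolding cE by (simp add: der_pow_add sum.distrib algebra_simps funpow_swap1)
    also have "(\<Sum>j\<le>J. of_int (int_binomial m j) * ?b m j) = (\<Sum>j\<le>Suc J. of_int (int_binomial m j) * ?b m j)"
      using that by simp
    also have "\<dots> = ?b m 0 + (\<Sum>j\<le>J. of_int (int_binomial m (Suc j)) * ?b m (Suc j))"
      by (subst sum.atMost_Suc_shift) simp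
    also have "\<dots> + (\<Sum>j\<le>J. of_int (int_binomial m j) * ?b m (Suc j)) =
       ?b m 0 + (\<Sum>j\<le>J. of_int (int_binomial (m + 1) (Suc j)) * ?b m (Suc j))"
      unfolding int_binomial_Suc_Suc by (simp add: sum.distrib algebra_simps)
    also have "\<dots> = (\<Sum>j\<le>Suc J. of_int (int_binomial (m + 1) j) * ?b m j)"
      by (subst sum.atMost_Suc_shift[of _ J]) simp
    finally show ?thesis .
  qed
  have "psd_coeff (A \<odot> psd_E B) n = (\<Sum>m=n-M-1..N. \<Sum>j\<le>J. of_int (int_binomial m j) * psd_coeff A m *
      (der ^^ j) (psd_coeff (psd_E B) (n - m + int j)))"
    by (rule psd_coeff_comp_box[OF N M']) (simp_all add: J_def)
  also have "\<dots> = (\<Sum>m=n-M-1..N. psd_coeff A m * (\<Sum>j\<le>J. of_int (int_binomial m j) *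
      (der ^^ j) (psd_coeff (psd_E B) (n - m + int j))))"
    by (simp add: sum_distrib_left algebra_simps)
  also have "\<dots> = (\<Sum>m=n-M-1..N. psd_coeff A m * (\<Sum>j\<le>Suc J. of_int (int_binomial (m + 1) j) * ?b m j))"
  proof (rule sum.cong)
    fix m assume "m \<in> {n-M-1..N}"
    hence "c (n - m - 1 + int (Suc J)) = 0"
      unfolding c_def by (intro deg_leD[OF M]) (auto simp: J_def)
    hence "?b m (Suc J) = 0" by (simp only: der_funpow_0)
    from step[OF this] show "psd_coeff A m * (\<Sum>j\<le>J. of_int (int_binomial m j) *
        (der ^^ j) (psd_coeff (psd_E B) (n - m + int j)))
      = psd_coeff A m * (\<Sum>j\<le>Suc J. of_int (int_binomial (m + 1) j) * ?b m j)" by (simp only:)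
  qed (rule refl)
  also have "\<dots> = (\<Sum>m=n-M..N+1. \<Sum>j\<le>Suc J. of_int (int_binomial m j) * psd_coeff (fls_shift 1 A) m *
      (der ^^ j) (c (n - m + int j)))"
    by (rule sum.reindex_bij_witness[of _ "\<lambda>m. m - 1" "\<lambda>m. m + 1"])
      (auto simp: sum_distrib_left algebra_simps)
  also have "\<dots> = psd_coeff (fls_shift 1 A \<odot> B) n"
    unfolding c_def by (rule psd_coeff_comp_box[OF N' M, symmetric]) (simp_all add: J_def)
  finally show "psd_coeff (fls_shift 1 A \<odot> B) n = psd_coeff (A \<odot> psd_E B) n" ..
qed

lemma der_comp: "der (A \<odot> B) = der A \<odot> B + A \<odot> der B"
proof (rule psd_eqI)
  fix n
  obtain N where N: "deg_le N A" using ex_deg_le by blast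
  obtain M where M: "deg_le M B" using ex_deg_le by blast
  have N': "deg_le N (der A)" using N unfolding deg_le_def by simp
  have M': "deg_le M (der B)" using M unfolding deg_le_def by simp
  have t: "der (of_int i * a * (der ^^ j) b) = of_int i * der a * (der ^^ j) b + of_int i * a * (der ^^ j) (der b)"
    for i j and a b :: 'a
    by (simp only: der_mult der_of_int funpow_swap1) simp
  note box = psd_coeff_comp_box'[where n = n]
  show "psd_coeff (der (A \<odot> B)) n = psd_coeff (der A \<odot> B + A \<odot> der B) n"
    unfolding fls_plus_nth der_fls_nth box[OF N M'] box[OF N' M] box[OF N M]
    by (simp only: der_sum t sum.distrib)
qed

lemma comp_E_left: "psd_E A \<odot> B = psd_E (A \<odot> B)"
  by (simp add: psd_E_def comp_add_left comp_shift_left comp_add_right comp_shift_right der_comp algebra_simps)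

section \<open>Reduction to monomials\<close>

text \<open>Additive maps that raise the order by at most a fixed d, hence continuous for the order
  filtration. Such maps are determined by their values on monomials.\<close>

definition psd_cts :: "('a::ab_group_add fls \<Rightarrow> 'b::ab_group_add fls) \<Rightarrow> bool" where
  "psd_cts \<Phi> \<longleftrightarrow> (\<forall>A B. \<Phi> (A + B) = \<Phi> A + \<Phi> B) \<and> (\<exists>d. \<forall>n A. deg_le n A \<longrightarrow> deg_le (n + d) (\<Phi> A))"

lemma psd_ctsI:
  "(\<And>A B. \<Phi> (A + B) = \<Phi> A + \<Phi> B) \<Longrightarrow> (\<And>n A. deg_le n A \<Longrightarrow> deg_le (n + d) (\<Phi> A)) \<Longrightarrow> psd_cts \<Phi>"
  unfolding psd_cts_def by blast

lemma psd_cts_comp: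
  assumes "psd_cts \<Psi>" "psd_cts \<Phi>"
  shows "psd_cts (\<lambda>A. \<Psi> (\<Phi> A))"
proof -
  obtain d where d: "\<And>n A. deg_le n A \<Longrightarrow> deg_le (n + d) (\<Phi> A)" using assms by (auto simp: psd_cts_def)
  obtain e where e: "\<And>n A. deg_le n A \<Longrightarrow> deg_le (n + e) (\<Psi> A)" using assms by (auto simp: psd_cts_def)
  have "deg_le (n + (d + e)) (\<Psi> (\<Phi> A))" if "deg_le n A" for n A
    using e[OF d[OF that]] by (simp add: add.assoc)
  thus ?thesis using assms by (intro psd_ctsI[where d = "d + e"]) (simp_all add: psd_cts_def)
qed

text \<open>To see the coefficient of order m, subtract from A its finitely many monomials of order
  at least m - d: the image of what remains has order less than m.\<close>

lemma psd_cts_vanish: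
  fixes \<Theta> :: "'a::ab_group_add fls \<Rightarrow> 'b::ab_group_add fls"
  assumes "psd_cts \<Theta>" and mono: "\<And>n a. \<Theta> (fls_shift n (fls_const a)) = 0"
  shows "\<Theta> A = 0"
proof (rule psd_eqI)
  fix m
  have add: "\<Theta> (A + B) = \<Theta> A + \<Theta> B" for A B using assms by (simp add: psd_cts_def)
  obtain d where d: "\<And>n A. deg_le n A \<Longrightarrow> deg_le (n + d) (\<Theta> A)" using assms by (auto simp: psd_cts_def)
  obtain M where M: "deg_le M A" using ex_deg_le by blast
  let ?T = "\<Sum>i=m-d..M. fls_shift i (fls_const (psd_coeff A i))"
  have T: "psd_coeff ?T k = (if k \<in> {m-d..M} then psd_coeff A k else 0)" for k
  proof -
    have "psd_coeff ?T k = (\<Sum>i=m-d..M. if i = k then psd_coeff A i else 0)"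
      unfolding fls_nth_sum by (intro sum.cong) auto
    thus ?thesis by simp
  qed
  have "deg_le (m - d - 1) (A - ?T)"
    unfolding deg_le_def
  proof (intro allI impI)
    fix k assume "k > m - d - 1"
    thus "psd_coeff (A - ?T) k = 0" using deg_leD[OF M, of k] by (simp only: fls_minus_nth T) auto
  qed
  hence "psd_coeff (\<Theta> (A - ?T)) m = 0" by (intro deg_leD[OF d]) auto
  moreover have "\<Theta> ?T = 0" unfolding additive_sum[of \<Theta>, OF add] mono by simp
  ultimately show "psd_coeff (\<Theta> A) m = psd_coeff 0 m" by (simp add: additive_diff[of \<Theta>, OF add])
qed

lemma psd_cts_diff: "psd_cts \<Phi> \<Longrightarrow> psd_cts \<Psi> \<Longrightarrow> psd_cts (\<lambda>A. \<Phi> A - \<Psi> A)"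
proof -
  assume "psd_cts \<Phi>" "psd_cts \<Psi>"
  then obtain d e where d: "\<And>n A. deg_le n A \<Longrightarrow> deg_le (n + d) (\<Phi> A)"
    and e: "\<And>n A. deg_le n A \<Longrightarrow> deg_le (n + e) (\<Psi> A)"
    and add: "\<And>A B. \<Phi> (A + B) = \<Phi> A + \<Phi> B" "\<And>A B. \<Psi> (A + B) = \<Psi> A + \<Psi> B"
    by (auto simp: psd_cts_def)
  show ?thesis
  proof (rule psd_ctsI[where d = "max d e"])
    show "deg_le (n + max d e) (\<Phi> A - \<Psi> A)" if "deg_le n A" for n A
      using deg_le_mono[OF d[OF that], of "n + max d e"] deg_le_mono[OF e[OF that], of "n + max d e"]
      by (simp add: deg_le_def)
  qed (simp add: add)
qed

lemma psd_cts_add: "psd_cts \<Phi> \<Longrightarrow> psd_cts \<Psi> \<Longrightarrow> psd_cts (\<lambda>A. \<Phi> A + \<Psi> A)"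
proof -
  assume *: "psd_cts \<Phi>" "psd_cts \<Psi>"
  have "psd_cts (\<lambda>A. - \<Psi> A)"
    using *(2) by (auto simp: psd_cts_def deg_le_def)
  from psd_cts_diff[OF *(1) this] show ?thesis by simp
qed

lemma psd_cts_ident: "psd_cts (\<lambda>A. A)"
  by (rule psd_ctsI[where d = 0]) simp_all

lemma psd_cts_comp_left: "psd_cts \<Phi> \<Longrightarrow> psd_cts (\<lambda>A. \<Phi> A \<odot> B)"
proof (rule psd_cts_comp[of "\<lambda>A. A \<odot> B"])
  obtain M where M: "deg_le M B" using ex_deg_le by blast
  show "psd_cts (\<lambda>A. A \<odot> B)"
    by (rule psd_ctsI[where d = M]) (simp_all add: comp_add_left deg_le_comp M)
qed

lemma psd_cts_comp_right: "psd_cts \<Phi> \<Longrightarrow> psd_cts (\<lambda>A. B \<odot> \<Phi> A)"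
proof (rule psd_cts_comp[of "\<lambda>A. B \<odot> A"])
  obtain M where M: "deg_le M B" using ex_deg_le by blast
  show "psd_cts (\<lambda>A. B \<odot> A)"
    using deg_le_comp[OF M] by (intro psd_ctsI[where d = M]) (simp_all add: comp_add_right add.commute)
qed

lemma psd_cts_fls_map:
  assumes "\<And>a b. f (a + b) = f a + f b" "psd_cts \<Phi>"
  shows "psd_cts (\<lambda>A. fls_map f (\<Phi> A))"
proof (rule psd_cts_comp[of "fls_map f", OF _ assms(2)])
  have "f 0 = 0" by (rule additive_zero) (rule assms)
  thus "psd_cts (fls_map f)"
    by (intro psd_ctsI[where d = 0]) (auto intro!: fls_eqI simp: assms fls_map_deg_le)
qed

lemma psd_cts_const_mult:
  fixes c :: "'a::ring_1"
  shows "psd_cts \<Phi> \<Longrightarrow> psd_cts (\<lambda>A. fls_const c * \<Phi> A)"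
  by (rule psd_cts_comp[of "\<lambda>A. fls_const c * A"])
    (auto intro!: psd_ctsI[where d = 0] simp: deg_le_def algebra_simps)

text \<open>The second hypothesis is an equivalence, so the induction also descends to negative
  powers.\<close>

lemma shift_const_induct:
  assumes "P (fls_const a)" "\<And>A. P (fls_shift 1 A) \<longleftrightarrow> P A"
  shows "P (fls_shift n (fls_const a))"
proof (induction n rule: int_induct[where k = 0])
  case (step1 i)
  have "fls_shift (i + 1) (fls_const a) = fls_shift 1 (fls_shift i (fls_const a))" by simp
  thus ?case using step1 assms(2) by metis
next
  case (step2 i)
  have "fls_shift i (fls_const a) = fls_shift 1 (fls_shift (i - 1) (fls_const a))" by simp
  thus ?case using step2 assms(2) by metis
qed (use assms in simp)

text \<open>A factor of the derivation on the right of A becomes an injective map f of the value;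
  cancelling f reaches the negative powers.\<close>

lemma psd_ext_shift:
  assumes "psd_cts L" "psd_cts R" "\<And>a. L (fls_const a) = R (fls_const a)" "inj f"
    "\<And>A. L (fls_shift 1 A) = f (L A)" "\<And>A. R (fls_shift 1 A) = f (R A)"
  shows "L A = R A"
proof -
  have "L (fls_shift n (fls_const a)) = R (fls_shift n (fls_const a))" for n a
    by (rule shift_const_induct) (use assms in \<open>auto dest: injD\<close>)
  hence "L A - R A = 0"
    using psd_cts_vanish[OF psd_cts_diff[OF assms(1,2)]] by simp
  thus ?thesis by simp
qed

text \<open>The main device for identities in two arguments: a factor of the derivation on the right
  of A moves into B as f. Equality is proved for all B in S at once, and surjectivity of f on S
  makes the step reversible, which yields negative powers.\<close>

lemma psd_ext_E:
  assumes cts: "\<And>B. B \<in> S \<Longrightarrow> psd_cts (\<lambda>A. L A B)" "\<And>B. B \<in> S \<Longrightarrow> psd_cts (\<lambda>A. R A B)"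
    and const: "\<And>a B. B \<in> S \<Longrightarrow> L (fls_const a) B = R (fls_const a) B"
    and E: "f ` S = S"
    and shift: "\<And>A B. B \<in> S \<Longrightarrow> L (fls_shift 1 A) B = L A (f B)"
      "\<And>A B. B \<in> S \<Longrightarrow> R (fls_shift 1 A) B = R A (f B)"
    and "B \<in> S"
  shows "L A B = R A B"
proof -
  have "\<forall>B\<in>S. L (fls_shift n (fls_const a)) B = R (fls_shift n (fls_const a)) B" for n a
  proof (rule shift_const_induct)
    fix A
    have "(\<forall>B\<in>S. L A (f B) = R A (f B)) \<longleftrightarrow> (\<forall>B\<in>S. L A B = R A B)"
      using E by (metis image_eqI imageE)
    thus "(\<forall>B\<in>S. L (fls_shift 1 A) B = R (fls_shift 1 A) B) \<longleftrightarrow> (\<forall>B\<in>S. L A B = R A B)"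
      by (simp add: shift)
  qed (simp add: const)
  hence "L A B - R A B = 0"
    using psd_cts_vanish[OF psd_cts_diff[OF cts]] \<open>B \<in> S\<close> by simp
  thus ?thesis by simp
qed

text \<open>Full associativity is not yet available, but \<open>comp_shift_left\<close> and
  \<open>comp_E_left\<close> are its instances with the derivation as the middle or the left factor.
  They suffice to show that left composition with the inverse of the derivation inverts
  \<open>psd_E\<close>.\<close>

lemma psd_E_bij: "bij psd_E"
proof (rule bijI')
  have r: "fls_shift (- 1) 1 \<odot> psd_E A = A" for A :: "'a fls"
    by (simp flip: comp_shift_left)
  have l: "psd_E (fls_shift (- 1) 1 \<odot> A) = A" for A :: "'a fls"
  proof -
    have "psd_E (fls_shift (- 1) 1) = (1 :: 'a fls)"
      by (rule fls_eqI) (simp add: psd_E_def)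
    thus ?thesis by (simp flip: comp_E_left)
  qed
  show "(psd_E A = psd_E B) \<longleftrightarrow> A = B" for A B :: "'a fls" using r by metis
  show "\<exists>A. B = psd_E A" for B :: "'a fls" using l by metis
qed

lemma comp_assoc: "(A \<odot> B) \<odot> C = A \<odot> (B \<odot> C)"
  by (rule psd_ext_E[where S = UNIV and f = psd_E and L = "\<lambda>A B. (A \<odot> B) \<odot> C" and R = "\<lambda>A B. A \<odot> (B \<odot> C)"])
    (simp_all add: psd_cts_comp_left psd_cts_ident comp_const_left comp_const_mult_left comp_shift_left
      comp_E_left bij_is_surj[OF psd_E_bij])

section \<open>Adjoints, inverses and homomorphisms\<close>

lemma psd_coeff_adjoint_box:
  assumes "deg_le M A" "int J \<ge> M - n"
  shows "psd_coeff (psd_adjoint A) n = (\<Sum>j\<le>J. (if even (n + int j) then 1 else - 1) *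
    of_int (int_binomial (n + int j) j) * (der ^^ j) (psd_coeff A (n + int j)))"
  unfolding psd_coeff_adjoint
proof (rule sum.mono_neutral_left)
  show "{j. psd_coeff A (n + int j) \<noteq> 0} \<subseteq> {..J}"
  proof
    fix j assume "j \<in> {j. psd_coeff A (n + int j) \<noteq> 0}"
    hence "n + int j \<le> M" using deg_leD[OF assms(1), of "n + int j"] not_le by blast
    thus "j \<in> {..J}" using assms(2) by auto
  qed
qed auto

lemma adjoint_add: "psd_adjoint (A + B) = psd_adjoint A + psd_adjoint B"
proof (rule psd_eqI)
  fix n
  obtain N where N: "deg_le N A" "deg_le N B" by (rule deg_le_obtain[where c=0])
  have N': "deg_le N (A + B)" using N by (simp add: deg_le_def)
  have J: "N - n \<le> int (nat (N - n))" by simp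
  show "psd_coeff (psd_adjoint (A + B)) n = psd_coeff (psd_adjoint A + psd_adjoint B) n"
    unfolding fls_plus_nth psd_coeff_adjoint_box[OF N(1) J] psd_coeff_adjoint_box[OF N(2) J]
      psd_coeff_adjoint_box[OF N' J] by (simp add: sum.distrib algebra_simps der_pow_add)
qed

lemmas adjoint_minus = additive_minus[of psd_adjoint, OF adjoint_add]
lemmas adjoint_sum = additive_sum[of psd_adjoint, OF adjoint_add]
lemmas adjoint_zero = additive_zero[of psd_adjoint, OF adjoint_add]

lemma adjoint_deg_le: "deg_le n A \<Longrightarrow> deg_le n (psd_adjoint A)"
  unfolding deg_le_def[of n "psd_adjoint A"]
proof (intro allI impI)
  fix m assume "deg_le n A" "n < m"
  thus "psd_coeff (psd_adjoint A) m = 0"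
    by (subst psd_coeff_adjoint_box[where J = 0]) (auto dest: deg_leD)
qed

lemma psd_cts_adjoint: "psd_cts \<Phi> \<Longrightarrow> psd_cts (\<lambda>A. psd_adjoint (\<Phi> A))"
  by (rule psd_cts_comp[of psd_adjoint]) (auto intro!: psd_ctsI[where d = 0] simp: adjoint_add adjoint_deg_le)

lemma adjoint_const: "psd_adjoint (fls_const c) = fls_const c"
proof (rule psd_eqI)
  fix n
  let ?t = "\<lambda>j. (if even (n + int j) then 1 else - 1) *
    of_int (int_binomial (n + int j) j) * (der ^^ j) (psd_coeff (fls_const c) (n + int j))"
  have "?t j = 0" if "n + int j \<noteq> 0" for j using that by simp
  moreover have "int_binomial 0 j = (if j = 0 then 1 else 0)" for j by (rule int_binomial_0_left)
  ultimately have "?t j = (if j = 0 then psd_coeff (fls_const c) n else 0)" for j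
    by (cases "n + int j = 0") auto
  moreover have "psd_coeff (psd_adjoint (fls_const c)) n = (\<Sum>j\<le>nat (- n). ?t j)"
    by (rule psd_coeff_adjoint_box[OF deg_le_const]) simp
  ultimately show "psd_coeff (psd_adjoint (fls_const c)) n = psd_coeff (fls_const c) n"
    by simp
qed

lemma adjoint_der: "psd_adjoint (der A) = der (psd_adjoint A)"
proof (rule psd_eqI)
  fix n
  obtain N where N: "deg_le N A" using ex_deg_le by blast
  have N': "deg_le N (der A)" using N by (simp add: deg_le_def)
  have J: "N - n \<le> int (nat (N - n))" by simp
  have t: "der ((if b then 1 else - 1) * of_int i * (der ^^ j) a) = (if b then 1 else - 1) * of_int i * (der ^^ j) (der a)"
    for i j b and a :: 'a
    by (auto simp add: der_mult der_of_int funpow_swap1 additive_minus[of der, OF der_add])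
  show "psd_coeff (psd_adjoint (der A)) n = psd_coeff (der (psd_adjoint A)) n"
    unfolding der_fls_nth psd_coeff_adjoint_box[OF N J] psd_coeff_adjoint_box[OF N' J]
    by (simp only: der_sum t)
qed

text \<open>Pascal's rule splits the coefficient of order n in two sums: one is minus the
  coefficient of order n - 1 of the adjoint of A, the other minus the derivative of its coefficient
  of order n.\<close>

lemma adjoint_shift: "psd_adjoint (fls_shift 1 A) = - psd_E (psd_adjoint A)"
proof (rule psd_eqI)
  fix n
  obtain N where N: "deg_le N A" using ex_deg_le by blast
  define J where "J = nat (N + 1 - n)"
  define c where "c = psd_coeff A"
  let ?s = "\<lambda>i::int. if even i then 1 else - 1 :: 'a"
  let ?t = "\<lambda>j. (der ^^ j) (c (n + int j - 1))"
  have "c (n + int (Suc J) - 1) = 0" unfolding c_def by (rule deg_leD[OF N]) (simp add: J_def)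
  hence z: "?t (Suc J) = 0" by (simp only: der_funpow_0)
  have s: "?s (n - 1 + int j) = - ?s (n + int j)" for j by (cases "even n"; cases "even j") simp_all
  have "psd_coeff (psd_adjoint (fls_shift 1 A)) n = (\<Sum>j\<le>Suc J. ?s (n + int j) * of_int (int_binomial (n + int j) j) * ?t j)"
    using psd_coeff_adjoint_box[OF deg_le_shift[OF N], of 1 n "Suc J"]
    unfolding psd_coeff_shift c_def J_def by (simp add: algebra_simps)
  also have "\<dots> = ?s n * ?t 0 + (\<Sum>j\<le>J. ?s (n + int (Suc j)) * of_int (int_binomial (n + int (Suc j)) (Suc j)) * ?t (Suc j))"
    by (subst sum.atMost_Suc_shift) simp
  also have "(\<Sum>j\<le>J. ?s (n + int (Suc j)) * of_int (int_binomial (n + int (Suc j)) (Suc j)) * ?t (Suc j))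
     = (\<Sum>j\<le>J. ?s (n + int (Suc j)) * of_int (int_binomial (n + int j) (Suc j)) * ?t (Suc j))
     + (\<Sum>j\<le>J. ?s (n + int (Suc j)) * of_int (int_binomial (n + int j) j) * ?t (Suc j))"
  proof -
    have "int_binomial (n + int (Suc j)) (Suc j) = int_binomial (n + int j) (Suc j) + int_binomial (n + int j) j" for j
      using int_binomial_Suc_Suc[of "n + int j" j] by (simp add: add.commute add.left_commute)
    thus ?thesis by (simp only: of_int_add distrib_left distrib_right sum.distrib)
  qed
  also have "?s n * ?t 0 + (\<dots>) = (\<Sum>j\<le>Suc J. ?s (n + int j) * of_int (int_binomial (n - 1 + int j) j) * ?t j)
     + (\<Sum>j\<le>J. ?s (n + int (Suc j)) * of_int (int_binomial (n + int j) j) * ?t (Suc j))"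
    by (subst sum.atMost_Suc_shift[of _ J]) simp
  also have "(\<Sum>j\<le>Suc J. ?s (n + int j) * of_int (int_binomial (n - 1 + int j) j) * ?t j)
     = - psd_coeff (psd_adjoint A) (n - 1)"
  proof -
    have "psd_coeff (psd_adjoint A) (n - 1) = (\<Sum>j\<le>Suc J. ?s (n - 1 + int j) * of_int (int_binomial (n - 1 + int j) j) *
        (der ^^ j) (psd_coeff A (n - 1 + int j)))"
      by (rule psd_coeff_adjoint_box[OF N]) (simp add: J_def)
    also have "\<dots> = (\<Sum>j\<le>Suc J. - (?s (n + int j) * of_int (int_binomial (n - 1 + int j) j) * ?t j))"
      unfolding s c_def by (simp add: algebra_simps)
    finally show ?thesis unfolding sum_negf by simp
  qed
  also have "(\<Sum>j\<le>J. ?s (n + int (Suc j)) * of_int (int_binomial (n + int j) j) * ?t (Suc j))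
     = - psd_coeff (psd_adjoint (der A)) n"
  proof -
    have "deg_le N (der A)" using N by (simp add: deg_le_def)
    hence "psd_coeff (psd_adjoint (der A)) n = (\<Sum>j\<le>J. ?s (n + int j) * of_int (int_binomial (n + int j) j) *
        (der ^^ j) (psd_coeff (der A) (n + int j)))"
      by (rule psd_coeff_adjoint_box) (simp add: J_def)
    also have "\<dots> = (\<Sum>j\<le>J. - (?s (n + int (Suc j)) * of_int (int_binomial (n + int j) j) * ?t (Suc j)))"
    proof (rule sum.cong)
      fix j
      have "?s (n + int j) = - ?s (n + int (Suc j))" by (cases "even n"; cases "even j") simp_all
      moreover have "(der ^^ j) (psd_coeff (der A) (n + int j)) = ?t (Suc j)"
        by (simp add: c_def funpow_swap1)
      ultimately show "?s (n + int j) * of_int (int_binomial (n + int j) j) *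
        (der ^^ j) (psd_coeff (der A) (n + int j)) = - (?s (n + int (Suc j)) * of_int (int_binomial (n + int j) j) * ?t (Suc j))"
        by (simp only: mult_minus_left)
    qed simp
    finally show ?thesis unfolding sum_negf by simp
  qed
  finally show "psd_coeff (psd_adjoint (fls_shift 1 A)) n = psd_coeff (- psd_E (psd_adjoint A)) n"
    by (simp add: psd_E_def adjoint_der)
qed

lemma adjoint_E: "psd_adjoint (psd_E A) = - fls_shift 1 (psd_adjoint A)"
  by (simp add: psd_E_def[of A] adjoint_add adjoint_shift adjoint_der) (simp add: psd_E_def)

lemma const_times_shift: "fls_const (a :: 'a::comm_ring_1) * fls_shift k B = fls_shift k (fls_const a * B)"
  by (rule fls_eqI) simp

lemma inj_E: "inj psd_E"
  by (rule bij_is_inj[OF psd_E_bij])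

lemma inj_neg_E: "inj (\<lambda>A. - psd_E A)"
  using inj_E by (simp add: inj_def)

lemma adjoint_const_mult: "psd_adjoint (fls_const a * B) = psd_adjoint B \<odot> fls_const a"
proof (rule psd_ext_shift[where L = "\<lambda>B. psd_adjoint (fls_const a * B)" and f = "\<lambda>A. - psd_E A"])
  fix b show "psd_adjoint (fls_const a * fls_const b) = psd_adjoint (fls_const b) \<odot> fls_const a"
    by (simp add: adjoint_const comp_const_left mult.commute)
qed (simp_all add: psd_cts_adjoint psd_cts_const_mult psd_cts_ident psd_cts_comp_left inj_neg_E
      adjoint_shift const_times_shift comp_E_left)

lemma adjoint_comp: "psd_adjoint (A \<odot> B) = psd_adjoint B \<odot> psd_adjoint A"
  by (rule psd_ext_E[where S = UNIV and f = psd_E and L = "\<lambda>A B. psd_adjoint (A \<odot> B)"])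
    (simp_all add: psd_cts_adjoint psd_cts_comp_left psd_cts_comp_right psd_cts_ident bij_is_surj[OF psd_E_bij]
      adjoint_const adjoint_const_mult comp_const_left comp_shift_left adjoint_shift adjoint_E)

lemma adjoint_adjoint: "psd_adjoint (psd_adjoint A) = A"
  by (rule psd_ext_shift[where f = "fls_shift 1"])
    (simp_all add: psd_cts_adjoint psd_cts_ident adjoint_const adjoint_shift adjoint_minus adjoint_E inj_def fls_shift_eq_iff)

lemma adjoint_one: "psd_adjoint 1 = 1"
  using adjoint_const[of 1] by simp

text \<open>The adjoint is an involutive antiautomorphism, so this is the mirror image of
  \<open>comp_one_left\<close>.\<close>

lemma comp_one_right [simp]: "A \<odot> 1 = A"
  using adjoint_comp[of 1 "psd_adjoint A"] by (simp add: adjoint_adjoint adjoint_one)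

text \<open>The inverse is the Neumann series of Z. The power i of Z has order at most - i, so every
  coefficient of the partial sums becomes stationary.\<close>

lemma geometric_inverse:
  assumes Z: "deg_le (- 1) Z"
  shows "\<exists>G. (1 - Z) \<odot> G = 1"
proof -
  define p where "p i = (((\<odot>) Z) ^^ i) 1" for i
  define s where "s K = (\<Sum>i\<le>K. p i)" for K
  have p: "deg_le (- int i) (p i)" for i
  proof (induction i)
    case (Suc i)
    thus ?case using deg_le_comp[OF Z Suc] by (simp add: p_def)
  qed (simp add: p_def deg_le_def)
  \<comment> \<open>The coefficient of order n is taken from the partial sum with index - n, from
    which on it no longer changes.\<close>
  define G where "G = Abs_fls (\<lambda>k. psd_coeff (s (nat k)) (- k))"
  have sc: "psd_coeff (s (nat (- n) + L)) n = psd_coeff (s (nat (- n))) n" for n L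
  proof (induction L)
    case (Suc L)
    have "psd_coeff (p (nat (- n) + Suc L)) n = 0" by (rule deg_leD[OF p]) simp
    thus ?case using Suc by (simp add: s_def)
  qed simp
  have G: "psd_coeff G n = psd_coeff (s (nat (- n))) n" for n
  proof -
    have "psd_coeff (s (nat k)) (- k) = 0" if "k < 0" for k
      unfolding s_def fls_nth_sum using that by (intro sum.neutral ballI deg_leD[OF p]) simp
    thus ?thesis unfolding G_def by (subst nth_Abs_fls_lower_bound[of 0]) auto
  qed
  have tel: "(1 - Z) \<odot> s K = 1 - p (Suc K)" for K
    by (induction K) (simp_all add: s_def p_def comp_diff_left comp_add_right)
  have "psd_coeff ((1 - Z) \<odot> G) n = psd_coeff 1 n" for n
  proof -
    define K where "K = nat (- n)"
    have "deg_le (- int K - 1) (G - s K)"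
      unfolding deg_le_def
    proof (intro allI impI)
      fix m assume "- int K - 1 < m"
      hence "nat (- m) \<le> K" by simp
      then obtain L where "K = nat (- m) + L" using le_Suc_ex by blast
      thus "psd_coeff (G - s K) m = 0" using sc[of m L] G[of m] by simp
    qed
    moreover have "deg_le 0 (1 - Z)" using Z by (simp add: deg_le_def)
    ultimately have "deg_le (0 + (- int K - 1)) ((1 - Z) \<odot> (G - s K))" by (intro deg_le_comp)
    hence "psd_coeff ((1 - Z) \<odot> (G - s K)) n = 0" by (rule deg_leD) (simp add: K_def)
    moreover have "psd_coeff (p (Suc K)) n = 0" by (rule deg_leD[OF p]) (simp add: K_def)
    ultimately show ?thesis using tel[of K] by (simp add: comp_diff_right)
  qed
  thus ?thesis using psd_eqI by blast
qed

lemma ex_right_inverse: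
  fixes A :: "'k::{differential_idom, field} fls"
  assumes "A \<noteq> 0"
  shows "\<exists>B. A \<odot> B = 1"
proof -
  define m where "m = - fls_subdegree A"
  have m: "deg_le m A" by (simp add: deg_le_def m_def)
  define a where "a = psd_coeff A m"
  have a: "a \<noteq> 0" using assms by (simp add: a_def m_def)
  \<comment> \<open>The inverse of the leading monomial up to lower order:
    \<open>A \<odot> B\<close> has order 0 and leading coefficient 1, so it differs from 1 by an
    operator of negative order.\<close>
  define B where "B = fls_shift (- m) (fls_const (inverse a))"
  have B: "deg_le (- m) B" unfolding B_def using deg_le_shift[OF deg_le_const, of "- m"] by simp
  have "psd_coeff (A \<odot> B) 0 = 1"
    using psd_coeff_comp_box[OF m B, of m 0 m 0] a by (simp add: B_def a_def)
  moreover have "psd_coeff (A \<odot> B) k = 0" if "k > 0" for k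
    using deg_leD[OF deg_le_comp[OF m B]] that by simp
  ultimately have "psd_coeff (1 - A \<odot> B) k = 0" if "k > - 1" for k
    using that by (cases "k = 0") auto
  hence "deg_le (- 1) (1 - A \<odot> B)" by (simp only: deg_le_def) blast
  from geometric_inverse[OF this] obtain G where "(A \<odot> B) \<odot> G = 1" by auto
  thus ?thesis unfolding comp_assoc by blast
qed

lemma ex_inverse:
  fixes A :: "'k::{differential_idom, field} fls"
  assumes "A \<noteq> 0"
  shows "\<exists>B. A \<odot> B = 1 \<and> B \<odot> A = 1"
proof -
  obtain B where B: "A \<odot> B = 1" using ex_right_inverse[OF assms] by blast
  hence "B \<noteq> 0" by auto
  then obtain C where C: "B \<odot> C = 1" using ex_right_inverse by blast
  have "A = C" using B C comp_assoc[of A B C] by simp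
  thus ?thesis using B C by blast
qed

text \<open>The operators satisfying P form a subskewfield containing the differential operators.
  Inverses can be taken in the skewfield of all pseudodifferential operators over the fractions,
  where they exist by \<open>ex_inverse\<close>.\<close>

lemma rational_induct [consumes 1, case_names const partial diff comp inverse]:
  fixes A :: "'v::differential_idom fract fls"
  assumes "A \<in> rational_over_fractions"
    and const: "\<And>a. P (fls_const a)" and partial: "P (fls_shift 1 1)"
    and diff: "\<And>A B. P A \<Longrightarrow> P B \<Longrightarrow> P (A - B)"
    and comp: "\<And>A B. P A \<Longrightarrow> P B \<Longrightarrow> P (A \<odot> B)"
    and inverse: "\<And>A B. P A \<Longrightarrow> A \<odot> B = 1 \<Longrightarrow> B \<odot> A = 1 \<Longrightarrow> P B"
  shows "P A"
proof -
  have "subskewfield {A. P A}"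
    unfolding subskewfield_def
  proof (intro conjI ballI impI)
    fix A assume "A \<in> {A. P A}" "A \<noteq> 0"
    moreover from ex_inverse[OF this(2)] obtain B where "A \<odot> B = 1" "B \<odot> A = 1" by blast
    ultimately show "\<exists>B\<in>{A. P A}. A \<odot> B = 1 \<and> B \<odot> A = 1" using inverse[of A B] by blast
  qed (use const[of 1] diff comp in auto)
  moreover have "P (to_fraction_psd D)" if "D \<in> differential_operators" for D
  proof -
    let ?F = "to_fraction_psd D"
    have 0: "P 0" using const[of 0] by simp
    have add: "P (A + B)" if "P A" "P B" for A B
      using diff[OF that(1) diff[OF 0 that(2)]] by simp
    obtain N where N: "deg_le N ?F" using ex_deg_le by blast
    have z: "psd_coeff ?F n = 0" if "n < 0" for n
      using \<open>D \<in> _\<close> that by (simp add: to_fraction_psd_def differential_operators_def Zero_fract_def)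
    have pow: "P (fls_shift (int n) 1)" for n
    proof (induction n)
      case (Suc n)
      have "fls_shift 1 1 \<odot> fls_shift (int n) 1 = (fls_shift (int (Suc n)) 1 :: 'v fract fls)"
        by (simp add: comp_shift_right add.commute)
      thus ?case using comp[OF partial Suc] by simp
    qed (use const[of 1] in simp)
    have "P (\<Sum>n\<le>k. fls_const (psd_coeff ?F (int n)) \<odot> fls_shift (int n) 1)" for k
    proof (induction k)
      case 0
      show ?case using comp[OF const pow[of 0]] by simp
    next
      case (Suc k)
      thus ?case unfolding sum.atMost_Suc by (rule add[OF _ comp[OF const pow]])
    qed
    moreover have "(\<Sum>n\<le>nat N. fls_const (psd_coeff ?F (int n)) \<odot> fls_shift (int n) 1) = ?F"
    proof (rule psd_eqI)
      fix m
      have "psd_coeff (fls_const (psd_coeff ?F (int n)) \<odot> fls_shift (int n) 1) m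
          = (if n = nat m then psd_coeff ?F m else 0)" for n
        using z[of m] by (auto simp: comp_const_left)
      thus "psd_coeff (\<Sum>n\<le>nat N. fls_const (psd_coeff ?F (int n)) \<odot> fls_shift (int n) 1) m = psd_coeff ?F m"
        using deg_leD[OF N, of m] by (auto simp: fls_nth_sum)
    qed
    ultimately show ?thesis by (metis (no_types))
  qed
  hence "to_fraction_psd ` differential_operators \<subseteq> {A. P A}" by blast
  ultimately have "rational_over_fractions \<subseteq> {A. P A}"
    unfolding rational_over_fractions_def by (intro Inter_lower) blast
  thus ?thesis using assms(1) by blast
qed

lemma rational_closed:
  shows "1 \<in> rational_over_fractions"
    and "A \<in> rational_over_fractions \<Longrightarrow> B \<in> rational_over_fractions \<Longrightarrow> A - B \<in> rational_over_fractions"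
    and "A \<in> rational_over_fractions \<Longrightarrow> B \<in> rational_over_fractions \<Longrightarrow> A \<odot> B \<in> rational_over_fractions"
  unfolding rational_over_fractions_def by (auto simp: subskewfield_def)

section \<open>Homomorphisms of differential rings, applied to coefficients\<close>

definition diff_hom :: "('a::differential_ring \<Rightarrow> 'b::differential_ring) \<Rightarrow> bool" where
  "diff_hom \<phi> \<longleftrightarrow> (\<forall>a b. \<phi> (a + b) = \<phi> a + \<phi> b) \<and> (\<forall>a b. \<phi> (a * b) = \<phi> a * \<phi> b) \<and> \<phi> 1 = 1 \<and>
     (\<forall>a. \<phi> (der a) = der (\<phi> a))"

context
  fixes \<phi> :: "'a::differential_ring \<Rightarrow> 'b::differential_ring"
  assumes hom: "diff_hom \<phi>"
begin

lemma diff_hom_add: "\<phi> (a + b) = \<phi> a + \<phi> b" and diff_hom_mult: "\<phi> (a * b) = \<phi> a * \<phi> b"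
  and diff_hom_one: "\<phi> 1 = 1" and diff_hom_der: "\<phi> (der a) = der (\<phi> a)"
  using hom by (auto simp: diff_hom_def)

lemma diff_hom_zero: "\<phi> 0 = 0"
  by (rule additive_zero) (rule diff_hom_add)

lemma diff_hom_of_int: "\<phi> (of_int i) = of_int i"
  by (induction i rule: int_induct[where k = 0])
    (simp_all add: diff_hom_zero diff_hom_one diff_hom_add additive_diff[of \<phi>, OF diff_hom_add])

lemma diff_hom_der_pow: "\<phi> ((der ^^ j) a) = (der ^^ j) (\<phi> a)"
  by (induction j) (simp_all add: diff_hom_der)

lemma fls_map_comp_hom: "fls_map \<phi> (A \<odot> B) = fls_map \<phi> A \<odot> fls_map \<phi> B"
proof (rule psd_eqI)
  fix n
  obtain N where N: "deg_le N A" using ex_deg_le by blast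
  obtain M where M: "deg_le M B" using ex_deg_le by blast
  note N' = fls_map_deg_le[of \<phi>, OF diff_hom_zero N] and M' = fls_map_deg_le[of \<phi>, OF diff_hom_zero M]
  note box = psd_coeff_comp_box'[where n = n]
  show "psd_coeff (fls_map \<phi> (A \<odot> B)) n = psd_coeff (fls_map \<phi> A \<odot> fls_map \<phi> B) n"
    unfolding box[OF N' M'] fls_map_nth[of \<phi>, OF diff_hom_zero] box[OF N M]
    by (simp add: additive_sum[of \<phi>, OF diff_hom_add] diff_hom_mult diff_hom_of_int diff_hom_der_pow)
qed

lemma fls_map_adjoint_hom: "fls_map \<phi> (psd_adjoint A) = psd_adjoint (fls_map \<phi> A)"
proof (rule psd_eqI)
  fix n
  obtain N where N: "deg_le N A" using ex_deg_le by blast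
  note N' = fls_map_deg_le[of \<phi>, OF diff_hom_zero N]
  have J: "N - n \<le> int (nat (N - n))" by simp
  have s: "\<phi> (if b then 1 else - 1) = (if b then 1 else - 1)" for b
    by (simp add: diff_hom_one additive_minus[of \<phi>, OF diff_hom_add])
  show "psd_coeff (fls_map \<phi> (psd_adjoint A)) n = psd_coeff (psd_adjoint (fls_map \<phi> A)) n"
    unfolding psd_coeff_adjoint_box[OF N' J] fls_map_nth[of \<phi>, OF diff_hom_zero] psd_coeff_adjoint_box[OF N J]
    by (simp only: additive_sum[of \<phi>, OF diff_hom_add] diff_hom_mult diff_hom_of_int diff_hom_der_pow s)
qed

end

text \<open>Makes \<open>psd_lift\<close> multiplicative for composition.\<close>

lemma diff_hom_fls_const: "diff_hom fls_const"
  unfolding diff_hom_def by (auto intro!: fls_eqI)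

section \<open>Bidifferential operators\<close>

text \<open>
  A series \<open>F :: 'a fls fls\<close>, outer variable \<open>\<mu>\<close> and inner variable \<open>\<lambda>\<close>, is a bidifferential
  operator with two arguments: \<open>\<lambda>\<close> stands for \<open>\<partial>\<close> acting on the first one and \<open>\<mu>\<close> for \<open>\<partial>\<close>
  acting on the second one. \<open>psd_sigma A \<odot> F\<close> applies \<open>A\<close> to the result, and \<open>F \<lhd> P\<close> and
  \<open>F \<rhd> Q\<close> apply \<open>P\<close> and \<open>Q\<close> to the arguments.
\<close>

definition psd_lift :: "'a::zero fls \<Rightarrow> 'a fls fls" where
  "psd_lift = fls_map fls_const"

lemma psd_lift_nth [simp]: "psd_lift A $$ n = fls_const (A $$ n)"
  by (simp add: psd_lift_def)

text \<open>The series A(lambda + mu) expanded in non-negative powers of lambda, that is for |mu| >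
  |lambda|: the coefficient of lambda^p mu^q is that of A at p + q times the binomial coefficient of
  p + q over p.\<close>

definition psd_sigma :: "'a::comm_ring_1 fls \<Rightarrow> 'a fls fls" where
  "psd_sigma A = Abs_fls (\<lambda>r. Abs_fls (\<lambda>s.
     if s \<le> 0 then of_int (int_binomial (- r - s) (nat (- s))) * A $$ (r + s) else 0))"

lemma psd_coeff_sigma:
  "psd_coeff (psd_coeff (psd_sigma A) q) p =
     (if p \<ge> 0 then of_int (int_binomial (q + p) (nat p)) * psd_coeff A (q + p) else 0)"
proof -
  let ?f = "\<lambda>r s. if s \<le> 0 then of_int (int_binomial (- r - s) (nat (- s))) * A $$ (r + s) else 0"
  obtain M where M: "deg_le M A" using ex_deg_le by blast
  have z: "A $$ k = 0" if "k < - M" for k using deg_leD[OF M, of "- k"] that by simp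
  have inner: "Abs_fls (?f r) $$ s = ?f r s" for r s
    by (rule nth_Abs_fls_lower_bound[of "- M - r"]) (auto simp: z)
  have "psd_sigma A $$ r = Abs_fls (?f r)" for r
    unfolding psd_sigma_def
    by (rule nth_Abs_fls_lower_bound[of "- M"]) (auto intro!: fls_eqI simp: inner z)
  thus ?thesis by (simp add: inner)
qed

lemma psd2_eqI: "(\<And>q p. psd_coeff (psd_coeff F q) p = psd_coeff (psd_coeff G q) p) \<Longrightarrow> F = G"
  by (intro psd_eqI) blast

lemma sigma_add: "psd_sigma (A + B) = psd_sigma A + psd_sigma B"
  by (rule psd2_eqI) (simp add: psd_coeff_sigma algebra_simps del: minus_add_distrib)

lemma sigma_der: "psd_sigma (der A) = der (psd_sigma A)"
proof (rule psd2_eqI)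
  fix q p
  show "psd_coeff (psd_coeff (psd_sigma (der A)) q) p = psd_coeff (psd_coeff (der (psd_sigma A)) q) p"
    unfolding der_fls_nth psd_coeff_sigma by (simp add: der_mult der_of_int)
qed

lemma sigma_const: "psd_sigma (fls_const a) = fls_const (fls_const a)"
proof (rule psd2_eqI)
  fix q p
  show "psd_coeff (psd_coeff (psd_sigma (fls_const a)) q) p = psd_coeff (psd_coeff (fls_const (fls_const a)) q) p"
    unfolding psd_coeff_sigma by (auto simp: int_binomial_0_left)
qed

lemma psd_coeff_X_inv_mult: "psd_coeff (fls_X_inv * f) n = psd_coeff (f :: 'a::comm_ring_1 fls) (n - 1)"
  by (simp only: fls_X_inv_times_conv_shift psd_coeff_shift)

text \<open>Multiplication by lambda + mu, which is Pascal's rule on coefficients. At p = 0 only the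
  summand with mu contributes.\<close>

lemma sigma_shift: "psd_sigma (fls_shift 1 A) = fls_shift 1 (psd_sigma A) + fls_const fls_X_inv * psd_sigma A"
proof (rule psd2_eqI)
  fix q p :: int
  have "psd_coeff (psd_coeff (fls_shift 1 (psd_sigma A) + fls_const fls_X_inv * psd_sigma A) q) p
    = psd_coeff (psd_coeff (psd_sigma A) (q - 1)) p + psd_coeff (psd_coeff (psd_sigma A) q) (p - 1)"
    by (simp only: fls_plus_nth psd_coeff_shift fls_mult_const_nth psd_coeff_X_inv_mult)
  also have "\<dots> = psd_coeff (psd_coeff (psd_sigma (fls_shift 1 A)) q) p"
  proof (cases "p \<ge> 1")
    case True
    define k where "k = nat (p - 1)"
    have p: "p = int (Suc k)" using True by (simp add: k_def)
    define X where "X = q + int k"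
    have e: "q - 1 + p = X" "q + (p - 1) = X" "q + p = X + 1" "X + 1 - 1 = X" "nat p = Suc k" "nat (p - 1) = k"
      "(0 \<le> p) = True" "(0 \<le> p - 1) = True"
      by (simp_all add: p X_def)
    show ?thesis
      unfolding psd_coeff_sigma psd_coeff_shift e int_binomial_Suc_Suc of_int_add if_True
      by (simp only: distrib_right)
  next
    case False
    hence e: "(0 \<le> p - 1) = False" by simp
    show ?thesis
    proof (cases "p = 0")
      case True
      have e': "q - 1 + 0 = q - 1" "q + 0 - 1 = q - 1" "(0 \<le> (0::int)) = True" by simp_all
      show ?thesis unfolding psd_coeff_sigma psd_coeff_shift e if_False True e' by simp
    next
      case False
      hence "(0 \<le> p) = False" using e by simp
      thus ?thesis unfolding psd_coeff_sigma e by simp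
    qed
  qed
  finally show "psd_coeff (psd_coeff (psd_sigma (fls_shift 1 A)) q) p =
    psd_coeff (psd_coeff (fls_shift 1 (psd_sigma A) + fls_const fls_X_inv * psd_sigma A) q) p" ..
qed

lemma psd_cts_sigma:
  fixes \<Phi> :: "'b::ab_group_add fls \<Rightarrow> 'a::comm_ring_1 fls"
  shows "psd_cts \<Phi> \<Longrightarrow> psd_cts (\<lambda>A. psd_sigma (\<Phi> A))"
proof (rule psd_cts_comp[of psd_sigma], rule psd_ctsI[where d = 0])
  fix n and A :: "'a fls" assume A: "deg_le n A"
  show "deg_le (n + 0) (psd_sigma A)"
    unfolding deg_le_def
  proof (intro allI impI)
    fix m assume m: "n + 0 < m"
    show "psd_coeff (psd_sigma A) m = 0"
    proof (rule psd_eqI)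
      fix p
      show "psd_coeff (psd_coeff (psd_sigma A) m) p = psd_coeff 0 p"
        unfolding psd_coeff_sigma using deg_leD[OF A, of "m + p"] m by (cases "p \<ge> 0") auto
    qed
  qed
qed (auto simp: sigma_add)

lemma sigma_one [simp]: "psd_sigma 1 = 1"
  using sigma_const[of 1] by simp

text \<open>\<open>psd_E2\<close> is the left action of \<open>\<partial>\<close>.\<close>

definition psd_E2 :: "'a::differential_ring fls fls \<Rightarrow> 'a fls fls" where
  "psd_E2 F = fls_shift 1 F + fls_map psd_E F"

lemma E_0: "psd_E 0 = 0"
  by (rule fls_eqI) (simp add: psd_E_def)

text \<open>Shows the left action of the derivation as lambda + mu plus the derivation of the
  coefficients.\<close>

lemma E2_alt: "psd_E2 F = psd_E F + fls_const fls_X_inv * F"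
  by (rule fls_eqI) (simp add: psd_E2_def psd_E_def[of F] psd_E_def[of "_ $$ _"] E_0 fls_X_inv_times_conv_shift)

lemma der_X_inv [simp]: "der (fls_X_inv :: 'a::differential_ring fls) = 0"
  by (rule fls_eqI) simp

lemma sigma_shift_comp: "psd_sigma (fls_shift 1 A) \<odot> F = psd_sigma A \<odot> psd_E2 F"
  by (simp add: sigma_shift comp_add_left comp_shift_left comp_const_mult_left E2_alt comp_add_right comp_const_right)

lemma E2_sigma: "psd_E2 (psd_sigma A) = psd_sigma (psd_E A)"
  by (simp add: E2_alt psd_E_def sigma_add sigma_shift sigma_der)

lemma E2_comp: "psd_E2 F \<odot> G = psd_E2 (F \<odot> G)"
  by (simp add: E2_alt comp_add_left comp_E_left comp_const_mult_left)

lemma sigma_const_mult: "psd_sigma (fls_const a * A) = fls_const (fls_const a) * psd_sigma A"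
  by (rule psd2_eqI) (simp add: psd_coeff_sigma algebra_simps del: minus_add_distrib)

text \<open>Composition in the variable mu alone reproduces composition of the original operators,
  because the derivation enters A only through lambda + mu plus the derivation of the
  coefficients.\<close>

lemma sigma_comp: "psd_sigma (A \<odot> B) = psd_sigma A \<odot> psd_sigma B"
  by (rule psd_ext_E[where S = UNIV and f = psd_E and L = "\<lambda>A B. psd_sigma (A \<odot> B)"])
    (simp_all add: psd_cts_sigma psd_cts_comp_left psd_cts_ident bij_is_surj[OF psd_E_bij] comp_const_left
      sigma_const sigma_shift_comp E2_sigma comp_shift_left sigma_const_mult)

lemma sigma_cancel: "A \<odot> B = 1 \<Longrightarrow> psd_sigma A \<odot> (psd_sigma B \<odot> F) = F"
  by (simp flip: comp_assoc sigma_comp)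

lemma E2_conv_comp: "psd_E2 F = psd_sigma (fls_shift 1 1) \<odot> F"
  by (simp add: sigma_shift_comp)

lemma bij_E2: "bij psd_E2"
proof (rule bijI')
  have i: "fls_shift 1 1 \<odot> fls_shift (- 1) 1 = (1 :: 'a fls)" "fls_shift (- 1) 1 \<odot> fls_shift 1 1 = (1 :: 'a fls)"
    by (simp_all add: comp_shift_right)
  show "(psd_E2 F = psd_E2 G) \<longleftrightarrow> F = G" for F G :: "'a fls fls"
    unfolding E2_conv_comp using sigma_cancel[OF i(2)] by metis
  show "\<exists>F. G = psd_E2 F" for G :: "'a fls fls"
    unfolding E2_conv_comp using sigma_cancel[OF i(1)] by metis
qed

lemma lift_comp: "psd_lift (A \<odot> B) = psd_lift A \<odot> psd_lift B"
  unfolding psd_lift_def by (rule fls_map_comp_hom[OF diff_hom_fls_const])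

lemma lift_add: "psd_lift (A + B) = psd_lift A + psd_lift B"
  by (auto intro!: fls_eqI)

lemma lift_const: "psd_lift (fls_const a) = fls_const (fls_const a)"
  by (rule fls_eqI) simp

lemma lift_one [simp]: "psd_lift 1 = 1"
  using lift_const[of 1] by simp

lemma lift_E: "psd_lift (psd_E A) = psd_E (psd_lift A)"
proof -
  have "fls_const (der b) = der (fls_const b)" for b :: 'a
    by (rule fls_eqI) simp
  thus ?thesis by (intro fls_eqI) (simp add: psd_E_def lift_add flip: lift_add)
qed

definition slot1 :: "'a::differential_ring fls fls \<Rightarrow> 'a fls \<Rightarrow> 'a fls fls" (infixl "\<lhd>" 75) where
  "F \<lhd> P = fls_map (\<lambda>f. f \<odot> P) F"

definition slot2 :: "'a::differential_ring fls fls \<Rightarrow> 'a fls \<Rightarrow> 'a fls fls" (infixl "\<rhd>" 75) where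
  "F \<rhd> Q = F \<odot> psd_lift Q"

lemma slot1_nth [simp]: "(F \<lhd> P) $$ n = F $$ n \<odot> P"
  by (simp add: slot1_def)

lemma slot1_add: "(F + G) \<lhd> P = F \<lhd> P + G \<lhd> P" "F \<lhd> (P + P') = F \<lhd> P + F \<lhd> P'"
  by (auto intro!: fls_eqI simp: comp_add_left comp_add_right)

lemma slot2_add: "(F + G) \<rhd> P = F \<rhd> P + G \<rhd> P" "F \<rhd> (P + P') = F \<rhd> P + F \<rhd> P'"
  by (simp_all add: slot2_def comp_add_left comp_add_right lift_add)

lemma slot1_comp: "F \<lhd> (P \<odot> Q) = F \<lhd> P \<lhd> Q"
  by (rule fls_eqI) (simp add: comp_assoc)

lemma slot2_comp: "F \<rhd> (P \<odot> Q) = F \<rhd> P \<rhd> Q"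
  by (simp add: slot2_def lift_comp comp_assoc)

lemma slot_one [simp]: "F \<lhd> 1 = F" "F \<rhd> 1 = F"
  by (auto intro!: fls_eqI simp: slot2_def)

lemma slot2_left: "(F \<odot> G) \<rhd> Q = F \<odot> (G \<rhd> Q)"
  by (simp add: slot2_def comp_assoc)

lemma psd_cts_slot1: "psd_cts \<Phi> \<Longrightarrow> psd_cts (\<lambda>A. \<Phi> A \<lhd> P)"
  unfolding slot1_def by (rule psd_cts_fls_map) (simp add: comp_add_left)

lemma slot1_shift: "fls_shift k F \<lhd> P = fls_shift k (F \<lhd> P)"
  by (rule fls_eqI) simp

lemma slot1_const: "fls_const f \<lhd> P = fls_const (f \<odot> P)"
  by (rule fls_eqI) simp

lemma slot1_const_mult_lift: "(fls_const f * psd_lift Q) \<lhd> P = fls_const (f \<odot> P) * psd_lift Q"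
proof (rule fls_eqI)
  fix n
  have "(f * fls_const (Q $$ n)) \<odot> P = (f \<odot> P) * fls_const (Q $$ n)"
    by (subst (1 2) mult.commute) (rule comp_const_mult_left)
  thus "((fls_const f * psd_lift Q) \<lhd> P) $$ n = (fls_const (f \<odot> P) * psd_lift Q) $$ n" by simp
qed

lemma slot1_slot2: "(F \<rhd> Q) \<lhd> P = (F \<lhd> P) \<rhd> Q"
  unfolding slot2_def
proof (rule psd_ext_E[where S = UNIV and f = psd_E and L = "\<lambda>F Q. (F \<odot> psd_lift Q) \<lhd> P"
      and R = "\<lambda>F Q. (F \<lhd> P) \<odot> psd_lift Q"])
  fix a and Q :: "'a fls"
  show "(fls_const a \<odot> psd_lift Q) \<lhd> P = fls_const a \<lhd> P \<odot> psd_lift Q"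
    by (simp only: comp_const_left slot1_const slot1_const_mult_lift)
qed (simp_all add: psd_cts_slot1 psd_cts_comp_left psd_cts_ident bij_is_surj[OF psd_E_bij]
        comp_shift_left slot1_shift lift_E)

lemma slot1_E2: "psd_E2 F \<lhd> P = psd_E2 (F \<lhd> P)"
  by (rule fls_eqI) (simp add: psd_E2_def E_0 comp_add_left comp_E_left)

lemma slot1_left: "(psd_sigma A \<odot> F) \<lhd> P = psd_sigma A \<odot> (F \<lhd> P)"
proof (rule psd_ext_E[where S = UNIV and f = psd_E2 and L = "\<lambda>A F. (psd_sigma A \<odot> F) \<lhd> P"
          and R = "\<lambda>A F. psd_sigma A \<odot> (F \<lhd> P)"])
  fix a and F :: "'a fls fls"
  show "(psd_sigma (fls_const a) \<odot> F) \<lhd> P = psd_sigma (fls_const a) \<odot> (F \<lhd> P)"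
    by (rule fls_eqI) (simp add: sigma_const comp_const_left comp_const_mult_left)
qed (simp_all add: psd_cts_slot1 psd_cts_comp_left psd_cts_sigma psd_cts_ident bij_is_surj[OF bij_E2]
        sigma_shift_comp slot1_E2)

text \<open>Abstract form of the map sending f to the generating series of its partial derivatives
  in powers of lambda. The last clause is the commutation relation of all these partial derivatives
  with the derivation, collected in one series.\<close>

definition twisted_der :: "('a::differential_ring \<Rightarrow> 'a fls) \<Rightarrow> bool" where
  "twisted_der \<theta> \<longleftrightarrow> (\<forall>a b. \<theta> (a + b) = \<theta> a + \<theta> b) \<and>
     (\<forall>a b. \<theta> (a * b) = fls_const a * \<theta> b + fls_const b * \<theta> a) \<and> (\<forall>a. \<theta> (der a) = psd_E (\<theta> a))"

context
  fixes \<theta> :: "'a::differential_ring \<Rightarrow> 'a fls"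
  assumes \<theta>: "twisted_der \<theta>"
begin

lemma twisted_add: "\<theta> (a + b) = \<theta> a + \<theta> b"
  and twisted_mult: "\<theta> (a * b) = fls_const a * \<theta> b + fls_const b * \<theta> a"
  and twisted_der: "\<theta> (der a) = psd_E (\<theta> a)"
  using \<theta> by (auto simp: twisted_der_def)

lemma twisted_zero: "\<theta> 0 = 0"
  by (rule additive_zero) (rule twisted_add)

lemma twisted_one: "\<theta> 1 = 0"
  using twisted_mult[of 1 1] by simp

lemma delta_nth: "fls_map \<theta> A $$ n = \<theta> (A $$ n)"
  by (rule fls_map_nth) (rule twisted_zero)

lemma delta_add: "fls_map \<theta> (A + B) = fls_map \<theta> A + fls_map \<theta> B"
  by (rule fls_eqI) (simp add: delta_nth twisted_add)

lemma delta_const: "fls_map \<theta> (fls_const a) = fls_const (\<theta> a)"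
  by (rule fls_eqI) (simp add: delta_nth twisted_zero)

lemma delta_shift: "fls_map \<theta> (fls_shift k A) = fls_shift k (fls_map \<theta> A)"
  by (rule fls_eqI) (simp add: delta_nth)

lemma delta_E: "fls_map \<theta> (psd_E A) = psd_E2 (fls_map \<theta> A)"
  by (rule fls_eqI) (simp add: delta_nth psd_E_def[of A] psd_E2_def E_0 twisted_add twisted_der)

text \<open>For a constant A this is the product rule of \<open>\<theta>\<close>; a factor of the
  derivation passes from A to B because \<open>\<theta>\<close> intertwines \<open>psd_E\<close> and
  \<open>psd_E2\<close>. If the derivative falls on A, then B acts on the second argument; if it
  falls on B, then A acts on the result.\<close>

lemma delta_comp: "fls_map \<theta> (A \<odot> B) = fls_map \<theta> A \<rhd> B + psd_sigma A \<odot> fls_map \<theta> B"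
  unfolding slot2_def
proof (rule psd_ext_E[where S = UNIV and f = psd_E and L = "\<lambda>A B. fls_map \<theta> (A \<odot> B)"
      and R = "\<lambda>A B. fls_map \<theta> A \<odot> psd_lift B + psd_sigma A \<odot> fls_map \<theta> B"])
  fix a B
  show "fls_map \<theta> (fls_const a \<odot> B) = fls_map \<theta> (fls_const a) \<odot> psd_lift B + psd_sigma (fls_const a) \<odot> fls_map \<theta> B"
    by (rule fls_eqI) (simp add: delta_nth comp_const_left sigma_const delta_const twisted_mult mult.commute)
qed (simp_all add: psd_cts_fls_map twisted_add psd_cts_add psd_cts_comp_left psd_cts_sigma psd_cts_ident
      bij_is_surj[OF psd_E_bij] sigma_shift_comp delta_E comp_shift_left delta_shift lift_E)

lemma delta_inverse:
  assumes "A \<odot> B = 1" "B \<odot> A = 1"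
  shows "fls_map \<theta> B = - (psd_sigma B \<odot> (fls_map \<theta> A \<rhd> B))"
proof -
  have "fls_map \<theta> (1::'a fls) = 0"
    using delta_const[of 1] by (simp add: twisted_one)
  hence "psd_sigma A \<odot> fls_map \<theta> B = - (fls_map \<theta> A \<rhd> B)"
    using delta_comp[of A B] assms(1) by (simp add: add_eq_0_iff)
  hence "psd_sigma B \<odot> (psd_sigma A \<odot> fls_map \<theta> B) = - (psd_sigma B \<odot> (fls_map \<theta> A \<rhd> B))" by simp
  thus ?thesis by (simp only: sigma_cancel[OF assms(2)])
qed

end

section \<open>Series in three variables\<close>

definition bounded_by :: "int \<Rightarrow> (int \<Rightarrow> int \<Rightarrow> int \<Rightarrow> 'a::zero) \<Rightarrow> bool" where
  "bounded_by N P \<longleftrightarrow> (\<forall>a b c. P a b c \<noteq> 0 \<longrightarrow> a \<le> N \<and> b \<le> N \<and> c \<le> N)"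

lemma three_var_iff: "P \<in> three_var_series \<longleftrightarrow> (\<exists>N. bounded_by N P)"
  by (simp add: three_var_series_def bounded_by_def)

lemma bounded_byD: "bounded_by N P \<Longrightarrow> a > N \<or> b > N \<or> c > N \<Longrightarrow> P a b c = 0"
  unfolding bounded_by_def by (metis not_le)

lemma bounded_by_mono: "bounded_by N P \<Longrightarrow> N \<le> M \<Longrightarrow> bounded_by M P"
  unfolding bounded_by_def by (meson order_trans)

lemma bounded_by_obtain:
  assumes "P \<in> three_var_series" "Q \<in> three_var_series"
  obtains N where "bounded_by N P" "bounded_by N Q" "N \<ge> 0"
proof -
  obtain k l where kl: "bounded_by k P" "bounded_by l Q" using assms by (auto simp: three_var_iff)
  show ?thesis
    by (rule that[of "max 0 (max k l)"]) (auto intro: bounded_by_mono[OF kl(1)] bounded_by_mono[OF kl(2)])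
qed

lemma bounded_by_map2:
  assumes "bounded_by N P" "bounded_by N Q" "f 0 0 = 0"
  shows "bounded_by N (\<lambda>a b c. f (P a b c) (Q a b c))"
  using assms unfolding bounded_by_def by metis

lemma bounded_by_map: "bounded_by N P \<Longrightarrow> f 0 = 0 \<Longrightarrow> bounded_by N (\<lambda>a b c. f (P a b c))"
  unfolding bounded_by_def by metis

lemma three_var_add: "P \<in> three_var_series \<Longrightarrow> Q \<in> three_var_series \<Longrightarrow>
    (\<lambda>a b c. P a b c + Q a b c :: 'a::ab_group_add) \<in> three_var_series"
  and three_var_diff: "P \<in> three_var_series \<Longrightarrow> Q \<in> three_var_series \<Longrightarrow>
    (\<lambda>a b c. P a b c - Q a b c :: 'a::ab_group_add) \<in> three_var_series"
proof -
  assume "P \<in> three_var_series" "Q \<in> three_var_series"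
  then obtain N where N: "bounded_by N P" "bounded_by N Q" by (rule bounded_by_obtain)
  show "(\<lambda>a b c. P a b c + Q a b c) \<in> three_var_series" "(\<lambda>a b c. P a b c - Q a b c) \<in> three_var_series"
    using bounded_by_map2[OF N, of "(+)"] bounded_by_map2[OF N, of "(-)"] by (auto simp: three_var_iff)
qed

lemma three_var_map: "P \<in> three_var_series \<Longrightarrow> f 0 = 0 \<Longrightarrow> (\<lambda>a b c. f (P a b c)) \<in> three_var_series"
  unfolding three_var_iff using bounded_by_map by blast

text \<open>The exponent of mu is determined by q, c and k, so two indices remain, and bounds on the
  exponents confine them to a rectangle.\<close>

lemma expand_box:
  assumes P: "bounded_by N P" and K: "int K \<ge> 2 * N - q" and L: "L \<le> q - N" and M: "M \<ge> N"
  shows "expand_lambda_mu P p q =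
    (\<Sum>k\<le>K. \<Sum>c=L..M. of_int (int_binomial c k) * P (p - int k) (q - c + int k) c)"
proof -
  let ?g = "\<lambda>k c. of_int (int_binomial c k) * P (p - int k) (q - c + int k) c"
  let ?S = "{(k, c). P (p - int k) (q - c + int k) c \<noteq> 0}"
  have "expand_lambda_mu P p q = (\<Sum>(k, c)\<in>?S. ?g k c)"
    unfolding expand_lambda_mu_def
  proof (rule sum.reindex_bij_witness[of _ "\<lambda>(k, c). (q - c + int k, c, k)" "\<lambda>(b, c, k). (k, c)"])
    fix x assume "x \<in> {(b, c, k). P (p - int k) b c \<noteq> 0 \<and> b + c - int k = q}"
    moreover obtain b c k where x: "x = (b, c, k)" by (cases x)
    ultimately have *: "P (p - int k) b c \<noteq> 0" "b = q - c + int k" by auto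
    show "(case case x of (b, c, k) \<Rightarrow> (k, c) of (k, c) \<Rightarrow> (q - c + int k, c, k)) = x"
      "(case x of (b, c, k) \<Rightarrow> (k, c)) \<in> ?S"
      "(case case x of (b, c, k) \<Rightarrow> (k, c) of (k, c) \<Rightarrow> ?g k c) =
        (case x of (b, c, k) \<Rightarrow> of_int (int_binomial c k) * P (p - int k) b c)"
      using * by (simp_all add: x)
  qed auto
  also have "\<dots> = (\<Sum>(k, c)\<in>{..K} \<times> {L..M}. ?g k c)"
  proof (rule sum.mono_neutral_left)
    show "?S \<subseteq> {..K} \<times> {L..M}"
    proof clarify
      fix k c assume "P (p - int k) (q - c + int k) c \<noteq> 0"
      hence "q - c + int k \<le> N" "c \<le> N" using P by (auto simp: bounded_by_def)
      thus "k \<in> {..K} \<and> c \<in> {L..M}" using K L M by auto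
    qed
  qed auto
  finally show ?thesis by (simp add: sum.cartesian_product)
qed

lemma expand_vanish:
  assumes "\<And>a b c. P a b c \<noteq> 0 \<Longrightarrow> b \<le> B \<and> c \<le> C" "q > B + C"
  shows "expand_lambda_mu P p q = 0"
proof -
  have "{(b, c, k). P (p - int k) b c \<noteq> 0 \<and> b + c - int k = q} = {}"
    using assms by fastforce
  thus ?thesis by (simp only: expand_lambda_mu_def sum.empty)
qed

lemma expand_add:
  assumes "P \<in> three_var_series" "Q \<in> three_var_series"
  shows "expand_lambda_mu (\<lambda>a b c. P a b c + Q a b c) p q = expand_lambda_mu P p q + expand_lambda_mu Q p q"
proof -
  obtain N where N: "bounded_by N P" "bounded_by N Q" by (rule bounded_by_obtain[OF assms])
  have K: "2 * N - q \<le> int (nat (2 * N - q))" by simp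
  note box = expand_box[OF _ K order_refl order_refl]
  have PQ: "bounded_by N (\<lambda>a b c. P a b c + Q a b c)" using bounded_by_map2[OF N, of "(+)"] by simp
  show ?thesis unfolding box[OF N(1)] box[OF N(2)] box[OF PQ] by (simp only: distrib_left sum.distrib)
qed

text \<open>Only integer multiples of coefficients occur in an expansion, so additivity of f is
  enough. This is what allows a retraction onto V that need not be multiplicative.\<close>

lemma expand_map:
  fixes f :: "'a::comm_ring_1 \<Rightarrow> 'b::comm_ring_1"
  assumes "P \<in> three_var_series" "\<And>a b. f (a + b) = f a + f b"
  shows "expand_lambda_mu (\<lambda>a b c. f (P a b c)) p q = f (expand_lambda_mu P p q)"
proof -
  obtain N where N: "bounded_by N P" by (rule bounded_by_obtain[OF assms(1) assms(1)])
  have K: "2 * N - q \<le> int (nat (2 * N - q))" by simp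
  note box = expand_box[OF _ K order_refl order_refl]
  have f0: "f 0 = 0" by (rule additive_zero) (rule assms(2))
  have fi: "f (of_int i * x) = of_int i * f x" for i x
    by (induction i rule: int_induct[where k = 0])
      (simp_all add: assms(2) f0 distrib_right left_diff_distrib additive_diff[of f, OF assms(2)])
  show ?thesis
    unfolding box[OF N] box[OF bounded_by_map[OF N, of f, OF f0]] additive_sum[of f, OF assms(2)] fi ..
qed

lemma expand_diff:
  assumes "P \<in> three_var_series" "Q \<in> three_var_series"
  shows "expand_lambda_mu (\<lambda>a b c. P a b c - Q a b c) p q = expand_lambda_mu P p q - expand_lambda_mu Q p q"
  using expand_add[OF assms(1) three_var_map[OF assms(2), of uminus]] expand_map[OF assms(2), of uminus] by simp

definition shift_lambda :: "(int \<Rightarrow> int \<Rightarrow> int \<Rightarrow> 'a) \<Rightarrow> int \<Rightarrow> int \<Rightarrow> int \<Rightarrow> 'a" where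
  "shift_lambda P a b c = P (a - 1) b c"
definition shift_mu :: "(int \<Rightarrow> int \<Rightarrow> int \<Rightarrow> 'a) \<Rightarrow> int \<Rightarrow> int \<Rightarrow> int \<Rightarrow> 'a" where
  "shift_mu P a b c = P a (b - 1) c"
definition shift_nu :: "(int \<Rightarrow> int \<Rightarrow> int \<Rightarrow> 'a) \<Rightarrow> int \<Rightarrow> int \<Rightarrow> int \<Rightarrow> 'a" where
  "shift_nu P a b c = P a b (c - 1)"

lemma bounded_by_shift:
  assumes "bounded_by N P"
  shows "bounded_by (N + 1) (shift_lambda P)" "bounded_by (N + 1) (shift_mu P)" "bounded_by (N + 1) (shift_nu P)"
  using assms unfolding bounded_by_def shift_lambda_def shift_mu_def shift_nu_def by force+

lemma three_var_shift:
  assumes "P \<in> three_var_series"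
  shows "shift_lambda P \<in> three_var_series" "shift_mu P \<in> three_var_series" "shift_nu P \<in> three_var_series"
  using assms bounded_by_shift unfolding three_var_iff by blast+

lemma expand_shift_lambda:
  assumes "P \<in> three_var_series"
  shows "expand_lambda_mu (shift_lambda P) p q = expand_lambda_mu P (p - 1) q"
proof -
  obtain N where N: "bounded_by N P" by (rule bounded_by_obtain[OF assms assms])
  note N' = bounded_by_shift(1)[OF N]
  have K: "2 * (N + 1) - q \<le> int (nat (2 * (N + 1) - q))" by simp
  show ?thesis
    by (subst expand_box[OF N' K order_refl order_refl], subst expand_box[OF N, where K = "nat (2 * (N + 1) - q)"
          and L = "q - (N + 1)" and M = "N + 1"]) (simp_all add: shift_lambda_def algebra_simps)
qed

lemma expand_shift_mu:
  assumes "P \<in> three_var_series"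
  shows "expand_lambda_mu (shift_mu P) p q = expand_lambda_mu P p (q - 1)"
proof -
  obtain N where N: "bounded_by N P" by (rule bounded_by_obtain[OF assms assms])
  note N' = bounded_by_shift(2)[OF N]
  have K: "2 * (N + 1) - q \<le> int (nat (2 * (N + 1) - q))" by simp
  show ?thesis
    by (subst expand_box[OF N' K order_refl order_refl], subst expand_box[OF N, where K = "nat (2 * (N + 1) - q)"
          and L = "q - (N + 1)" and M = "N + 1"]) (simp_all add: shift_mu_def algebra_simps)
qed

text \<open>The expansion of nu^(c+1) is lambda + mu times that of nu^c, again by Pascal's
  rule.\<close>

lemma expand_shift_nu:
  assumes "P \<in> three_var_series"
  shows "expand_lambda_mu (shift_nu P) p q = expand_lambda_mu P p (q - 1) + expand_lambda_mu P (p - 1) q"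
proof -
  obtain N where N: "bounded_by N P" by (rule bounded_by_obtain[OF assms assms])
  note N' = bounded_by_shift(3)[OF N]
  define K where "K = nat (2 * (N + 1) - q)"
  define L where "L = q - N - 2"
  define t where "t k c = P (p - int k) (q - c - 1 + int k) c" for k c
  have "expand_lambda_mu (shift_nu P) p q =
      (\<Sum>k\<le>Suc K. \<Sum>c=L+1..N+1. of_int (int_binomial c k) * shift_nu P (p - int k) (q - c + int k) c)"
    by (rule expand_box[OF N']) (simp_all add: K_def L_def)
  also have "\<dots> = (\<Sum>k\<le>Suc K. \<Sum>c=L..N. of_int (int_binomial (c + 1) k) * t k c)"
    by (rule sum.cong[OF refl], rule sum.reindex_bij_witness[of _ "\<lambda>c. c + 1" "\<lambda>c. c - 1"])
      (auto simp: shift_nu_def t_def algebra_simps)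
  also have "\<dots> = (\<Sum>c=L..N. t 0 c) + (\<Sum>k\<le>K. \<Sum>c=L..N. of_int (int_binomial (c + 1) (Suc k)) * t (Suc k) c)"
    by (subst sum.atMost_Suc_shift) simp
  also have "(\<Sum>k\<le>K. \<Sum>c=L..N. of_int (int_binomial (c + 1) (Suc k)) * t (Suc k) c) =
      (\<Sum>k\<le>K. \<Sum>c=L..N. of_int (int_binomial c (Suc k)) * t (Suc k) c) +
      (\<Sum>k\<le>K. \<Sum>c=L..N. of_int (int_binomial c k) * t (Suc k) c)"
    by (simp only: int_binomial_Suc_Suc of_int_add distrib_right sum.distrib)
  also have "(\<Sum>k\<le>K. \<Sum>c=L..N. of_int (int_binomial c k) * t (Suc k) c) = expand_lambda_mu P (p - 1) q"
    by (subst expand_box[OF N, where K = K and L = L and M = N])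
      (simp_all add: K_def L_def t_def algebra_simps)
  also have "(\<Sum>c=L..N. t 0 c) + ((\<Sum>k\<le>K. \<Sum>c=L..N. of_int (int_binomial c (Suc k)) * t (Suc k) c) + expand_lambda_mu P (p - 1) q)
    = (\<Sum>k\<le>Suc K. \<Sum>c=L..N. of_int (int_binomial c k) * t k c) + expand_lambda_mu P (p - 1) q"
    by (subst sum.atMost_Suc_shift[of _ K]) simp
  also have "(\<Sum>k\<le>Suc K. \<Sum>c=L..N. of_int (int_binomial c k) * t k c) = expand_lambda_mu P p (q - 1)"
    by (subst expand_box[OF N, where K = "Suc K" and L = L and M = N])
      (simp_all add: K_def L_def t_def algebra_simps)
  finally show ?thesis .
qed

lemma mult_eq_shifts:
  "mult_nu_minus_lambda_minus_mu G = (\<lambda>a b c. shift_nu G a b c - shift_lambda G a b c - shift_mu G a b c)"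
  by (simp add: fun_eq_iff mult_nu_minus_lambda_minus_mu_def shift_nu_def shift_lambda_def shift_mu_def)

lemma three_var_mult:
  "G \<in> three_var_series \<Longrightarrow> mult_nu_minus_lambda_minus_mu G \<in> three_var_series"
  by (simp add: mult_eq_shifts three_var_diff three_var_shift)

lemma expand_mult:
  assumes "G \<in> three_var_series"
  shows "expand_lambda_mu (mult_nu_minus_lambda_minus_mu G) p q = 0"
  unfolding mult_eq_shifts using assms
  by (simp add: expand_diff three_var_diff three_var_shift expand_shift_nu expand_shift_lambda expand_shift_mu)

lemma expand_c0:
  assumes "P \<in> three_var_series" "\<And>a b c. P a b c \<noteq> 0 \<Longrightarrow> c = 0"
  shows "expand_lambda_mu P p q = P p q 0"
proof -
  obtain N where N: "bounded_by N P" by (rule bounded_by_obtain[OF assms(1) assms(1)])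
  have "expand_lambda_mu P p q = (\<Sum>k\<le>nat (2 * N - q). \<Sum>c=min 0 (q - N)..max 0 N.
      of_int (int_binomial c k) * P (p - int k) (q - c + int k) c)"
    by (rule expand_box[OF N]) auto
  also have "\<dots> = (\<Sum>k\<le>nat (2 * N - q). \<Sum>c=min 0 (q - N)..max 0 N.
      if c = 0 then if k = 0 then P p q 0 else 0 else 0)"
  proof (intro sum.cong refl)
    fix k c
    have "P (p - int k) (q - c + int k) c = 0" if "c \<noteq> 0" using assms(2) that by blast
    thus "of_int (int_binomial c k) * P (p - int k) (q - c + int k) c = (if c = 0 then if k = 0 then P p q 0 else 0 else 0)"
      by (auto simp: int_binomial_0_left)
  qed
  also have "\<dots> = P p q 0" by simp
  finally show ?thesis .
qed

section \<open>The kernel of an expansion\<close>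

definition fin_supp :: "(int \<Rightarrow> int \<Rightarrow> int \<Rightarrow> 'a::zero) \<Rightarrow> bool" where
  "fin_supp P \<longleftrightarrow> finite {(a, b, c). P a b c \<noteq> 0}"

lemma fin_suppI: "finite S \<Longrightarrow> (\<And>a b c. P a b c \<noteq> 0 \<Longrightarrow> (a, b, c) \<in> S) \<Longrightarrow> fin_supp P"
  unfolding fin_supp_def by (erule finite_subset[rotated]) auto

lemma fin_supp_map2: "fin_supp P \<Longrightarrow> fin_supp Q \<Longrightarrow> f 0 0 = 0 \<Longrightarrow> fin_supp (\<lambda>a b c. f (P a b c) (Q a b c))"
  by (rule fin_suppI[where S = "{(a, b, c). P a b c \<noteq> 0} \<union> {(a, b, c). Q a b c \<noteq> 0}"])
    (auto simp: fin_supp_def)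

lemma fin_supp_translate: "fin_supp P \<Longrightarrow> fin_supp (\<lambda>a b c. P (a - i) (b - j) (c - k))"
  by (rule fin_suppI[where S = "(\<lambda>(a, b, c). (a + i, b + j, c + k)) ` {(a, b, c). P a b c \<noteq> 0}"])
    (force simp: fin_supp_def)+

lemma fin_supp_mult: "fin_supp G \<Longrightarrow> fin_supp (mult_nu_minus_lambda_minus_mu (G :: _ \<Rightarrow> _ \<Rightarrow> _ \<Rightarrow> 'a::ab_group_add))"
  unfolding mult_eq_shifts
  using fin_supp_translate[of G 0 0 1] fin_supp_translate[of G 1 0 0] fin_supp_translate[of G 0 1 0]
  by (intro fin_supp_map2[where f = "(-)"]) (simp_all add: shift_nu_def shift_lambda_def shift_mu_def)

lemma fin_supp_three_var: "fin_supp P \<Longrightarrow> P \<in> three_var_series"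
proof -
  assume *: "fin_supp P"
  let ?S = "{(a, b, c). P a b c \<noteq> 0}"
  let ?M = "Max (insert 0 ((\<lambda>(a, b, c). max a (max b c)) ` ?S))"
  have "max a (max b c) \<le> ?M" if "P a b c \<noteq> 0" for a b c
    using * that by (intro Max_ge) (force simp: fin_supp_def)+
  thus ?thesis unfolding three_var_series_def by force
qed

lemma mult_add: "mult_nu_minus_lambda_minus_mu (\<lambda>a b c. F a b c + G a b c) =
    (\<lambda>a b c. mult_nu_minus_lambda_minus_mu F a b c + mult_nu_minus_lambda_minus_mu G a b c)"
  by (simp add: fun_eq_iff mult_nu_minus_lambda_minus_mu_def)

text \<open>Induction on the highest power of nu. Without nu the expansion returns the series
  itself, so a vanishing expansion means a vanishing series.\<close>

lemma expand_kernel_nonneg: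
  assumes "fin_supp P" "\<And>a b c. P a b c \<noteq> 0 \<Longrightarrow> 0 \<le> c \<and> c \<le> int C"
    "\<And>p q. expand_lambda_mu P p q = 0"
  shows "\<exists>G. fin_supp G \<and> P = mult_nu_minus_lambda_minus_mu G"
  using assms
proof (induction C arbitrary: P)
  case 0
  have *: "c = 0" if "P a b c \<noteq> 0" for a b c using 0(2)[OF that] by simp
  hence "P p q 0 = 0" for p q using expand_c0[OF fin_supp_three_var[OF 0(1)], of p q] * 0(3) by simp
  hence "P = (\<lambda>a b c. 0)" using * by (metis (no_types) ext)
  thus ?case
    by (intro exI[of _ "\<lambda>a b c. 0"]) (auto simp: mult_nu_minus_lambda_minus_mu_def intro: fin_suppI[of "{}"])
next
  case (Suc C)
  \<comment> \<open>The part of highest degree in nu, divided by nu. Subtracting nu - lambda - mu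
    times it replaces nu^(C+1) by (lambda + mu) nu^C.\<close>
  define G0 where "G0 a b c = (if c = int C then P a b (int C + 1) else 0)" for a b c
  define P' where "P' a b c = P a b c - mult_nu_minus_lambda_minus_mu G0 a b c" for a b c
  have G0: "fin_supp G0"
    using fin_supp_translate[OF Suc.prems(1), of 0 0 "- 1"] unfolding fin_supp_def
    by (rule finite_subset[rotated]) (auto simp: G0_def)
  have P': "fin_supp P'"
    using fin_supp_map2[OF Suc.prems(1) fin_supp_mult[OF G0], of "(-)"] by (simp add: P'_def[abs_def])
  have "0 \<le> c \<and> c \<le> int C" if "P' a b c \<noteq> 0" for a b c
    using that Suc.prems(2)[of a b c] Suc.prems(2)[of a b "c + 1"]
    by (auto simp: P'_def G0_def mult_nu_minus_lambda_minus_mu_def diff_eq_eq split: if_splits)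
  moreover have "expand_lambda_mu P' p q = 0" for p q
    unfolding P'_def using Suc.prems(1,3) G0
    by (simp add: expand_diff fin_supp_three_var three_var_mult expand_mult)
  ultimately obtain G1 where G1: "fin_supp G1" "P' = mult_nu_minus_lambda_minus_mu G1"
    using Suc.IH[OF P'] by blast
  have "P = mult_nu_minus_lambda_minus_mu (\<lambda>a b c. G0 a b c + G1 a b c)"
    unfolding mult_add using G1(2) by (simp add: fun_eq_iff P'_def algebra_simps)
  thus ?case using fin_supp_map2[OF G0 G1(1), of "(+)"] by auto
qed

text \<open>Multiplication by a power of nu removes the negative powers of nu, preserves a vanishing
  expansion, and can be undone on the resulting multiple.\<close>

lemma expand_kernel_fin_supp:
  assumes P: "fin_supp P" and e: "\<And>p q. expand_lambda_mu P p q = 0"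
  shows "\<exists>G. fin_supp G \<and> P = mult_nu_minus_lambda_minus_mu G"
proof -
  let ?c = "(\<lambda>(a, b, c). c) ` {(a, b, c). P a b c \<noteq> 0}"
  have fc: "finite ?c" using P by (simp add: fin_supp_def)
  define M where "M = nat (Max (insert 0 (uminus ` ?c)))"
  define C where "C = nat (Max (insert 0 ?c))"
  have c: "- int M \<le> c \<and> c \<le> int C" if "P a b c \<noteq> 0" for a b c
  proof -
    have "c \<in> ?c" using that by force
    hence "c \<le> Max (insert 0 ?c)" "- c \<le> Max (insert 0 (uminus ` ?c))" using fc by auto
    thus ?thesis by (simp add: M_def C_def)
  qed
  define P2 where "P2 m a b c = P a b (c - int m)" for m a b c
  have P2: "fin_supp (P2 m)" for m
    using fin_supp_translate[OF P, of 0 0 "int m"] by (simp add: P2_def[abs_def])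
  have "expand_lambda_mu (P2 m) p q = 0" for m p q
  proof (induction m arbitrary: p q)
    case (Suc m)
    have "P2 (Suc m) = shift_nu (P2 m)" by (simp add: P2_def shift_nu_def fun_eq_iff algebra_simps)
    thus ?case using Suc by (simp add: expand_shift_nu fin_supp_three_var P2)
  qed (simp add: P2_def[abs_def] e)
  hence "\<exists>G. fin_supp G \<and> P2 M = mult_nu_minus_lambda_minus_mu G"
    using c by (intro expand_kernel_nonneg[where C = "C + M"] P2) (fastforce simp: P2_def)+
  then obtain G where G: "fin_supp G" "P2 M = mult_nu_minus_lambda_minus_mu G" by blast
  have "P a b c = mult_nu_minus_lambda_minus_mu (\<lambda>a b c. G a b (c + int M)) a b c" for a b c
    using fun_cong[OF fun_cong[OF fun_cong[OF G(2), of a], of b], of "c + int M"]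
    by (simp add: P2_def mult_nu_minus_lambda_minus_mu_def algebra_simps)
  hence "P = mult_nu_minus_lambda_minus_mu (\<lambda>a b c. G a b (c + int M))" by (simp add: fun_eq_iff)
  thus ?thesis using fin_supp_translate[OF G(1), of 0 0 "- int M"] by auto
qed

text \<open>The extreme coefficients of \<open>G\<close> in each variable survive in \<open>(\<nu> - \<lambda> - \<mu>) G\<close>.\<close>

lemma bounded_by_mult:
  fixes G :: "int \<Rightarrow> int \<Rightarrow> int \<Rightarrow> 'a::ab_group_add"
  assumes G: "fin_supp G" and b: "bounded_by N (mult_nu_minus_lambda_minus_mu G)"
  shows "bounded_by N G"
  unfolding bounded_by_def
proof (intro allI impI)
  fix a b c assume nz: "G a b c \<noteq> 0"
  let ?S = "{(a, b, c). G a b c \<noteq> 0}"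
  have max: "\<exists>x y z. G x y z \<noteq> 0 \<and> (\<forall>x' y' z'. G x' y' z' \<noteq> 0 \<longrightarrow> h x' y' z' \<le> h x y z)"
    for h :: "int \<Rightarrow> int \<Rightarrow> int \<Rightarrow> int"
  proof -
    let ?h = "(\<lambda>(x, y, z). h x y z) ` ?S"
    have "finite ?h" "?h \<noteq> {}" using G nz by (auto simp: fin_supp_def)
    from Max_in[OF this] obtain w where w: "Max ?h = (\<lambda>(x, y, z). h x y z) w" "w \<in> ?S" by (rule imageE)
    obtain x y z where "w = (x, y, z)" by (cases w)
    hence "G x y z \<noteq> 0" "h x y z = Max ?h" using w by auto
    moreover have "h x' y' z' \<le> Max ?h" if "G x' y' z' \<noteq> 0" for x' y' z'
      using \<open>finite ?h\<close> that by (intro Max_ge) force+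
    ultimately show ?thesis by metis
  qed
  have m: "x \<le> N \<and> y \<le> N \<and> z \<le> N" if "mult_nu_minus_lambda_minus_mu G x y z \<noteq> 0" for x y z
    using b that unfolding bounded_by_def by blast
  note mult = mult_nu_minus_lambda_minus_mu_def
  obtain x y z where "G x y z \<noteq> 0" and x: "\<And>x' y' z'. G x' y' z' \<noteq> 0 \<Longrightarrow> x' \<le> x"
    using max[of "\<lambda>x y z. x"] by blast
  moreover have "G (x + 1) y' z' = 0" for y' z' using x[of "x + 1" y' z'] by force
  ultimately have "x + 1 \<le> N" using m[of "x + 1" y z] by (simp add: mult)
  hence a: "a \<le> N" using x[OF nz] by simp
  obtain x y z where "G x y z \<noteq> 0" and y: "\<And>x' y' z'. G x' y' z' \<noteq> 0 \<Longrightarrow> y' \<le> y"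
    using max[of "\<lambda>x y z. y"] by blast
  moreover have "G x' (y + 1) z' = 0" for x' z' using y[of x' "y + 1" z'] by force
  ultimately have "y + 1 \<le> N" using m[of x "y + 1" z] by (simp add: mult)
  hence b: "b \<le> N" using y[OF nz] by simp
  obtain x y z where "G x y z \<noteq> 0" and z: "\<And>x' y' z'. G x' y' z' \<noteq> 0 \<Longrightarrow> z' \<le> z"
    using max[of "\<lambda>x y z. z"] by blast
  moreover have "G x' y' (z + 1) = 0" for x' y' using z[of x' y' "z + 1"] by force
  ultimately have "z + 1 \<le> N" using m[of x y "z + 1"] by (simp add: mult)
  thus "a \<le> N \<and> b \<le> N \<and> c \<le> N" using a b z[OF nz] by simp
qed

text \<open>Multiples of nu - lambda - mu are found separately in each total degree. By
  \<open>bounded_by_mult\<close> their factors are bounded uniformly, so they can be assembled into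
  one series.\<close>

lemma expand_kernel:
  assumes P: "P \<in> three_var_series" and e: "\<And>p q. expand_lambda_mu P p q = 0"
  shows "zero_in_quotient P"
proof -
  obtain N where N: "bounded_by N P" by (rule bounded_by_obtain[OF P P])
  \<comment> \<open>In total degree d, exponents that are at most N are also at least d - 2 N; hence
    each homogeneous component has finite support.\<close>
  define D where "D d a b c = (if a + b + c = d then P a b c else 0)" for d a b c :: int
  have D: "fin_supp (D d)" for d
  proof (rule fin_suppI[where S = "{d - 2 * N..N} \<times> {d - 2 * N..N} \<times> {d - 2 * N..N}"])
    fix a b c assume "D d a b c \<noteq> 0"
    hence "a + b + c = d" "a \<le> N" "b \<le> N" "c \<le> N" using N by (auto simp: D_def bounded_by_def split: if_splits)
    thus "(a, b, c) \<in> {d - 2 * N..N} \<times> {d - 2 * N..N} \<times> {d - 2 * N..N}" by auto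
  qed simp
  have "expand_lambda_mu (D d) p q = 0" for d p q
  proof (cases "p + q = d")
    case True
    have "{(b, c, k). D d (p - int k) b c \<noteq> 0 \<and> b + c - int k = q} = {(b, c, k). P (p - int k) b c \<noteq> 0 \<and> b + c - int k = q}"
      using True by (auto simp: D_def)
    hence "expand_lambda_mu (D d) p q = expand_lambda_mu P p q"
      unfolding expand_lambda_mu_def using True by (intro sum.cong) (auto simp: D_def)
    thus ?thesis using e by simp
  next
    case False
    hence "{(b, c, k). D d (p - int k) b c \<noteq> 0 \<and> b + c - int k = q} = {}" by (auto simp: D_def split: if_splits)
    thus ?thesis by (simp only: expand_lambda_mu_def sum.empty)
  qed
  hence "\<exists>G. fin_supp G \<and> D d = mult_nu_minus_lambda_minus_mu G" for d
    by (intro expand_kernel_fin_supp D)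
  then obtain G where G: "\<And>d. fin_supp (G d)" "\<And>d. D d = mult_nu_minus_lambda_minus_mu (G d)" by metis
  have "bounded_by N (D d)" for d using N by (auto simp: bounded_by_def D_def)
  hence bG: "bounded_by N (G d)" for d using bounded_by_mult[OF G(1)] by (simp add: G(2))
  \<comment> \<open>The component of degree d of P has a factor of degree d - 1, whence the shift by
    one.\<close>
  define F where "F a b c = G (a + b + c + 1) a b c" for a b c
  have "bounded_by N F" using bG unfolding bounded_by_def F_def by blast
  moreover have "P a b c = mult_nu_minus_lambda_minus_mu F a b c" for a b c
  proof -
    have "P a b c = D (a + b + c) a b c" by (simp add: D_def)
    also have "\<dots> = mult_nu_minus_lambda_minus_mu F a b c"
      by (simp add: G(2) mult_nu_minus_lambda_minus_mu_def F_def algebra_simps)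
    finally show ?thesis .
  qed
  ultimately show ?thesis unfolding zero_in_quotient_def three_var_iff by (metis ext bexI three_var_iff)
qed

section \<open>Expansions and left action\<close>

lemma fls_map_zero: "f 0 = 0 \<Longrightarrow> fls_map f 0 = 0"
  by (rule fls_eqI) simp

definition expand1 :: "(int \<Rightarrow> int \<Rightarrow> int \<Rightarrow> 'a::comm_ring_1) \<Rightarrow> 'a fls fls" where
  "expand1 P = Abs_fls (\<lambda>r. Abs_fls (\<lambda>s. expand_lambda_mu P (- s) (- r)))"

lemma psd_coeff_expand1:
  assumes "P \<in> three_var_series"
  shows "psd_coeff (psd_coeff (expand1 P) q) p = expand_lambda_mu P p q"
proof -
  obtain N where N: "bounded_by N P" by (rule bounded_by_obtain[OF assms assms])
  \<comment> \<open>The bound on the exponent of lambda depends on q: the smaller q is, the more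
    terms of the expansion of nu^c contribute. Hence the values are iterated series rather than
    series bounded jointly in both variables.\<close>
  have p: "expand_lambda_mu P p q = 0" if "p > N + int (nat (2 * N - q))" for p q
  proof -
    have "P (p - int k) (q - c + int k) c = 0" if "k \<le> nat (2 * N - q)" for k c
      by (rule bounded_byD[OF N]) (use that \<open>p > _\<close> in linarith)
    thus ?thesis
      by (subst expand_box[OF N _ order_refl order_refl, where K = "nat (2 * N - q)"]) (auto intro!: sum.neutral)
  qed
  have q: "expand_lambda_mu P p q = 0" if "q > N + N" for p q
    by (rule expand_vanish[OF _ that]) (use N in \<open>auto simp: bounded_by_def\<close>)
  have inner: "Abs_fls (\<lambda>s. expand_lambda_mu P (- s) (- r)) $$ s = expand_lambda_mu P (- s) (- r)" for r s
    by (rule nth_Abs_fls_lower_bound[of "- N - int (nat (2 * N + r))"]) (auto intro: p)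
  have outer: "expand1 P $$ r = Abs_fls (\<lambda>s. expand_lambda_mu P (- s) (- r))" for r
    unfolding expand1_def
    by (rule nth_Abs_fls_lower_bound[of "- (N + N)"]) (auto intro!: fls_eqI simp: inner q)
  show ?thesis using inner[of "- q" "- p"] unfolding outer[symmetric] by (simp only: minus_minus)
qed

lemma coeff2_eq_iff: "coeff2 F = coeff2 G \<longleftrightarrow> F = G"
  by (metis coeff2_def psd2_eqI)

lemma coeff2_expand1: "P \<in> three_var_series \<Longrightarrow> coeff2 (expand1 P) = expand_lambda_mu P"
  by (simp add: fun_eq_iff coeff2_def psd_coeff_expand1)

lemma expand1_add: "P \<in> three_var_series \<Longrightarrow> Q \<in> three_var_series \<Longrightarrow>
    expand1 (\<lambda>a b c. P a b c + Q a b c) = expand1 P + expand1 Q"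
  by (rule psd2_eqI) (simp add: psd_coeff_expand1 three_var_add expand_add)

lemma expand1_diff: "P \<in> three_var_series \<Longrightarrow> Q \<in> three_var_series \<Longrightarrow>
    expand1 (\<lambda>a b c. P a b c - Q a b c) = expand1 P - expand1 Q"
  by (rule psd2_eqI) (simp add: psd_coeff_expand1 three_var_diff expand_diff)

lemma expand1_map:
  assumes "P \<in> three_var_series" "\<And>a b. f (a + b) = f a + f b"
  shows "expand1 (\<lambda>a b c. f (P a b c)) = fls_map (fls_map f) (expand1 P)"
proof -
  have f0: "f 0 = 0" by (rule additive_zero) (rule assms(2))
  have "fls_map f 0 = 0" by (rule fls_eqI) (simp add: f0)
  thus ?thesis
    by (intro psd2_eqI) (simp add: psd_coeff_expand1 three_var_map assms f0 expand_map)
qed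

lemma expand1_shift_nu:
  assumes "P \<in> three_var_series"
  shows "expand1 (shift_nu P) = fls_shift 1 (expand1 P) + fls_const fls_X_inv * expand1 P"
proof (rule psd2_eqI)
  fix q p
  have "psd_coeff (psd_coeff (fls_shift 1 (expand1 P) + fls_const fls_X_inv * expand1 P) q) p
    = psd_coeff (psd_coeff (expand1 P) (q - 1)) p + psd_coeff (psd_coeff (expand1 P) q) (p - 1)"
    by (simp only: fls_plus_nth psd_coeff_shift fls_mult_const_nth psd_coeff_X_inv_mult)
  thus "psd_coeff (psd_coeff (expand1 (shift_nu P)) q) p =
      psd_coeff (psd_coeff (fls_shift 1 (expand1 P) + fls_const fls_X_inv * expand1 P) q) p"
    by (simp only: psd_coeff_expand1[OF assms] psd_coeff_expand1[OF three_var_shift(3)[OF assms]] expand_shift_nu[OF assms])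
qed

lemma expand1_eq_0_iff:
  assumes "P \<in> three_var_series"
  shows "expand1 P = 0 \<longleftrightarrow> zero_in_quotient P"
proof
  assume "expand1 P = 0"
  hence "expand_lambda_mu P p q = 0" for p q
    using psd_coeff_expand1[OF assms, of q p] by simp
  thus "zero_in_quotient P" by (rule expand_kernel[OF assms])
next
  assume "zero_in_quotient P"
  then obtain G where "G \<in> three_var_series" "P = mult_nu_minus_lambda_minus_mu G"
    by (auto simp: zero_in_quotient_def)
  thus "expand1 P = 0"
    using psd_coeff_expand1[OF assms] by (intro psd2_eqI) (simp add: expand_mult)
qed

section \<open>Reduction of the other two expansions to the first\<close>

definition swap_vars :: "(int \<Rightarrow> int \<Rightarrow> int \<Rightarrow> 'a) \<Rightarrow> int \<Rightarrow> int \<Rightarrow> int \<Rightarrow> 'a" where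
  "swap_vars P a b c = P b a c"

text \<open>\<open>\<mu> = \<nu> - \<lambda>\<close> is expanded like \<open>\<nu> = \<lambda> + \<mu>\<close> after renaming \<open>\<nu>\<close>, \<open>-\<lambda>\<close>, \<open>\<mu>\<close> to \<open>\<lambda>\<close>, \<open>\<mu>\<close>, \<open>\<nu>\<close>.\<close>

definition rotate_vars :: "(int \<Rightarrow> int \<Rightarrow> int \<Rightarrow> 'a::comm_ring_1) \<Rightarrow> int \<Rightarrow> int \<Rightarrow> int \<Rightarrow> 'a" where
  "rotate_vars P x y z = (if even y then P y z x else - P y z x)"

lemma three_var_swap: "P \<in> three_var_series \<Longrightarrow> swap_vars P \<in> three_var_series"
  unfolding three_var_series_def swap_vars_def by blast

lemma three_var_rotate: "P \<in> three_var_series \<Longrightarrow> rotate_vars P \<in> three_var_series"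
  unfolding three_var_series_def rotate_vars_def by (auto split: if_splits)

lemma expand_mu_lambda_swap: "expand_mu_lambda P = expand_lambda_mu (swap_vars P)"
  by (simp add: fun_eq_iff expand_mu_lambda_def expand_lambda_mu_def swap_vars_def)

text \<open>Since b - k = q - a, the sign of (-lambda)^(b-k) factors into (-1)^q and (-1)^a; the
  latter is built into \<open>rotate_vars\<close>.\<close>

lemma expand_nu_lambda_rotate:
  "expand_nu_lambda P p q = (if even q then 1 else - 1) * expand_lambda_mu (rotate_vars P) p q"
proof -
  have "{(a, b, k). P a b (p - int k) \<noteq> 0 \<and> a + b - int k = q} =
      {(b, c, k). rotate_vars P (p - int k) b c \<noteq> 0 \<and> b + c - int k = q}"
    by (auto simp: rotate_vars_def)
  thus ?thesis
    unfolding expand_nu_lambda_def expand_lambda_mu_def sum_distrib_left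
    by (intro sum.cong) (auto simp: rotate_vars_def)
qed

lemma zero_in_quotient_swap: "zero_in_quotient P \<Longrightarrow> zero_in_quotient (swap_vars P)"
  unfolding zero_in_quotient_def
proof (elim bexE)
  fix G assume "G \<in> three_var_series" "P = mult_nu_minus_lambda_minus_mu G"
  thus "\<exists>G\<in>three_var_series. swap_vars P = mult_nu_minus_lambda_minus_mu G"
    by (intro bexI[of _ "swap_vars G"] three_var_swap)
      (auto simp: fun_eq_iff swap_vars_def mult_nu_minus_lambda_minus_mu_def)
qed

lemma zero_in_quotient_unrotate:
  assumes "zero_in_quotient (rotate_vars P)"
  shows "zero_in_quotient P"
proof -
  obtain G where G: "G \<in> three_var_series" "rotate_vars P = mult_nu_minus_lambda_minus_mu G"
    using assms by (auto simp: zero_in_quotient_def)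
  \<comment> \<open>The renaming sends nu - lambda - mu to its negative, hence the sign opposite to
    that in \<open>rotate_vars\<close>.\<close>
  define F where "F a b c = (if even a then - G c a b else G c a b)" for a b c
  have "P a b c = mult_nu_minus_lambda_minus_mu F a b c" for a b c
    using fun_cong[OF fun_cong[OF fun_cong[OF G(2), of c], of a], of b]
    by (cases "even a") (simp_all add: rotate_vars_def F_def mult_nu_minus_lambda_minus_mu_def algebra_simps)
  hence "P = mult_nu_minus_lambda_minus_mu F" by (simp add: fun_eq_iff)
  moreover have "F \<in> three_var_series"
    using G(1) unfolding three_var_series_def F_def by (auto split: if_splits)
  ultimately show ?thesis by (auto simp: zero_in_quotient_def)
qed

text \<open>The sign by the parity of the outer exponent restores lambda from the renamed variable
  -lambda.\<close>

definition expand3 :: "(int \<Rightarrow> int \<Rightarrow> int \<Rightarrow> 'a::comm_ring_1) \<Rightarrow> 'a fls fls" where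
  "expand3 P = Abs_fls (\<lambda>r. if even r then expand1 (rotate_vars P) $$ r else - expand1 (rotate_vars P) $$ r)"

lemma psd_coeff_expand3:
  assumes "P \<in> three_var_series"
  shows "psd_coeff (psd_coeff (expand3 P) q) p = expand_nu_lambda P p q"
proof -
  obtain N where "\<forall>k<N. expand1 (rotate_vars P) $$ k = 0" by (rule fls_nth_vanishes_belowE)
  hence "expand3 P $$ r = (if even r then expand1 (rotate_vars P) $$ r else - expand1 (rotate_vars P) $$ r)" for r
    unfolding expand3_def by (intro nth_Abs_fls_lower_bound[of N]) auto
  thus ?thesis
    using psd_coeff_expand1[OF three_var_rotate[OF assms], of q p] by (simp add: expand_nu_lambda_rotate)
qed

lemma coeff2_expand3: "P \<in> three_var_series \<Longrightarrow> coeff2 (expand3 P) = expand_nu_lambda P"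
  by (simp add: fun_eq_iff coeff2_def psd_coeff_expand3)

lemma rotate_map2: "rotate_vars (\<lambda>a b c. P a b c + Q a b c) = (\<lambda>a b c. rotate_vars P a b c + rotate_vars Q a b c)"
  "rotate_vars (\<lambda>a b c. P a b c - Q a b c) = (\<lambda>a b c. rotate_vars P a b c - rotate_vars Q a b c)"
  by (auto simp: fun_eq_iff rotate_vars_def)

lemma expand3_add: "P \<in> three_var_series \<Longrightarrow> Q \<in> three_var_series \<Longrightarrow>
    expand3 (\<lambda>a b c. P a b c + Q a b c) = expand3 P + expand3 Q"
  by (rule psd2_eqI)
    (simp add: psd_coeff_expand3 three_var_add expand_add expand_nu_lambda_rotate rotate_map2 three_var_rotate)

lemma expand3_diff: "P \<in> three_var_series \<Longrightarrow> Q \<in> three_var_series \<Longrightarrow>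
    expand3 (\<lambda>a b c. P a b c - Q a b c) = expand3 P - expand3 Q"
  by (rule psd2_eqI)
    (simp add: psd_coeff_expand3 three_var_diff expand_diff expand_nu_lambda_rotate rotate_map2 three_var_rotate)

lemma expand3_map:
  assumes "P \<in> three_var_series" "\<And>a b. f (a + b) = f a + f b"
  shows "expand3 (\<lambda>a b c. f (P a b c)) = fls_map (fls_map f) (expand3 P)"
proof -
  have f0: "f 0 = 0" by (rule additive_zero) (rule assms(2))
  have fm: "fls_map f 0 = 0" by (rule fls_eqI) (simp add: f0)
  have r: "rotate_vars (\<lambda>a b c. f (P a b c)) = (\<lambda>a b c. f (rotate_vars P a b c))"
    by (auto simp: fun_eq_iff rotate_vars_def additive_minus[of f, OF assms(2)])
  show ?thesis
    by (intro psd2_eqI) (simp add: psd_coeff_expand3 three_var_map assms f0 fm r expand_nu_lambda_rotate three_var_rotate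
        expand_map[of _ f] additive_minus[of f, OF assms(2)])
qed

lemma expand3_eq_0_imp:
  assumes "P \<in> three_var_series" "expand3 P = 0"
  shows "zero_in_quotient P"
proof -
  have "expand_nu_lambda P p q = 0" for p q
    using psd_coeff_expand3[OF assms(1), of q p] assms(2) by simp
  hence "expand_lambda_mu (rotate_vars P) p q = 0" for p q
    using expand_nu_lambda_rotate[of P p q] by (cases "even q") auto
  hence "zero_in_quotient (rotate_vars P)" by (rule expand_kernel[OF three_var_rotate[OF assms(1)]])
  thus ?thesis by (rule zero_in_quotient_unrotate)
qed

lemma expand3_shift_nu:
  assumes "P \<in> three_var_series"
  shows "expand3 (shift_nu P) = fls_const fls_X_inv * expand3 P"
proof (rule psd2_eqI)
  fix q p
  have "rotate_vars (shift_nu P) = shift_lambda (rotate_vars P)"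
    by (simp add: fun_eq_iff rotate_vars_def shift_nu_def shift_lambda_def)
  thus "psd_coeff (psd_coeff (expand3 (shift_nu P)) q) p = psd_coeff (psd_coeff (fls_const fls_X_inv * expand3 P) q) p"
    by (simp only: fls_mult_const_nth psd_coeff_X_inv_mult psd_coeff_expand3[OF assms] psd_coeff_expand3[OF three_var_shift(3)[OF assms]]
        expand_nu_lambda_rotate expand_shift_lambda[OF three_var_rotate[OF assms]])
qed

lemma expand3_shift_mu:
  assumes "P \<in> three_var_series"
  shows "expand3 (shift_mu P) = fls_const fls_X_inv * expand3 P - fls_shift 1 (expand3 P)"
proof (rule psd2_eqI)
  fix q p :: int
  have r: "rotate_vars (shift_mu P) = shift_nu (rotate_vars P)"
    by (simp add: fun_eq_iff rotate_vars_def shift_nu_def shift_mu_def)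
  have s: "(if even q then 1 else - 1) = - (if even (q - 1) then 1 else - 1 :: 'a)" by simp
  have "psd_coeff (psd_coeff (fls_const fls_X_inv * expand3 P - fls_shift 1 (expand3 P)) q) p
    = psd_coeff (psd_coeff (expand3 P) q) (p - 1) - psd_coeff (psd_coeff (expand3 P) (q - 1)) p"
    by (simp only: fls_minus_nth psd_coeff_shift fls_mult_const_nth psd_coeff_X_inv_mult)
  also have "\<dots> = psd_coeff (psd_coeff (expand3 (shift_mu P)) q) p"
    unfolding psd_coeff_expand3[OF assms] psd_coeff_expand3[OF three_var_shift(2)[OF assms]]
      expand_nu_lambda_rotate r expand_shift_nu[OF three_var_rotate[OF assms]] s
    by (simp add: algebra_simps)
  finally show "psd_coeff (psd_coeff (expand3 (shift_mu P)) q) p =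
      psd_coeff (psd_coeff (fls_const fls_X_inv * expand3 P - fls_shift 1 (expand3 P)) q) p" ..
qed

section \<open>The action of operators on representatives\<close>

definition nu_row :: "(int \<Rightarrow> int \<Rightarrow> int \<Rightarrow> 'a::zero) \<Rightarrow> int \<Rightarrow> int \<Rightarrow> 'a fls" where
  "nu_row P a b = Abs_fls (\<lambda>r. P a b (- r))"

text \<open>The operator A(nu + derivation) on representatives. Since nu stands for the derivation
  acting on the result, this is the left action before any choice of an expansion.\<close>

definition psd_act :: "'a::differential_ring fls \<Rightarrow> (int \<Rightarrow> int \<Rightarrow> int \<Rightarrow> 'a) \<Rightarrow> int \<Rightarrow> int \<Rightarrow> int \<Rightarrow> 'a" where
  "psd_act A P a b c = psd_coeff (A \<odot> nu_row P a b) c"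

lemma psd_coeff_nu_row: "P \<in> three_var_series \<Longrightarrow> psd_coeff (nu_row P a b) c = P a b c"
proof -
  assume "P \<in> three_var_series"
  then obtain N where "bounded_by N P" by (auto simp: three_var_iff)
  thus ?thesis
    unfolding nu_row_def by (subst nth_Abs_fls_lower_bound[of "- N"]) (auto intro: bounded_byD)
qed

lemma nu_row_act: "nu_row (psd_act A P) a b = A \<odot> nu_row P a b"
proof -
  have "(\<lambda>r. psd_act A P a b (- r)) = fls_nth (A \<odot> nu_row P a b)" by (simp add: fun_eq_iff psd_act_def)
  thus ?thesis by (simp add: nu_row_def[of "psd_act A P"] fls_nth_inverse)
qed

lemma act_bound:
  assumes "bounded_by N P" "deg_le n A" "psd_act A P a b c \<noteq> 0"
  shows "a \<le> N" "b \<le> N" "c \<le> n + N"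
proof -
  have P: "P \<in> three_var_series" using assms(1) by (auto simp: three_var_iff)
  have "nu_row P a b \<noteq> 0" using assms(3) by (auto simp: psd_act_def)
  then obtain c' where "P a b c' \<noteq> 0" using psd_coeff_nu_row[OF P, of a b] by (metis fls_zero_nth psd_eqI)
  thus "a \<le> N" "b \<le> N" using assms(1) by (auto simp: bounded_by_def)
  have "deg_le N (nu_row P a b)"
    using assms(1) by (auto simp: deg_le_def psd_coeff_nu_row[OF P] dest: bounded_byD)
  from deg_leD[OF deg_le_comp[OF assms(2) this], of c] assms(3) show "c \<le> n + N"
    unfolding psd_act_def using not_le by blast
qed

lemma three_var_act: "P \<in> three_var_series \<Longrightarrow> psd_act A P \<in> three_var_series"
proof -
  assume "P \<in> three_var_series"
  then obtain N where N: "bounded_by N P" by (auto simp: three_var_iff)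
  obtain n where n: "deg_le n A" using ex_deg_le by blast
  have "bounded_by (max N (n + N)) (psd_act A P)"
    unfolding bounded_by_def using act_bound[OF N n] by (meson le_max_iff_disj)
  thus ?thesis by (auto simp: three_var_iff)
qed

lemma act_comp: "psd_act (A \<odot> B) P = psd_act A (psd_act B P)"
  by (simp add: fun_eq_iff psd_act_def[of A] psd_act_def[of "A \<odot> B"] nu_row_act comp_assoc)

lemma act_const: "P \<in> three_var_series \<Longrightarrow> psd_act (fls_const x) P = (\<lambda>a b c. x * P a b c)"
  by (simp add: fun_eq_iff psd_act_def comp_const_left psd_coeff_nu_row)

definition psd_actE :: "(int \<Rightarrow> int \<Rightarrow> int \<Rightarrow> 'a::differential_ring) \<Rightarrow> int \<Rightarrow> int \<Rightarrow> int \<Rightarrow> 'a" where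
  "psd_actE = psd_act (fls_shift 1 1)"

lemma act_shift: "psd_act (fls_shift 1 A) P = psd_act A (psd_actE P)"
proof -
  have "fls_shift 1 A = A \<odot> fls_shift 1 1" by (simp add: comp_shift_right)
  thus ?thesis by (simp add: psd_actE_def act_comp)
qed

lemma actE_eq: "P \<in> three_var_series \<Longrightarrow> psd_actE P = (\<lambda>a b c. shift_nu P a b c + der (P a b c))"
  unfolding psd_actE_def psd_act_def comp_shift_left comp_one_left psd_coeff_E
  by (simp add: fun_eq_iff psd_coeff_nu_row shift_nu_def del: minus_diff_eq)

lemma actE_surj: "psd_actE ` three_var_series = three_var_series"
proof (rule antisym)
  show "psd_actE ` three_var_series \<subseteq> three_var_series"
    unfolding psd_actE_def using three_var_act by blast
  show "three_var_series \<subseteq> psd_actE ` (three_var_series :: (_ \<Rightarrow> _ \<Rightarrow> _ \<Rightarrow> 'a) set)"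
  proof
    fix P :: "_ \<Rightarrow> _ \<Rightarrow> _ \<Rightarrow> 'a" assume P: "P \<in> three_var_series"
    have "fls_shift 1 1 \<odot> fls_shift (- 1) 1 = (1 :: 'a fls)" by (simp add: comp_shift_right)
    hence "psd_actE (psd_act (fls_shift (- 1) 1) P) = psd_act 1 P"
      unfolding psd_actE_def by (simp flip: act_comp)
    also have "\<dots> = P" using act_const[OF P, of 1] by simp
    finally show "P \<in> psd_actE ` three_var_series" using three_var_act[OF P] by (metis image_eqI)
  qed
qed

lemma act_add: "psd_act (A + B) P = (\<lambda>a b c. psd_act A P a b c + psd_act B P a b c)"
  by (simp add: fun_eq_iff psd_act_def comp_add_left)

lemma psd_cts_expand1_act: "P \<in> three_var_series \<Longrightarrow> psd_cts (\<lambda>A. expand1 (psd_act A P))"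
proof -
  assume P: "P \<in> three_var_series"
  then obtain N where N: "bounded_by N P" by (auto simp: three_var_iff)
  show ?thesis
  proof (rule psd_ctsI[where d = "N + N"])
    fix n and A :: "'a fls" assume "deg_le n A"
    note b = act_bound[OF N this]
    show "deg_le (n + (N + N)) (expand1 (psd_act A P))"
      unfolding deg_le_def
    proof (intro allI impI psd_eqI)
      fix q p assume "n + (N + N) < q"
      hence "expand_lambda_mu (psd_act A P) p q = 0"
        by (intro expand_vanish[where B = N and C = "n + N"]) (auto dest: b)
      thus "psd_coeff (psd_coeff (expand1 (psd_act A P)) q) p = psd_coeff 0 p"
        by (simp add: psd_coeff_expand1 three_var_act P)
    qed
  qed (simp add: act_add expand1_add three_var_act P)
qed

text \<open>In this domain nu is expanded as lambda + mu, so the action through nu becomes that of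
  \<open>psd_sigma A\<close>.\<close>

lemma expand1_act: "P \<in> three_var_series \<Longrightarrow> expand1 (psd_act A P) = psd_sigma A \<odot> expand1 P"
proof (rule psd_ext_E[where S = three_var_series and f = psd_actE and L = "\<lambda>A P. expand1 (psd_act A P)"
      and R = "\<lambda>A P. psd_sigma A \<odot> expand1 P", OF _ _ _ actE_surj])
  fix x and P :: "_ \<Rightarrow> _ \<Rightarrow> _ \<Rightarrow> 'a" assume P: "P \<in> three_var_series"
  show "expand1 (psd_act (fls_const x) P) = psd_sigma (fls_const x) \<odot> expand1 P"
    by (rule psd2_eqI) (simp add: act_const P expand1_map distrib_left fls_map_zero sigma_const comp_const_left)
next
  fix A and P :: "_ \<Rightarrow> _ \<Rightarrow> _ \<Rightarrow> 'a" assume P: "P \<in> three_var_series"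
  have "fls_map (fls_map der) F = der F" for F :: "'a fls fls" by (simp add: der_fls_def)
  hence "expand1 (psd_actE P) = psd_E2 (expand1 P)"
    by (simp add: actE_eq P expand1_add three_var_shift three_var_map expand1_shift_nu expand1_map der_add E2_alt psd_E_def)
  thus "psd_sigma (fls_shift 1 A) \<odot> expand1 P = psd_sigma A \<odot> expand1 (psd_actE P)"
    by (simp add: sigma_shift_comp)
qed (simp_all add: psd_cts_expand1_act psd_cts_comp_left psd_cts_sigma psd_cts_ident act_shift)

lemma psd_cts_expand3_act: "P \<in> three_var_series \<Longrightarrow> psd_cts (\<lambda>A. psd_coeff (expand3 (psd_act A P)) q)"
proof -
  assume P: "P \<in> three_var_series"
  then obtain N where N: "bounded_by N P" by (auto simp: three_var_iff)
  show ?thesis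
  proof (rule psd_ctsI[where d = "3 * N - q"])
    fix n and A :: "'a fls" assume "deg_le n A"
    note b = act_bound[OF N this]
    show "deg_le (n + (3 * N - q)) (psd_coeff (expand3 (psd_act A P)) q)"
      unfolding deg_le_def
    proof (intro allI impI)
      fix p assume p: "n + (3 * N - q) < p"
      have "{(a, b, k). psd_act A P a b (p - int k) \<noteq> 0 \<and> a + b - int k = q} = {}"
      proof -
        have "a + b - int k \<noteq> q" if "psd_act A P a b (p - int k) \<noteq> 0" for a b k
          using b[OF that] p by linarith
        thus ?thesis by auto
      qed
      hence "expand_nu_lambda (psd_act A P) p q = 0" by (simp only: expand_nu_lambda_def sum.empty)
      thus "psd_coeff (psd_coeff (expand3 (psd_act A P)) q) p = 0"
        by (simp add: psd_coeff_expand3 three_var_act P)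
    qed
  qed (simp add: act_add expand3_add three_var_act P)
qed

text \<open>Here nu is the inner variable. Lowering the order of A lowers the order in nu but not
  that in lambda, so continuity in A holds only for each outer coefficient, and q is fixed before
  the extension argument.\<close>

lemma expand3_act:
  assumes "P \<in> three_var_series"
  shows "expand3 (psd_act A P) = fls_map ((\<odot>) A) (expand3 P)"
proof (rule psd_eqI)
  fix q
  have "psd_coeff (expand3 (psd_act A P)) q = A \<odot> psd_coeff (expand3 P) q"
  proof (rule psd_ext_E[where S = three_var_series and f = psd_actE and L = "\<lambda>A P. psd_coeff (expand3 (psd_act A P)) q"
      and R = "\<lambda>A P. A \<odot> psd_coeff (expand3 P) q", OF _ _ _ actE_surj _ _ assms])
    fix x and P :: "_ \<Rightarrow> _ \<Rightarrow> _ \<Rightarrow> 'a" assume P: "P \<in> three_var_series"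
    show "psd_coeff (expand3 (psd_act (fls_const x) P)) q = fls_const x \<odot> psd_coeff (expand3 P) q"
      by (rule psd_eqI) (simp add: act_const P expand3_map distrib_left fls_map_zero comp_const_left)
  next
    fix A and P :: "_ \<Rightarrow> _ \<Rightarrow> _ \<Rightarrow> 'a" assume P: "P \<in> three_var_series"
    have "fls_map (fls_map der) F = der F" for F :: "'a fls fls" by (simp add: der_fls_def)
    hence "psd_coeff (expand3 (psd_actE P)) q = psd_E (psd_coeff (expand3 P) q)"
      by (simp add: actE_eq P expand3_add three_var_shift three_var_map expand3_shift_nu expand3_map der_add psd_E_def
          fls_X_inv_times_conv_shift)
    thus "fls_shift 1 A \<odot> psd_coeff (expand3 P) q = A \<odot> psd_coeff (expand3 (psd_actE P)) q"
      by (simp add: comp_shift_left)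
  qed (simp_all add: psd_cts_expand3_act psd_cts_comp_left psd_cts_ident act_shift)
  thus "psd_coeff (expand3 (psd_act A P)) q = psd_coeff (fls_map ((\<odot>) A) (expand3 P)) q" by simp
qed

lemma swap_act: "swap_vars (psd_act A P) = psd_act A (swap_vars P)"
  by (simp add: fun_eq_iff swap_vars_def psd_act_def nu_row_def)

definition psd_tensor :: "'a::mult_zero fls \<Rightarrow> 'a fls \<Rightarrow> int \<Rightarrow> int \<Rightarrow> int \<Rightarrow> 'a" where
  "psd_tensor P Q a b c = (if c = 0 then psd_coeff P a * psd_coeff Q b else 0)"

lemma tensor_nonzero: "deg_le m P \<Longrightarrow> deg_le n Q \<Longrightarrow> psd_tensor P Q a b c \<noteq> 0 \<Longrightarrow> a \<le> m \<and> b \<le> n \<and> c = 0"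
  unfolding psd_tensor_def by (metis deg_leD mult_zero_left mult_zero_right not_le)

lemma three_var_tensor: "psd_tensor P Q \<in> three_var_series"
proof -
  obtain n where n: "deg_le n P" "deg_le n Q" "n \<ge> 0" by (rule deg_le_obtain)
  hence "bounded_by n (psd_tensor P Q)" unfolding bounded_by_def using tensor_nonzero[OF n(1,2)] by auto
  thus ?thesis by (auto simp: three_var_iff)
qed

lemma expand1_tensor: "expand1 (psd_tensor P Q) = fls_const P * psd_lift (Q :: 'a::comm_ring_1 fls)"
proof (rule psd2_eqI)
  fix q p
  have "expand_lambda_mu (psd_tensor P Q) p q = psd_tensor P Q p q 0"
    by (rule expand_c0[OF three_var_tensor]) (auto simp: psd_tensor_def split: if_splits)
  thus "psd_coeff (psd_coeff (expand1 (psd_tensor P Q)) q) p = psd_coeff (psd_coeff (fls_const P * psd_lift Q) q) p"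
    by (simp add: psd_coeff_expand1 three_var_tensor psd_tensor_def)
qed

lemma swap_tensor: "swap_vars (psd_tensor P Q) = psd_tensor Q (P :: 'a::comm_ring_1 fls)"
  by (auto simp: fun_eq_iff swap_vars_def psd_tensor_def mult.commute)

lemma psd_cts_expand3_tensor: "psd_cts (\<lambda>Q. expand3 (psd_tensor P (Q :: 'a::comm_ring_1 fls)))"
proof -
  obtain m where m: "deg_le m P" using ex_deg_le by blast
  show ?thesis
  proof (rule psd_ctsI[where d = m])
    fix n and Q :: "'a fls" assume n: "deg_le n Q"
    show "deg_le (n + m) (expand3 (psd_tensor P Q))"
      unfolding deg_le_def
    proof (intro allI impI psd_eqI)
      fix q p assume q: "n + m < q"
      have "{(a, b, k). psd_tensor P Q a b (p - int k) \<noteq> 0 \<and> a + b - int k = q} = {}"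
        using q by (auto dest!: tensor_nonzero[OF m n])
      hence "expand_nu_lambda (psd_tensor P Q) p q = 0" by (simp only: expand_nu_lambda_def sum.empty)
      thus "psd_coeff (psd_coeff (expand3 (psd_tensor P Q)) q) p = psd_coeff 0 p"
        by (simp add: psd_coeff_expand3 three_var_tensor)
    qed
  next
    fix Q R :: "'a fls"
    have "psd_tensor P (Q + R) = (\<lambda>a b c. psd_tensor P Q a b c + psd_tensor P R a b c)"
      by (simp add: fun_eq_iff psd_tensor_def distrib_left)
    thus "expand3 (psd_tensor P (Q + R)) = expand3 (psd_tensor P Q) + expand3 (psd_tensor P R)"
      by (simp add: expand3_add three_var_tensor)
  qed
qed

text \<open>Integration by parts. A factor of the derivation on the right of Q multiplies the left
  side by mu = nu - lambda. On the right side it gives minus \<open>psd_E2\<close>, whose two parts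
  turn, under the adjoint in the inner variable, into multiplication by nu and by -lambda. For
  negative powers nu - lambda is cancelled, the iterated series forming a domain.\<close>

lemma expand3_tensor:
  fixes P Q :: "'a::differential_idom fls"
  shows "expand3 (psd_tensor P Q) = fls_map psd_adjoint (psd_sigma (psd_adjoint Q) \<odot> psd_lift P)"
proof (rule psd_ext_shift[where L = "\<lambda>Q. expand3 (psd_tensor P Q)" and f = "\<lambda>F. fls_const fls_X_inv * F - fls_shift 1 F"
      and R = "\<lambda>Q. fls_map psd_adjoint (psd_sigma (psd_adjoint Q) \<odot> psd_lift P)"])
  fix x :: 'a
  have "expand_nu_lambda (psd_tensor P (fls_const x)) p q = psd_tensor P (fls_const x) q 0 p" for p q
    unfolding expand_nu_lambda_rotate
    by (subst expand_c0[OF three_var_rotate[OF three_var_tensor]])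
      (auto simp: rotate_vars_def psd_tensor_def split: if_splits)
  thus "expand3 (psd_tensor P (fls_const x)) = fls_map psd_adjoint (psd_sigma (psd_adjoint (fls_const x)) \<odot> psd_lift P)"
    by (intro psd2_eqI) (auto simp: psd_coeff_expand3 three_var_tensor adjoint_const sigma_const comp_const_left
        psd_tensor_def adjoint_zero mult.commute)
next
  have "(fls_const fls_X_inv - fls_X_inv :: 'a fls fls) \<noteq> 0"
  proof
    assume "(fls_const fls_X_inv - fls_X_inv :: 'a fls fls) = 0"
    hence "(fls_const fls_X_inv - fls_X_inv :: 'a fls fls) $$ (- 1) = 0" by (simp only: fls_zero_nth)
    thus False by simp
  qed
  hence "inj (\<lambda>F::'a fls fls. (fls_const fls_X_inv - fls_X_inv) * F)" by (simp add: inj_def)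
  thus "inj (\<lambda>F::'a fls fls. fls_const fls_X_inv * F - fls_shift 1 F)"
    by (simp add: left_diff_distrib fls_X_inv_times_conv_shift)
next
  fix Q :: "'a fls"
  have "psd_tensor P (fls_shift 1 Q) = shift_mu (psd_tensor P Q)"
    by (simp add: fun_eq_iff psd_tensor_def shift_mu_def)
  thus "expand3 (psd_tensor P (fls_shift 1 Q)) = fls_const fls_X_inv * expand3 (psd_tensor P Q) - fls_shift 1 (expand3 (psd_tensor P Q))"
    by (simp add: expand3_shift_mu three_var_tensor)
next
  fix Q :: "'a fls"
  define F where "F = psd_sigma (psd_adjoint Q) \<odot> psd_lift P"
  have "psd_sigma (psd_adjoint (fls_shift 1 Q)) \<odot> psd_lift P = - psd_E2 F"
  proof -
    have "psd_sigma (- psd_E (psd_adjoint Q)) = - psd_E2 (psd_sigma (psd_adjoint Q))"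
      by (simp add: additive_minus[of psd_sigma, OF sigma_add] E2_sigma)
    thus ?thesis by (simp add: adjoint_shift F_def E2_comp)
  qed
  moreover have "fls_map psd_adjoint (- psd_E2 F) = fls_const fls_X_inv * fls_map psd_adjoint F - fls_shift 1 (fls_map psd_adjoint F)"
    by (rule fls_eqI)
      (simp add: adjoint_zero psd_E2_def adjoint_minus adjoint_add additive_diff[of psd_adjoint, OF adjoint_add] adjoint_E E_0 fls_X_inv_times_conv_shift)
  ultimately show "fls_map psd_adjoint (psd_sigma (psd_adjoint (fls_shift 1 Q)) \<odot> psd_lift P) =
      fls_const fls_X_inv * fls_map psd_adjoint (psd_sigma (psd_adjoint Q) \<odot> psd_lift P) -
      fls_shift 1 (fls_map psd_adjoint (psd_sigma (psd_adjoint Q) \<odot> psd_lift P))"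
    by (simp add: F_def)
qed (simp_all add: psd_cts_expand3_tensor psd_cts_fls_map psd_cts_comp_left psd_cts_sigma psd_cts_adjoint psd_cts_ident adjoint_add)

section \<open>The terms of the Jacobi identity as bidifferential operators\<close>

lemma slot_diff: "(F - G) \<lhd> P = F \<lhd> P - G \<lhd> P" "(F - G) \<rhd> P = F \<rhd> P - G \<rhd> P"
  by (rule additive_diff, simp add: slot1_add slot2_add)+

lemma slot_zero [simp]: "0 \<lhd> P = 0" "0 \<rhd> P = 0"
  by (rule additive_zero, simp add: slot1_add slot2_add)+

lemma slot_minus: "(- F) \<lhd> P = - (F \<lhd> P)" "(- F) \<rhd> P = - (F \<rhd> P)"
  by (rule additive_minus, simp add: slot1_add slot2_add)+

lemma lift_slot1: "psd_lift x \<lhd> P = fls_const P * psd_lift x"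
  using slot1_const_mult_lift[of 1 x P] by simp

lemma const_mult_slot2: "(fls_const P * F) \<rhd> Q = fls_const P * (F \<rhd> Q)"
  by (simp add: slot2_def comp_const_mult_left)

lemma zero_three_var: "(\<lambda>a b c. 0) \<in> three_var_series"
  by (simp add: three_var_series_def)

lemma expand_zero: "expand1 (\<lambda>a b c. 0) = 0" "expand3 (\<lambda>a b c. 0) = 0"
  using expand1_diff[OF zero_three_var zero_three_var] expand3_diff[OF zero_three_var zero_three_var] by simp_all

lemma fls_map_adjoint_add: "fls_map psd_adjoint (F + G) = fls_map psd_adjoint F + fls_map psd_adjoint G"
  by (rule fls_eqI) (simp add: adjoint_zero adjoint_add)

lemmas fls_map_adjoint_diff = additive_diff[of "fls_map psd_adjoint", OF fls_map_adjoint_add]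
lemmas fls_map_adjoint_minus = additive_minus[of "fls_map psd_adjoint", OF fls_map_adjoint_add]

lemma swap_diff: "swap_vars (\<lambda>a b c. S a b c - T a b c) = (\<lambda>a b c. swap_vars S a b c - swap_vars T a b c)"
  "swap_vars (\<lambda>a b c. S a b c + T a b c) = (\<lambda>a b c. swap_vars S a b c + swap_vars T a b c)"
  by (simp_all add: fun_eq_iff swap_vars_def)

lemma swap_swap: "swap_vars (swap_vars T) = T"
  by (simp add: fun_eq_iff swap_vars_def)

text \<open>All expansions have as kernel exactly the multiples of nu - lambda - mu, so equality in
  one domain implies equality in every other one.\<close>

lemma expand1_cong_swap:
  assumes "S \<in> three_var_series" "T \<in> three_var_series" "expand1 (swap_vars S) = expand1 (swap_vars T)"
  shows "expand1 S = expand1 T"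
proof -
  let ?D = "\<lambda>a b c. S a b c - T a b c"
  have D: "?D \<in> three_var_series" by (rule three_var_diff[OF assms(1,2)])
  have "expand1 (swap_vars ?D) = 0"
    using assms by (simp add: swap_diff expand1_diff three_var_swap)
  hence "zero_in_quotient (swap_vars (swap_vars ?D))"
    using expand1_eq_0_iff[OF three_var_swap[OF D]] zero_in_quotient_swap by blast
  hence "expand1 ?D = 0" using expand1_eq_0_iff[OF D] by (simp only: swap_swap)
  thus ?thesis using assms by (simp add: expand1_diff)
qed

lemma expand1_cong_expand3:
  assumes "S \<in> three_var_series" "T \<in> three_var_series" "expand3 S = expand3 T"
  shows "expand1 S = expand1 T"
proof -
  let ?D = "\<lambda>a b c. S a b c - T a b c"
  have D: "?D \<in> three_var_series" by (rule three_var_diff[OF assms(1,2)])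
  have "expand3 ?D = 0" using assms by (simp add: expand3_diff)
  hence "expand1 ?D = 0" using expand3_eq_0_imp[OF D] expand1_eq_0_iff[OF D] by blast
  thus ?thesis using assms by (simp add: expand1_diff)
qed

text \<open>
  For \<open>\<theta> = (\<Sum>m. \<partial>a/\<partial>u\<^sup>(\<^sup>m\<^sup>) \<lambda>\<^sup>m)\<close> the operator \<open>fls_map \<theta> A\<close> sends \<open>(P, Q)\<close> to the derivative of \<open>A\<close>
  in the direction \<open>P\<close>, applied to \<open>Q\<close>. In \<open>represents_swapped \<theta> A F\<close> the arguments are exchanged,
  and in \<open>represents_dual \<theta> A F\<close> the result is the variational derivative of \<open>Q A(P)\<close> with \<open>P\<close> and
  \<open>Q\<close> fixed; in both cases \<open>F\<close> is the expansion in the domain \<open>|\<mu>| > |\<lambda>|\<close> common to all terms,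
  although the terms are naturally expanded elsewhere.
\<close>

definition represents_swapped ::
  "('a::differential_ring \<Rightarrow> 'a fls) \<Rightarrow> 'a fls \<Rightarrow> 'a fls fls \<Rightarrow> bool" where
  "represents_swapped \<theta> A F \<longleftrightarrow> (\<forall>P Q. \<exists>T\<in>three_var_series.
     expand1 T = F \<lhd> P \<rhd> Q \<and> expand1 (swap_vars T) = fls_map \<theta> A \<lhd> Q \<rhd> P)"

definition represents_dual ::
  "('a::differential_ring \<Rightarrow> 'a fls) \<Rightarrow> 'a fls \<Rightarrow> 'a fls fls \<Rightarrow> bool" where
  "represents_dual \<theta> A F \<longleftrightarrow> (\<forall>P Q. \<exists>T\<in>three_var_series.
     expand1 T = F \<lhd> P \<rhd> Q \<and>
     expand3 T = fls_map psd_adjoint (psd_sigma (psd_adjoint Q) \<odot> fls_map \<theta> A \<rhd> P))"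

lemma represents_swappedE:
  assumes "represents_swapped \<theta> A F"
  obtains T where "T \<in> three_var_series" "expand1 T = F \<lhd> P \<rhd> Q" "expand1 (swap_vars T) = fls_map \<theta> A \<lhd> Q \<rhd> P"
  using assms unfolding represents_swapped_def by blast

lemma represents_dualE:
  assumes "represents_dual \<theta> A F"
  obtains T where "T \<in> three_var_series" "expand1 T = F \<lhd> P \<rhd> Q"
    "expand3 T = fls_map psd_adjoint (psd_sigma (psd_adjoint Q) \<odot> fls_map \<theta> A \<rhd> P)"
  using assms unfolding represents_dual_def by blast

text \<open>For uniqueness the arguments P = Q = 1 suffice. Arbitrary P and Q are what the closure
  under composition needs, where the first argument of A is \<open>B \<odot> P\<close>.\<close>

lemma represents_swapped_unique:
  assumes "represents_swapped \<theta> A F" "represents_swapped \<theta> A G"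
  shows "F = G"
proof -
  obtain S where S: "S \<in> three_var_series" "expand1 S = F \<lhd> 1 \<rhd> 1" "expand1 (swap_vars S) = fls_map \<theta> A \<lhd> 1 \<rhd> 1"
    by (rule represents_swappedE[OF assms(1)])
  obtain T where T: "T \<in> three_var_series" "expand1 T = G \<lhd> 1 \<rhd> 1" "expand1 (swap_vars T) = fls_map \<theta> A \<lhd> 1 \<rhd> 1"
    by (rule represents_swappedE[OF assms(2)])
  show ?thesis using expand1_cong_swap[OF S(1) T(1)] S T by simp
qed

lemma represents_dual_unique:
  assumes "represents_dual \<theta> A F" "represents_dual \<theta> A G"
  shows "F = G"
proof -
  obtain S where S: "S \<in> three_var_series" "expand1 S = F \<lhd> 1 \<rhd> 1"
    "expand3 S = fls_map psd_adjoint (psd_sigma (psd_adjoint 1) \<odot> fls_map \<theta> A \<rhd> 1)"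
    by (rule represents_dualE[OF assms(1)])
  obtain T where T: "T \<in> three_var_series" "expand1 T = G \<lhd> 1 \<rhd> 1"
    "expand3 T = fls_map psd_adjoint (psd_sigma (psd_adjoint 1) \<odot> fls_map \<theta> A \<rhd> 1)"
    by (rule represents_dualE[OF assms(2)])
  show ?thesis using expand1_cong_expand3[OF S(1) T(1)] S T by simp
qed

context
  fixes \<theta> :: "'a::differential_idom \<Rightarrow> 'a fls"
  assumes \<theta>: "twisted_der \<theta>"
begin

text \<open>For multiplication by x the value is P times the derivative of x in the direction Q.
  This is a product of a series in lambda and one in mu, without nu, so no expansion is
  involved.\<close>

lemma represents_swapped_const: "represents_swapped \<theta> (fls_const x) (psd_lift (\<theta> x))"
  unfolding represents_swapped_def
proof (intro allI)
  fix P Q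
  show "\<exists>T\<in>three_var_series. expand1 T = psd_lift (\<theta> x) \<lhd> P \<rhd> Q \<and>
      expand1 (swap_vars T) = fls_map \<theta> (fls_const x) \<lhd> Q \<rhd> P"
  proof (intro bexI[of _ "psd_tensor P (\<theta> x \<odot> Q)"] conjI three_var_tensor)
    show "expand1 (psd_tensor P (\<theta> x \<odot> Q)) = psd_lift (\<theta> x) \<lhd> P \<rhd> Q"
      by (simp only: expand1_tensor lift_slot1 const_mult_slot2) (simp only: slot2_def lift_comp)
    show "expand1 (swap_vars (psd_tensor P (\<theta> x \<odot> Q))) = fls_map \<theta> (fls_const x) \<lhd> Q \<rhd> P"
      by (simp add: swap_tensor expand1_tensor delta_const[OF \<theta>] slot1_const slot2_def comp_const_left)
  qed
qed

text \<open>The variational derivative of Q x P is the adjoint of \<open>\<theta> x\<close> applied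
  to the product of P and Q; the adjoint therefore acts through nu on the tensor.\<close>

lemma represents_dual_const: "represents_dual \<theta> (fls_const x) (psd_sigma (psd_adjoint (\<theta> x)))"
  unfolding represents_dual_def
proof (intro allI)
  fix P Q
  let ?y = "psd_adjoint (\<theta> x)"
  show "\<exists>T\<in>three_var_series. expand1 T = psd_sigma ?y \<lhd> P \<rhd> Q \<and>
      expand3 T = fls_map psd_adjoint (psd_sigma (psd_adjoint Q) \<odot> fls_map \<theta> (fls_const x) \<rhd> P)"
  proof (intro bexI[of _ "psd_act ?y (psd_tensor P Q)"] conjI three_var_act three_var_tensor)
    have "psd_sigma ?y \<lhd> P \<rhd> Q = psd_sigma ?y \<odot> (1 \<lhd> P \<rhd> Q)"
      using slot1_left[of ?y 1 P] slot2_left[of "psd_sigma ?y" "1 \<lhd> P" Q] by simp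
    also have "1 \<lhd> P \<rhd> Q = fls_const P * psd_lift Q"
      using slot1_const[of 1 P] by (simp add: slot2_def comp_const_left)
    finally show "expand1 (psd_act ?y (psd_tensor P Q)) = psd_sigma ?y \<lhd> P \<rhd> Q"
      by (simp add: expand1_act three_var_tensor expand1_tensor)
    have "psd_sigma (psd_adjoint Q) \<odot> fls_map \<theta> (fls_const x) \<rhd> P = (psd_sigma (psd_adjoint Q) \<odot> psd_lift P) \<lhd> \<theta> x"
      by (simp add: delta_const[OF \<theta>] slot1_left slot2_left)
        (simp add: slot2_def comp_const_left lift_slot1)
    thus "expand3 (psd_act ?y (psd_tensor P Q)) =
        fls_map psd_adjoint (psd_sigma (psd_adjoint Q) \<odot> fls_map \<theta> (fls_const x) \<rhd> P)"
      by (intro fls_eqI) (simp add: expand3_act three_var_tensor expand3_tensor adjoint_zero adjoint_comp)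
  qed
qed

lemma delta_partial: "fls_map \<theta> (fls_shift 1 1) = 0"
  using delta_const[OF \<theta>, of 1] by (simp add: delta_shift[OF \<theta>] twisted_one[OF \<theta>])

lemma represents_partial: "represents_swapped \<theta> (fls_shift 1 1) 0" "represents_dual \<theta> (fls_shift 1 1) 0"
  unfolding represents_swapped_def represents_dual_def
  by (auto intro!: bexI[of _ "\<lambda>a b c. 0"] simp: zero_three_var expand_zero delta_partial swap_vars_def[abs_def]
      fls_map_zero[of psd_adjoint, OF adjoint_zero])

lemma delta_diff: "fls_map \<theta> (A - B) = fls_map \<theta> A - fls_map \<theta> B"
  by (rule additive_diff) (rule delta_add[OF \<theta>])

lemma represents_swapped_diff:
  assumes "represents_swapped \<theta> A F" "represents_swapped \<theta> B G"
  shows "represents_swapped \<theta> (A - B) (F - G)"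
  unfolding represents_swapped_def
proof (intro allI)
  fix P Q
  obtain S where S: "S \<in> three_var_series" "expand1 S = F \<lhd> P \<rhd> Q" "expand1 (swap_vars S) = fls_map \<theta> A \<lhd> Q \<rhd> P"
    by (rule represents_swappedE[OF assms(1)])
  obtain T where T: "T \<in> three_var_series" "expand1 T = G \<lhd> P \<rhd> Q" "expand1 (swap_vars T) = fls_map \<theta> B \<lhd> Q \<rhd> P"
    by (rule represents_swappedE[OF assms(2)])
  show "\<exists>T\<in>three_var_series. expand1 T = (F - G) \<lhd> P \<rhd> Q \<and> expand1 (swap_vars T) = fls_map \<theta> (A - B) \<lhd> Q \<rhd> P"
    using S T by (intro bexI[OF _ three_var_diff[OF S(1) T(1)]])
      (simp add: expand1_diff swap_diff three_var_swap slot_diff delta_diff)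
qed

lemma represents_dual_diff:
  assumes "represents_dual \<theta> A F" "represents_dual \<theta> B G"
  shows "represents_dual \<theta> (A - B) (F - G)"
  unfolding represents_dual_def
proof (intro allI)
  fix P Q
  obtain S where S: "S \<in> three_var_series" "expand1 S = F \<lhd> P \<rhd> Q"
    "expand3 S = fls_map psd_adjoint (psd_sigma (psd_adjoint Q) \<odot> fls_map \<theta> A \<rhd> P)"
    by (rule represents_dualE[OF assms(1)])
  obtain T where T: "T \<in> three_var_series" "expand1 T = G \<lhd> P \<rhd> Q"
    "expand3 T = fls_map psd_adjoint (psd_sigma (psd_adjoint Q) \<odot> fls_map \<theta> B \<rhd> P)"
    by (rule represents_dualE[OF assms(2)])
  show "\<exists>T\<in>three_var_series. expand1 T = (F - G) \<lhd> P \<rhd> Q \<and>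
      expand3 T = fls_map psd_adjoint (psd_sigma (psd_adjoint Q) \<odot> fls_map \<theta> (A - B) \<rhd> P)"
    using S T by (intro bexI[OF _ three_var_diff[OF S(1) T(1)]])
      (simp add: expand1_diff expand3_diff slot_diff delta_diff comp_diff_right fls_map_adjoint_diff)
qed

text \<open>The derivative falls either on A, with first argument \<open>B \<odot> P\<close>, or on
  B, with A applied to the result through nu.\<close>

lemma represents_swapped_comp:
  assumes "represents_swapped \<theta> A F" "represents_swapped \<theta> B G"
  shows "represents_swapped \<theta> (A \<odot> B) (F \<lhd> B + psd_sigma A \<odot> G)"
  unfolding represents_swapped_def
proof (intro allI)
  fix P Q
  obtain S where S: "S \<in> three_var_series" "expand1 S = F \<lhd> (B \<odot> P) \<rhd> Q"
    "expand1 (swap_vars S) = fls_map \<theta> A \<lhd> Q \<rhd> (B \<odot> P)"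
    by (rule represents_swappedE[OF assms(1)])
  obtain T where T: "T \<in> three_var_series" "expand1 T = G \<lhd> P \<rhd> Q" "expand1 (swap_vars T) = fls_map \<theta> B \<lhd> Q \<rhd> P"
    by (rule represents_swappedE[OF assms(2)])
  note AT = three_var_act[OF T(1), of A]
  show "\<exists>T\<in>three_var_series. expand1 T = (F \<lhd> B + psd_sigma A \<odot> G) \<lhd> P \<rhd> Q \<and>
      expand1 (swap_vars T) = fls_map \<theta> (A \<odot> B) \<lhd> Q \<rhd> P"
    using S T AT by (intro bexI[OF _ three_var_add[OF S(1) AT]])
      (simp add: expand1_add swap_diff swap_act three_var_swap three_var_act expand1_act slot1_add slot2_add slot1_comp slot2_comp slot1_left
        slot2_left slot1_slot2 delta_comp[OF \<theta>])
qed

text \<open>In the pairing of Q with A(B(P)), a variation of A sees the arguments B(P) and Q, while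
  a variation of B sees P and the adjoint of A applied to Q.\<close>

lemma represents_dual_comp:
  assumes "represents_dual \<theta> A F" "represents_dual \<theta> B G"
  shows "represents_dual \<theta> (A \<odot> B) (F \<lhd> B + G \<rhd> psd_adjoint A)"
  unfolding represents_dual_def
proof (intro allI)
  fix P Q
  obtain S where S: "S \<in> three_var_series" "expand1 S = F \<lhd> (B \<odot> P) \<rhd> Q"
    "expand3 S = fls_map psd_adjoint (psd_sigma (psd_adjoint Q) \<odot> fls_map \<theta> A \<rhd> (B \<odot> P))"
    by (rule represents_dualE[OF assms(1)])
  obtain T where T: "T \<in> three_var_series" "expand1 T = G \<lhd> P \<rhd> (psd_adjoint A \<odot> Q)"
    "expand3 T = fls_map psd_adjoint (psd_sigma (psd_adjoint (psd_adjoint A \<odot> Q)) \<odot> fls_map \<theta> B \<rhd> P)"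
    by (rule represents_dualE[OF assms(2)])
  show "\<exists>T\<in>three_var_series. expand1 T = (F \<lhd> B + G \<rhd> psd_adjoint A) \<lhd> P \<rhd> Q \<and>
      expand3 T = fls_map psd_adjoint (psd_sigma (psd_adjoint Q) \<odot> fls_map \<theta> (A \<odot> B) \<rhd> P)"
    using S T by (intro bexI[OF _ three_var_add[OF S(1) T(1)]])
      (simp add: expand1_add expand3_add slot1_add slot2_add slot1_comp slot2_comp slot2_left
        slot1_slot2 delta_comp[OF \<theta>] comp_add_right fls_map_adjoint_add adjoint_comp adjoint_adjoint sigma_comp comp_assoc)
qed

lemma represents_swapped_inverse:
  assumes "represents_swapped \<theta> A F" "A \<odot> B = 1" "B \<odot> A = 1"
  shows "represents_swapped \<theta> B (- (psd_sigma B \<odot> (F \<lhd> B)))"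
  unfolding represents_swapped_def
proof (intro allI)
  fix P Q
  obtain S where S: "S \<in> three_var_series" "expand1 S = F \<lhd> (B \<odot> P) \<rhd> Q"
    "expand1 (swap_vars S) = fls_map \<theta> A \<lhd> Q \<rhd> (B \<odot> P)"
    by (rule represents_swappedE[OF assms(1)])
  note BS = three_var_act[OF S(1), of "- B"]
  have "psd_sigma (- B) = - psd_sigma B" by (rule additive_minus) (rule sigma_add)
  thus "\<exists>T\<in>three_var_series. expand1 T = - (psd_sigma B \<odot> (F \<lhd> B)) \<lhd> P \<rhd> Q \<and>
      expand1 (swap_vars T) = fls_map \<theta> B \<lhd> Q \<rhd> P"
    using S by (intro bexI[OF _ BS])
      (simp add: swap_act three_var_swap expand1_act slot1_comp slot2_comp slot1_left slot_minus
        slot2_left slot1_slot2 delta_inverse[OF \<theta> assms(2,3)])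
qed

text \<open>The derivative of B is minus B, the derivative of A, and B in succession. In the pairing
  with Q the outer B passes to Q as its adjoint.\<close>

lemma represents_dual_inverse:
  assumes "represents_dual \<theta> A F" "A \<odot> B = 1" "B \<odot> A = 1"
  shows "represents_dual \<theta> B (- (F \<lhd> B \<rhd> psd_adjoint B))"
  unfolding represents_dual_def
proof (intro allI)
  fix P Q
  obtain S where S: "S \<in> three_var_series" "expand1 S = F \<lhd> (B \<odot> P) \<rhd> (psd_adjoint B \<odot> Q)"
    "expand3 S = fls_map psd_adjoint (psd_sigma (psd_adjoint (psd_adjoint B \<odot> Q)) \<odot> fls_map \<theta> A \<rhd> (B \<odot> P))"
    by (rule represents_dualE[OF assms(1)])
  show "\<exists>T\<in>three_var_series. expand1 T = - (F \<lhd> B \<rhd> psd_adjoint B) \<lhd> P \<rhd> Q \<and>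
      expand3 T = fls_map psd_adjoint (psd_sigma (psd_adjoint Q) \<odot> fls_map \<theta> B \<rhd> P)"
    using S expand1_diff[OF zero_three_var S(1)] expand3_diff[OF zero_three_var S(1)]
    by (intro bexI[OF _ three_var_diff[OF zero_three_var S(1)]])
      (simp add: expand_zero slot1_comp slot2_comp slot_minus slot2_left slot1_slot2
        delta_inverse[OF \<theta> assms(2,3)] fls_map_adjoint_minus adjoint_comp adjoint_adjoint sigma_comp comp_assoc)
qed

end

lemma represents_exist:
  fixes \<theta> :: "'v::differential_idom fract \<Rightarrow> 'v fract fls"
  assumes \<theta>: "twisted_der \<theta>" and "A \<in> rational_over_fractions"
  shows "\<exists>F. represents_swapped \<theta> A F" "\<exists>F. represents_dual \<theta> A F"
proof -
  show "\<exists>F. represents_swapped \<theta> A F"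
    using assms(2) by (induction A rule: rational_induct)
      (blast intro: represents_swapped_const represents_partial represents_swapped_diff represents_swapped_comp
        represents_swapped_inverse \<theta>)+
  show "\<exists>F. represents_dual \<theta> A F"
    using assms(2) by (induction A rule: rational_induct)
      (blast intro: represents_dual_const represents_partial represents_dual_diff represents_dual_comp
        represents_dual_inverse \<theta>)+
qed

text \<open>On rational operators over the fractions this is well defined, by
  \<open>represents_exist\<close> and \<open>represents_swapped_unique\<close>; elsewhere the value
  is arbitrary.\<close>

definition delta_swapped :: "('a::differential_ring \<Rightarrow> 'a fls) \<Rightarrow> 'a fls \<Rightarrow> 'a fls fls" where
  "delta_swapped \<theta> A = (SOME F. represents_swapped \<theta> A F)"

definition delta_dual :: "('a::differential_ring \<Rightarrow> 'a fls) \<Rightarrow> 'a fls \<Rightarrow> 'a fls fls" where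
  "delta_dual \<theta> A = (SOME F. represents_dual \<theta> A F)"

lemma delta_swapped_eqI: "represents_swapped \<theta> A F \<Longrightarrow> delta_swapped \<theta> A = F"
  unfolding delta_swapped_def using represents_swapped_unique by (metis someI)

lemma delta_dual_eqI: "represents_dual \<theta> A F \<Longrightarrow> delta_dual \<theta> A = F"
  unfolding delta_dual_def using represents_dual_unique by (metis someI)

section \<open>Matrices\<close>

type_synonym ('a, 'i) psd_array = "((('a fls fls, 'i) vec, 'i) vec, 'i) vec"

text \<open>The entry \<open>k, i, j\<close> is the component \<open>k\<close> of the value at the basis vectors \<open>i\<close> and \<open>j\<close>.\<close>

definition psdm_left :: "('a::differential_ring, 'i::finite) psd_matrix \<Rightarrow> ('a, 'i) psd_array \<Rightarrow> ('a, 'i) psd_array" where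
  "psdm_left A F = (\<chi> k i j. \<Sum>l\<in>UNIV. psd_sigma (A $ k $ l) \<odot> F $ l $ i $ j)"

definition psdm_slot1 :: "('a::differential_ring, 'i::finite) psd_array \<Rightarrow> ('a, 'i) psd_matrix \<Rightarrow> ('a, 'i) psd_array"
    (infixl "\<lhd>\<^sub>M" 75) where
  "F \<lhd>\<^sub>M P = (\<chi> k i j. \<Sum>l\<in>UNIV. F $ k $ l $ j \<lhd> P $ l $ i)"

definition psdm_slot2 :: "('a::differential_ring, 'i::finite) psd_array \<Rightarrow> ('a, 'i) psd_matrix \<Rightarrow> ('a, 'i) psd_array"
    (infixl "\<rhd>\<^sub>M" 75) where
  "F \<rhd>\<^sub>M Q = (\<chi> k i j. \<Sum>l\<in>UNIV. F $ k $ i $ l \<rhd> Q $ l $ j)"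

lemmas slot1_sum_left = additive_sum[of "\<lambda>F. F \<lhd> P", OF slot1_add(1)] for P
lemmas slot1_sum_right = additive_sum[of "\<lambda>P. F \<lhd> P", OF slot1_add(2)] for F
lemmas slot2_sum_left = additive_sum[of "\<lambda>F. F \<rhd> P", OF slot2_add(1)] for P
lemmas slot2_sum_right = additive_sum[of "\<lambda>P. F \<rhd> P", OF slot2_add(2)] for F
lemmas slot_zero_right [simp] = additive_zero[of "\<lambda>P. F \<lhd> P", OF slot1_add(2)] additive_zero[of "\<lambda>P. F \<rhd> P", OF slot2_add(2)] for F
lemmas sigma_sum = additive_sum[of psd_sigma, OF sigma_add]
lemmas sigma_zero [simp] = additive_zero[of psd_sigma, OF sigma_add]

lemma psdm_comp_assoc: "(A \<odot>\<^sub>M B) \<odot>\<^sub>M C = A \<odot>\<^sub>M (B \<odot>\<^sub>M C)"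
  by (simp add: vec_eq_iff psdm_comp_def comp_sum_left comp_sum_right comp_assoc) (intro allI, rule sum.swap)

lemma psdm_comp_one [simp]: "psdm_one \<odot>\<^sub>M A = A" "A \<odot>\<^sub>M psdm_one = A"
  by (simp_all add: vec_eq_iff psdm_comp_def psdm_one_def if_distrib if_distribR cong: if_cong)

lemma psdm_comp_add: "(A + B) \<odot>\<^sub>M C = A \<odot>\<^sub>M C + B \<odot>\<^sub>M C" "A \<odot>\<^sub>M (B + C) = A \<odot>\<^sub>M B + A \<odot>\<^sub>M C"
  by (simp_all add: vec_eq_iff psdm_comp_def comp_add_left comp_add_right sum.distrib)

lemmas psdm_comp_minus_left = additive_minus[of "\<lambda>A. A \<odot>\<^sub>M C", OF psdm_comp_add(1)] for C
lemmas psdm_comp_minus_right = additive_minus[of "\<lambda>A. C \<odot>\<^sub>M A", OF psdm_comp_add(2)] for C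
lemmas psdm_comp_minus = psdm_comp_minus_left psdm_comp_minus_right

lemma psdm_adjoint_comp: "psdm_adjoint (A \<odot>\<^sub>M B) = psdm_adjoint B \<odot>\<^sub>M psdm_adjoint A"
  by (simp add: vec_eq_iff psdm_comp_def psdm_adjoint_def adjoint_sum adjoint_comp)

lemma psdm_adjoint_add: "psdm_adjoint (A + B) = psdm_adjoint A + psdm_adjoint B"
  by (simp add: vec_eq_iff psdm_adjoint_def adjoint_add)

lemma psdm_adjoint_one: "psdm_adjoint psdm_one = psdm_one"
  by (simp add: vec_eq_iff psdm_adjoint_def psdm_one_def adjoint_one adjoint_zero)

lemma left_comp: "psdm_left (A \<odot>\<^sub>M B) F = psdm_left A (psdm_left B F)"
  by (simp add: vec_eq_iff psdm_left_def psdm_comp_def comp_sum_left comp_sum_right sigma_sum sigma_comp comp_assoc)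
    (intro allI, rule sum.swap)

lemma left_one [simp]: "psdm_left psdm_one F = F"
  by (simp add: vec_eq_iff psdm_left_def psdm_one_def if_distrib if_distribR cong: if_cong)

lemma left_add: "psdm_left (A + B) F = psdm_left A F + psdm_left B F" "psdm_left A (F + G) = psdm_left A F + psdm_left A G"
  by (simp_all add: vec_eq_iff psdm_left_def sigma_add comp_add_left comp_add_right sum.distrib)

lemma slot1M_add: "(F + G) \<lhd>\<^sub>M P = F \<lhd>\<^sub>M P + G \<lhd>\<^sub>M P" "F \<lhd>\<^sub>M (P + Q) = F \<lhd>\<^sub>M P + F \<lhd>\<^sub>M Q"
  by (simp_all add: vec_eq_iff psdm_slot1_def slot1_add sum.distrib)

lemma slot2M_add: "(F + G) \<rhd>\<^sub>M P = F \<rhd>\<^sub>M P + G \<rhd>\<^sub>M P" "F \<rhd>\<^sub>M (P + Q) = F \<rhd>\<^sub>M P + F \<rhd>\<^sub>M Q"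
  by (simp_all add: vec_eq_iff psdm_slot2_def slot2_add sum.distrib)

lemma slot1M_comp: "F \<lhd>\<^sub>M (P \<odot>\<^sub>M Q) = F \<lhd>\<^sub>M P \<lhd>\<^sub>M Q"
  by (simp add: vec_eq_iff psdm_slot1_def psdm_comp_def slot1_sum_left slot1_sum_right slot1_comp)
    (intro allI, rule sum.swap)

lemma slot2M_comp: "F \<rhd>\<^sub>M (P \<odot>\<^sub>M Q) = F \<rhd>\<^sub>M P \<rhd>\<^sub>M Q"
  by (simp add: vec_eq_iff psdm_slot2_def psdm_comp_def slot2_sum_left slot2_sum_right slot2_comp)
    (intro allI, rule sum.swap)

lemma slotM_one [simp]: "F \<lhd>\<^sub>M psdm_one = F" "F \<rhd>\<^sub>M psdm_one = F"
  by (simp_all add: vec_eq_iff psdm_slot1_def psdm_slot2_def psdm_one_def if_distrib if_distribR cong: if_cong)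

lemma slot1M_left: "psdm_left A F \<lhd>\<^sub>M P = psdm_left A (F \<lhd>\<^sub>M P)"
  by (simp add: vec_eq_iff psdm_slot1_def psdm_left_def slot1_sum_left comp_sum_right slot1_left)
    (intro allI, rule sum.swap)

lemma slot2M_left: "psdm_left A F \<rhd>\<^sub>M P = psdm_left A (F \<rhd>\<^sub>M P)"
  by (simp add: vec_eq_iff psdm_slot2_def psdm_left_def slot2_sum_left comp_sum_right slot2_left)
    (intro allI, rule sum.swap)

lemma slot1M_slot2M: "F \<rhd>\<^sub>M Q \<lhd>\<^sub>M P = F \<lhd>\<^sub>M P \<rhd>\<^sub>M Q"
  by (simp add: vec_eq_iff psdm_slot1_def psdm_slot2_def slot1_sum_left slot2_sum_left slot1_slot2)
    (intro allI, rule sum.swap)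

lemmas left_minus1 = additive_minus[of "\<lambda>A. psdm_left A F", OF left_add(1)] for F
lemmas left_minus2 = additive_minus[of "psdm_left A", OF left_add(2)] for A
lemmas left_diff2 = additive_diff[of "psdm_left A", OF left_add(2)] for A
lemmas left_zero2 = additive_zero[of "psdm_left A", OF left_add(2)] for A
lemmas slot1M_minus1 = additive_minus[of "\<lambda>F. F \<lhd>\<^sub>M P", OF slot1M_add(1)] for P
lemmas slot1M_diff1 = additive_diff[of "\<lambda>F. F \<lhd>\<^sub>M P", OF slot1M_add(1)] for P
lemmas slot1M_zero1 = additive_zero[of "\<lambda>F. F \<lhd>\<^sub>M P", OF slot1M_add(1)] for P
lemmas slot2M_minus1 = additive_minus[of "\<lambda>F. F \<rhd>\<^sub>M P", OF slot2M_add(1)] for P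
lemmas slot2M_minus2 = additive_minus[of "\<lambda>P. F \<rhd>\<^sub>M P", OF slot2M_add(2)] for F
lemmas slot2M_diff1 = additive_diff[of "\<lambda>F. F \<rhd>\<^sub>M P", OF slot2M_add(1)] for P
lemmas slot2M_zero1 = additive_zero[of "\<lambda>F. F \<rhd>\<^sub>M P", OF slot2M_add(1)] for P

lemmas array_simps = left_comp left_add slot1M_add slot2M_add slot1M_comp slot2M_comp slot1M_left slot2M_left
  slot1M_slot2M left_minus1 left_minus2 left_diff2 left_zero2 slot1M_minus1 slot1M_diff1 slot1M_zero1
  slot2M_minus1 slot2M_minus2 slot2M_diff1 slot2M_zero1

definition psdm_const :: "'a::zero \<Rightarrow> ('a, 'i::finite) psd_matrix" where
  "psdm_const c = (\<chi> i j. if i = j then fls_const c else 0)"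

lemma psdm_const_comp: "psdm_const c \<odot>\<^sub>M A = (\<chi> i j. fls_const c * A $ i $ j)"
  by (simp add: vec_eq_iff psdm_comp_def psdm_const_def if_distrib if_distribR comp_const_left cong: if_cong)

lemma psdm_const_commute: "der c = 0 \<Longrightarrow> A \<odot>\<^sub>M psdm_const c = psdm_const c \<odot>\<^sub>M A"
  using comp_const_right[of c _ 1]
  by (simp add: vec_eq_iff psdm_const_comp) (simp add: psdm_comp_def psdm_const_def if_distrib if_distribR cong: if_cong)

lemma psdm_adjoint_const: "psdm_adjoint (psdm_const c) = psdm_const c"
  by (simp add: vec_eq_iff psdm_adjoint_def psdm_const_def adjoint_const adjoint_zero)

text \<open>A constant commutes with the derivation and may move from the result to an argument. In
  \<open>dform_const\<close> it appears on the left in \<open>d1\<close> and \<open>d2\<close>, but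
  at the second argument in \<open>d3\<close>.\<close>

lemma left_const: "der c = 0 \<Longrightarrow> psdm_left (psdm_const c) F = F \<rhd>\<^sub>M psdm_const c"
proof -
  assume c: "der c = 0"
  have "der (fls_const c) = 0" using c by (intro fls_eqI) simp
  from comp_const_right[OF this, of _ 1]
  have "fls_const (fls_const c) * X = X \<rhd> fls_const c" for X
    by (simp add: slot2_def lift_const)
  thus ?thesis
    by (simp add: vec_eq_iff psdm_left_def psdm_slot2_def psdm_const_def if_distrib if_distribR sigma_const
        comp_const_left cong: if_cong)
qed

section \<open>Hamiltonian operators and closed two-forms over the field of fractions\<close>

definition rational_fraction_matrices :: "('v::differential_idom fract, 'i::finite) psd_matrix set" where
  "rational_fraction_matrices = {A. \<forall>i j. A $ i $ j \<in> rational_over_fractions}"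

lemma rational_zero: "0 \<in> rational_over_fractions"
  using rational_closed(2)[OF rational_closed(1) rational_closed(1)] by simp

lemma rational_add: "A \<in> rational_over_fractions \<Longrightarrow> B \<in> rational_over_fractions \<Longrightarrow> A + B \<in> rational_over_fractions"
  using rational_closed(2)[of A "0 - B"] rational_closed(2)[OF rational_zero, of B] by simp

lemma rational_sum: "(\<And>x. x \<in> S \<Longrightarrow> f x \<in> rational_over_fractions) \<Longrightarrow> sum f S \<in> rational_over_fractions"
  by (induction S rule: infinite_finite_induct) (auto simp: rational_zero rational_add)

lemma rational_matrix_add: "A \<in> rational_fraction_matrices \<Longrightarrow> B \<in> rational_fraction_matrices \<Longrightarrow> A + B \<in> rational_fraction_matrices"
  by (simp add: rational_fraction_matrices_def rational_add)

lemma rational_matrix_comp: "A \<in> rational_fraction_matrices \<Longrightarrow> B \<in> rational_fraction_matrices \<Longrightarrow> A \<odot>\<^sub>M B \<in> rational_fraction_matrices"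
  by (simp add: rational_fraction_matrices_def psdm_comp_def rational_sum rational_closed)

lemma rational_matrix_one: "psdm_one \<in> rational_fraction_matrices"
  by (simp add: rational_fraction_matrices_def psdm_one_def rational_closed rational_zero)

lemma rational_matrix_power: "A \<in> rational_fraction_matrices \<Longrightarrow> psdm_power A n \<in> rational_fraction_matrices"
  by (induction n) (simp_all add: rational_matrix_one rational_matrix_comp)

lemma psdm_power_commute: "psdm_power A n \<odot>\<^sub>M A = A \<odot>\<^sub>M psdm_power A n"
  by (induction n) (simp_all add: psdm_comp_assoc)

lemma psdm_power_add: "psdm_power A (m + n) = psdm_power A m \<odot>\<^sub>M psdm_power A n"
  by (induction m) (simp_all add: psdm_comp_assoc)

text \<open>One derivation for each differential variable. The calculus of two-forms and torsions
  needs nothing else of the partial derivatives.\<close>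

locale twisted_derivations =
  fixes \<theta> :: "'i::finite \<Rightarrow> 'v::differential_idom fract \<Rightarrow> 'v fract fls"
  assumes \<theta>: "twisted_der (\<theta> s)"
begin

lemma represents_delta:
  assumes "A \<in> rational_over_fractions"
  shows "represents_swapped (\<theta> s) A (delta_swapped (\<theta> s) A)" "represents_dual (\<theta> s) A (delta_dual (\<theta> s) A)"
  unfolding delta_swapped_def delta_dual_def using represents_exist[OF \<theta> assms] by (metis someI)+

lemma delta_diff_rational:
  assumes "A \<in> rational_over_fractions" "B \<in> rational_over_fractions"
  shows "delta_swapped (\<theta> s) (A - B) = delta_swapped (\<theta> s) A - delta_swapped (\<theta> s) B"
    and "delta_dual (\<theta> s) (A - B) = delta_dual (\<theta> s) A - delta_dual (\<theta> s) B"
  using represents_delta assms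
  by (auto intro!: delta_swapped_eqI delta_dual_eqI represents_swapped_diff represents_dual_diff \<theta>)

lemma delta_zero: "delta_swapped (\<theta> s) 0 = 0" "delta_dual (\<theta> s) 0 = 0"
  using delta_diff_rational[OF rational_zero rational_zero] by simp_all

lemma delta_add_rational:
  assumes "A \<in> rational_over_fractions" "B \<in> rational_over_fractions"
  shows "delta_swapped (\<theta> s) (A + B) = delta_swapped (\<theta> s) A + delta_swapped (\<theta> s) B"
    and "delta_dual (\<theta> s) (A + B) = delta_dual (\<theta> s) A + delta_dual (\<theta> s) B"
  using delta_diff_rational[OF rational_add[OF assms] assms(2), of s] by (simp_all add: algebra_simps)

lemma delta_sum_rational:
  assumes "\<And>x. x \<in> S \<Longrightarrow> f x \<in> rational_over_fractions"
  shows "delta_swapped (\<theta> s) (sum f S) = (\<Sum>x\<in>S. delta_swapped (\<theta> s) (f x))"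
    and "delta_dual (\<theta> s) (sum f S) = (\<Sum>x\<in>S. delta_dual (\<theta> s) (f x))"
  using assms by (induction S rule: infinite_finite_induct) (auto simp: delta_zero delta_add_rational rational_sum)

lemma delta_comp_rational:
  assumes "A \<in> rational_over_fractions" "B \<in> rational_over_fractions"
  shows "delta_swapped (\<theta> s) (A \<odot> B) = delta_swapped (\<theta> s) A \<lhd> B + psd_sigma A \<odot> delta_swapped (\<theta> s) B"
    and "delta_dual (\<theta> s) (A \<odot> B) = delta_dual (\<theta> s) A \<lhd> B + delta_dual (\<theta> s) B \<rhd> psd_adjoint A"
  using represents_delta assms
  by (auto intro!: delta_swapped_eqI delta_dual_eqI represents_swapped_comp represents_dual_comp \<theta>)

lemma delta_const_zero:
  assumes "\<theta> s c = 0"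
  shows "delta_swapped (\<theta> s) (fls_const c) = 0" "delta_dual (\<theta> s) (fls_const c) = 0"
  using represents_swapped_const[OF \<theta>, of s c] represents_dual_const[OF \<theta>, of s c] assms
  by (auto intro!: delta_swapped_eqI delta_dual_eqI simp: adjoint_zero psd_lift_def fls_map_zero)

text \<open>
  \<open>d1 A\<close> and \<open>d2 A\<close> differentiate \<open>A\<close> in the direction of the first and second argument and apply
  the result to the other one; \<open>d3 A\<close> is the variational derivative of the pairing of the second
  argument with the value of \<open>A\<close> at the first one.
\<close>

definition d1 :: "('v fract, 'i) psd_matrix \<Rightarrow> ('v fract, 'i) psd_array" where
  "d1 A = (\<chi> k i j. fls_map (\<theta> i) (A $ k $ j))"

definition d2 :: "('v fract, 'i) psd_matrix \<Rightarrow> ('v fract, 'i) psd_array" where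
  "d2 A = (\<chi> k i j. delta_swapped (\<theta> j) (A $ k $ i))"

definition d3 :: "('v fract, 'i) psd_matrix \<Rightarrow> ('v fract, 'i) psd_array" where
  "d3 A = (\<chi> k i j. delta_dual (\<theta> k) (A $ j $ i))"

abbreviation \<R> :: "('v fract, 'i) psd_matrix set" where
  "\<R> \<equiv> rational_fraction_matrices"

lemma d1_comp: "d1 (A \<odot>\<^sub>M B) = d1 A \<rhd>\<^sub>M B + psdm_left A (d1 B)"
  by (simp add: vec_eq_iff d1_def psdm_comp_def psdm_slot2_def psdm_left_def additive_sum[of "fls_map (\<theta> i)" for i, OF delta_add[OF \<theta>]]
      delta_comp[OF \<theta>] sum.distrib)

lemma d2_comp: "A \<in> \<R> \<Longrightarrow> B \<in> \<R> \<Longrightarrow> d2 (A \<odot>\<^sub>M B) = d2 A \<lhd>\<^sub>M B + psdm_left A (d2 B)"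
  by (simp add: vec_eq_iff d2_def psdm_comp_def psdm_slot1_def psdm_left_def rational_fraction_matrices_def
      delta_sum_rational delta_comp_rational rational_closed sum.distrib)

lemma d3_comp: "A \<in> \<R> \<Longrightarrow> B \<in> \<R> \<Longrightarrow> d3 (A \<odot>\<^sub>M B) = d3 A \<lhd>\<^sub>M B + d3 B \<rhd>\<^sub>M psdm_adjoint A"
  by (simp add: vec_eq_iff d3_def psdm_comp_def psdm_slot1_def psdm_slot2_def psdm_adjoint_def rational_fraction_matrices_def
      delta_sum_rational delta_comp_rational rational_closed sum.distrib)

lemma d1_add: "d1 (A + B) = d1 A + d1 B"
  by (simp add: vec_eq_iff d1_def delta_add[OF \<theta>])

lemma d2_add: "A \<in> \<R> \<Longrightarrow> B \<in> \<R> \<Longrightarrow> d2 (A + B) = d2 A + d2 B"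
  by (simp add: vec_eq_iff d2_def rational_fraction_matrices_def delta_add_rational)

lemma d3_add: "A \<in> \<R> \<Longrightarrow> B \<in> \<R> \<Longrightarrow> d3 (A + B) = d3 A + d3 B"
  by (simp add: vec_eq_iff d3_def rational_fraction_matrices_def delta_add_rational)

lemma d_const:
  assumes "\<And>s. \<theta> s c = 0"
  shows "d1 (psdm_const c) = 0" "d2 (psdm_const c) = 0" "d3 (psdm_const c) = 0"
  using assms by (simp_all add: vec_eq_iff d1_def d2_def d3_def psdm_const_def delta_zero delta_const_zero
      delta_const[OF \<theta>] fls_map_zero[of "\<theta> s" for s, OF twisted_zero[OF \<theta>]])

lemma d_one: "d1 psdm_one = 0" "d2 psdm_one = 0" "d3 psdm_one = 0"
proof -
  have "psdm_one = (psdm_const 1 :: ('v fract, 'i) psd_matrix)"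
    by (simp add: vec_eq_iff psdm_one_def psdm_const_def)
  thus "d1 psdm_one = 0" "d2 psdm_one = 0" "d3 psdm_one = 0"
    using d_const[of 1] twisted_one[OF \<theta>] by metis+
qed

text \<open>The three terms of the Jacobi identity, all expanded for |mu| > |lambda|; the entry k,
  i, j belongs to u_i, u_j, u_k in the order of the identity.\<close>

definition jacobiator :: "('v fract, 'i) psd_matrix \<Rightarrow> ('v fract, 'i) psd_array" where
  "jacobiator H = d1 H \<lhd>\<^sub>M H - d2 H \<rhd>\<^sub>M H - psdm_left H (d3 H)"

text \<open>The exterior derivative of the two-form with operator S, with its third argument R
  stripped off by integration by parts. The cyclic term that pairs the first argument with the value
  at R becomes - \<open>d2 S\<close> by skewadjointness, and the term differentiated along R is the
  variational derivative \<open>d3 S\<close>.\<close>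

definition dform :: "('v fract, 'i) psd_matrix \<Rightarrow> ('v fract, 'i) psd_array" where
  "dform S = d1 S - d2 S + d3 S"

definition torsion :: "('v fract, 'i) psd_matrix \<Rightarrow> ('v fract, 'i) psd_array" where
  "torsion A = d1 A \<lhd>\<^sub>M A - d2 A \<rhd>\<^sub>M A - psdm_left A (d1 A - d2 A)"

lemma dform_add: "A \<in> \<R> \<Longrightarrow> B \<in> \<R> \<Longrightarrow> dform (A + B) = dform A + dform B"
  by (simp add: dform_def d1_add d2_add d3_add)

context
  fixes K S :: "('v fract, 'i) psd_matrix"
  assumes K: "K \<in> \<R>" and S: "S \<in> \<R>" and KS: "K \<odot>\<^sub>M S = psdm_one" and SK: "S \<odot>\<^sub>M K = psdm_one"
    and skew: "psdm_adjoint K = - K"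
begin

lemma skew_inverse: "psdm_adjoint S = - S"
proof -
  have "psdm_adjoint S \<odot>\<^sub>M - K = psdm_one"
    using psdm_adjoint_comp[of K S] by (simp add: KS skew psdm_adjoint_one)
  hence "- psdm_adjoint S \<odot>\<^sub>M K \<odot>\<^sub>M S = S" by (simp add: psdm_comp_minus)
  thus ?thesis by (simp add: psdm_comp_assoc KS) (metis minus_minus)
qed

lemma d_inverse:
  "d1 K = - psdm_left K (d1 S \<rhd>\<^sub>M K)" "d2 K = - psdm_left K (d2 S \<lhd>\<^sub>M K)" "d3 K = d3 S \<lhd>\<^sub>M K \<rhd>\<^sub>M K"
proof -
  have KSF: "psdm_left K (psdm_left S F) = F" for F by (simp flip: left_comp add: KS)
  have "psdm_left K (d1 S \<rhd>\<^sub>M K + psdm_left S (d1 K)) = 0" "psdm_left K (d2 S \<lhd>\<^sub>M K + psdm_left S (d2 K)) = 0"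
    using d1_comp[of S K] d2_comp[OF S K] by (simp_all add: SK d_one left_zero2)
  thus "d1 K = - psdm_left K (d1 S \<rhd>\<^sub>M K)" "d2 K = - psdm_left K (d2 S \<lhd>\<^sub>M K)"
    by (simp_all add: left_add KSF eq_neg_iff_add_eq_0 add.commute)
  have "(d3 S \<lhd>\<^sub>M K - d3 K \<rhd>\<^sub>M S) \<rhd>\<^sub>M K = 0"
    using d3_comp[OF S K] by (simp add: SK d_one skew_inverse slot2M_minus2 slot2M_zero1)
  moreover have "d3 K \<rhd>\<^sub>M S \<rhd>\<^sub>M K = d3 K" by (simp flip: slot2M_comp add: SK)
  ultimately show "d3 K = d3 S \<lhd>\<^sub>M K \<rhd>\<^sub>M K" by (simp add: slot2M_diff1)
qed

lemma jacobiator_inverse: "jacobiator K = - psdm_left K (dform S \<lhd>\<^sub>M K \<rhd>\<^sub>M K)"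
  unfolding jacobiator_def dform_def d_inverse by (simp add: array_simps)

lemma cancel: "psdm_left K F = 0 \<Longrightarrow> F = 0" "F \<lhd>\<^sub>M K \<rhd>\<^sub>M K = 0 \<Longrightarrow> F = 0"
proof -
  assume "psdm_left K F = 0"
  hence "psdm_left S (psdm_left K F) = 0" by (simp add: left_zero2)
  thus "F = 0" by (simp flip: left_comp add: SK)
next
  assume "F \<lhd>\<^sub>M K \<rhd>\<^sub>M K = 0"
  hence "F \<lhd>\<^sub>M K \<rhd>\<^sub>M K \<rhd>\<^sub>M S = 0" by (simp add: slot2M_zero1)
  hence "F \<lhd>\<^sub>M K = 0" by (simp flip: slot2M_comp add: KS)
  hence "F \<lhd>\<^sub>M K \<lhd>\<^sub>M S = 0" by (simp add: slot1M_zero1)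
  thus "F = 0" by (simp flip: slot1M_comp add: KS)
qed

lemma jacobiator_eq_0_imp: "jacobiator K = 0 \<Longrightarrow> dform S = 0"
  using cancel unfolding jacobiator_inverse by (metis neg_equal_0_iff_equal)

text \<open>All derivatives of K are expressed by those of S, with \<open>d3 S\<close> eliminated by
  closedness. The remaining variational term, that of A, is traded for
  \<open>d3 (S \<odot>\<^sub>M A)\<close>; this completes
  \<open>dform (S \<odot>\<^sub>M A)\<close>, and what is left over is the torsion.\<close>

lemma jacobiator_comp:
  assumes A: "A \<in> \<R>" and skewA: "psdm_adjoint (A \<odot>\<^sub>M K) = - (A \<odot>\<^sub>M K)" and closed: "dform S = 0"
  shows "jacobiator (A \<odot>\<^sub>M K) = (torsion A + psdm_left (A \<odot>\<^sub>M K) (dform (S \<odot>\<^sub>M A))) \<lhd>\<^sub>M K \<rhd>\<^sub>M K"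
proof -
  \<comment> \<open>Skewadjointness of the product A K is used only in this form, to move the
    adjoint of A across K.\<close>
  have KA: "K \<odot>\<^sub>M psdm_adjoint A = A \<odot>\<^sub>M K"
    using skewA by (simp add: psdm_adjoint_comp skew psdm_comp_minus)
  have SF: "psdm_left K (psdm_left S F) = F" for F by (simp flip: left_comp add: KS)
  have d3S: "d3 S = d2 S - d1 S" using closed by (simp add: dform_def algebra_simps)
  have "d3 (S \<odot>\<^sub>M A) = d3 S \<lhd>\<^sub>M A - d3 A \<rhd>\<^sub>M S"
    by (simp add: d3_comp S A skew_inverse slot2M_minus2)
  hence "d3 A \<rhd>\<^sub>M S = d3 S \<lhd>\<^sub>M A - d3 (S \<odot>\<^sub>M A)" by simp
  hence "d3 A \<rhd>\<^sub>M S \<rhd>\<^sub>M K = (d3 S \<lhd>\<^sub>M A - d3 (S \<odot>\<^sub>M A)) \<rhd>\<^sub>M K" by (simp only:)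
  hence d3A: "d3 A = (d3 S \<lhd>\<^sub>M A - d3 (S \<odot>\<^sub>M A)) \<rhd>\<^sub>M K"
    by (simp flip: slot2M_comp add: SK)
  have "d3 K \<rhd>\<^sub>M psdm_adjoint A = d3 S \<lhd>\<^sub>M K \<rhd>\<^sub>M (K \<odot>\<^sub>M psdm_adjoint A)"
    by (simp add: d_inverse slot2M_comp)
  hence d3K: "d3 K \<rhd>\<^sub>M psdm_adjoint A = d3 S \<lhd>\<^sub>M K \<rhd>\<^sub>M A \<rhd>\<^sub>M K"
    by (simp add: KA slot2M_comp)
  have d3AK: "d3 (A \<odot>\<^sub>M K) = (d3 S \<lhd>\<^sub>M A - d3 (S \<odot>\<^sub>M A)) \<rhd>\<^sub>M K \<lhd>\<^sub>M K + d3 S \<lhd>\<^sub>M K \<rhd>\<^sub>M A \<rhd>\<^sub>M K"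
    using d3_comp[OF A K] unfolding d3K by (simp flip: d3A)
  show ?thesis
    unfolding jacobiator_def torsion_def dform_def d1_comp d2_comp[OF A K] d2_comp[OF S A] d3AK d_inverse(1,2) d3S
    by (simp add: array_simps SF algebra_simps)
qed

end

text \<open>Skewadjointness of R and of R N makes the variational terms cancel: both sides contain
  \<open>d3\<close> of R N with N at the first argument, minus \<open>d3 N\<close> with R N at the
  second. The first and second derivatives differ by R applied to the torsion.\<close>

lemma dform_recursion:
  assumes "R \<in> \<R>" "N \<in> \<R>" "psdm_adjoint R = - R" "psdm_adjoint (R \<odot>\<^sub>M N) = - (R \<odot>\<^sub>M N)"
  shows "dform (R \<odot>\<^sub>M N \<odot>\<^sub>M N) = dform (R \<odot>\<^sub>M N) \<lhd>\<^sub>M N + dform (R \<odot>\<^sub>M N) \<rhd>\<^sub>M N - dform R \<lhd>\<^sub>M N \<rhd>\<^sub>M N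
    - psdm_left R (torsion N)"
  using assms
  by (simp add: dform_def torsion_def d1_comp d2_comp d3_comp rational_matrix_comp array_simps algebra_simps)

lemma dform_const:
  assumes "der c = 0" "\<And>s. \<theta> s c = 0" "psdm_const c \<in> \<R>" "A \<in> \<R>"
  shows "dform (psdm_const c \<odot>\<^sub>M A) = psdm_left (psdm_const c) (dform A)"
  unfolding dform_def d1_comp d2_comp[OF assms(3,4)] d3_comp[OF assms(3,4)] d_const[OF assms(2)]
  by (simp add: array_simps psdm_adjoint_const left_const[OF assms(1)])

text \<open>Polynomials in N whose coefficients are constants of the derivation and of all
  \<open>\<theta> s\<close>. Such coefficients commute with every operator and have zero
  derivatives.\<close>

inductive npoly :: "('v fract, 'i) psd_matrix \<Rightarrow> ('v fract, 'i) psd_matrix \<Rightarrow> bool" for N where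
  power: "npoly N (psdm_power N n)"
| add: "npoly N A \<Longrightarrow> npoly N B \<Longrightarrow> npoly N (A + B)"
| const: "der c = 0 \<Longrightarrow> (\<And>s. \<theta> s c = 0) \<Longrightarrow> psdm_const c \<in> \<R> \<Longrightarrow> npoly N A \<Longrightarrow> npoly N (psdm_const c \<odot>\<^sub>M A)"

lemma npoly_rational: "npoly N A \<Longrightarrow> N \<in> \<R> \<Longrightarrow> A \<in> \<R>"
  by (induction rule: npoly.induct) (auto intro: rational_matrix_power rational_matrix_add rational_matrix_comp)

lemma npoly_comp: "npoly N A \<Longrightarrow> npoly N B \<Longrightarrow> npoly N (A \<odot>\<^sub>M B)"
proof (induction A rule: npoly.induct)
  case (power n)
  from power show ?case
  proof (induction B rule: npoly.induct)
    case (power m)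
    show ?case using npoly.power[of N "n + m"] by (simp add: psdm_power_add)
  next
    case (const c A)
    have "psdm_power N n \<odot>\<^sub>M (psdm_const c \<odot>\<^sub>M A) = psdm_const c \<odot>\<^sub>M (psdm_power N n \<odot>\<^sub>M A)"
      using const(1) by (simp flip: psdm_comp_assoc add: psdm_const_commute)
    thus ?case using const by (simp add: npoly.const)
  qed (simp add: psdm_comp_add npoly.add)
qed (simp_all add: psdm_comp_add psdm_comp_assoc npoly.add npoly.const)

theorem jacobiator_npoly:
  assumes K: "K \<in> \<R>" and S: "S \<in> \<R>" and KS: "K \<odot>\<^sub>M S = psdm_one" and SK: "S \<odot>\<^sub>M K = psdm_one"
    and H: "H \<in> \<R>" and skew: "psdm_adjoint K = - K" "psdm_adjoint H = - H"
    and J: "jacobiator K = 0" "jacobiator H = 0" "jacobiator (K + H) = 0"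
    and A: "npoly (H \<odot>\<^sub>M S) A"
  shows "psdm_adjoint (A \<odot>\<^sub>M K) = - (A \<odot>\<^sub>M K)" "jacobiator (A \<odot>\<^sub>M K) = 0"
proof -
  define N where "N = H \<odot>\<^sub>M S"
  have N: "N \<in> \<R>" by (simp add: N_def H S rational_matrix_comp)
  have NK: "N \<odot>\<^sub>M K = H" by (simp add: N_def psdm_comp_assoc SK)
  note inv = K S KS SK skew(1)
  note S_skew = skew_inverse[OF inv]
  have dS: "dform S = 0" by (rule jacobiator_eq_0_imp[OF inv J(1)])
  \<comment> \<open>\<open>jacobiator_comp\<close> at A = N, where A K = H; the arguments K on both
    sides are cancelled.\<close>
  have "torsion N + psdm_left H (dform (S \<odot>\<^sub>M N)) = 0"
    using jacobiator_comp[OF inv N _ dS] cancel(2)[OF inv] by (simp add: NK skew J)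
  moreover have "torsion N + psdm_left (K + H) (dform (S \<odot>\<^sub>M N)) = 0"
  proof -
    let ?A = "psdm_one + N"
    have AK: "?A \<odot>\<^sub>M K = K + H" by (simp add: psdm_comp_add NK)
    have t: "torsion ?A = torsion N"
      using N by (simp add: torsion_def d1_add d2_add rational_matrix_one d_one array_simps)
    have "S \<odot>\<^sub>M ?A = S + S \<odot>\<^sub>M N" by (simp add: psdm_comp_add)
    hence f: "dform (S \<odot>\<^sub>M ?A) = dform (S \<odot>\<^sub>M N)"
      by (simp add: dform_add S N rational_matrix_comp dS)
    show ?thesis
      using jacobiator_comp[OF inv, of ?A] cancel(2)[OF inv]
      by (simp add: AK psdm_adjoint_add skew J dS f t rational_matrix_add rational_matrix_one N)
  qed
  ultimately have dSN: "dform (S \<odot>\<^sub>M N) = 0" and tN: "torsion N = 0"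
  proof -
    assume *: "torsion N + psdm_left H (dform (S \<odot>\<^sub>M N)) = 0" "torsion N + psdm_left (K + H) (dform (S \<odot>\<^sub>M N)) = 0"
    have "psdm_left K (dform (S \<odot>\<^sub>M N)) = (torsion N + psdm_left (K + H) (dform (S \<odot>\<^sub>M N)))
        - (torsion N + psdm_left H (dform (S \<odot>\<^sub>M N)))"
      by (simp add: left_add)
    hence "psdm_left K (dform (S \<odot>\<^sub>M N)) = 0" by (simp only: * diff_self)
    thus d: "dform (S \<odot>\<^sub>M N) = 0" by (rule cancel(1)[OF inv])
    show "torsion N = 0" using *(1) by (simp add: d left_zero2)
  qed
  have SNskew: "psdm_adjoint (S \<odot>\<^sub>M psdm_power N n) = - (S \<odot>\<^sub>M psdm_power N n)" for n
  proof (induction n)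
    case (Suc n)
    have "psdm_adjoint (S \<odot>\<^sub>M psdm_power N (Suc n)) = psdm_adjoint N \<odot>\<^sub>M psdm_adjoint (S \<odot>\<^sub>M psdm_power N n)"
      by (simp flip: psdm_power_commute psdm_comp_assoc psdm_adjoint_comp)
    also have "psdm_adjoint N = S \<odot>\<^sub>M H"
      by (simp add: N_def psdm_adjoint_comp S_skew skew psdm_comp_minus)
    finally show ?case unfolding Suc by (simp add: psdm_comp_minus psdm_comp_assoc N_def)
  qed (simp add: S_skew)
  have SNR: "S \<odot>\<^sub>M psdm_power N n \<in> \<R>" for n by (intro rational_matrix_comp rational_matrix_power S N)
  have step: "S \<odot>\<^sub>M psdm_power N (Suc n) = S \<odot>\<^sub>M psdm_power N n \<odot>\<^sub>M N" for n
    by (simp add: psdm_comp_assoc psdm_power_commute)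
  \<comment> \<open>The recursion has second order, so two consecutive powers are carried
    along.\<close>
  have "dform (S \<odot>\<^sub>M psdm_power N n) = 0 \<and> dform (S \<odot>\<^sub>M psdm_power N (Suc n)) = 0" for n
  proof (induction n)
    case 0
    show ?case using dS dSN by simp
  next
    case (Suc n)
    have "psdm_adjoint (S \<odot>\<^sub>M psdm_power N n \<odot>\<^sub>M N) = - (S \<odot>\<^sub>M psdm_power N n \<odot>\<^sub>M N)"
      using SNskew[of "Suc n"] by (simp only: step)
    from dform_recursion[OF SNR N SNskew this] Suc tN
    have "dform (S \<odot>\<^sub>M psdm_power N n \<odot>\<^sub>M N \<odot>\<^sub>M N) = 0"
      by (simp only: step) (simp add: array_simps)
    thus ?case using Suc by (simp only: step)
  qed
  hence dSNn: "dform (S \<odot>\<^sub>M psdm_power N n) = 0" for n by blast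
  have closed: "dform (S \<odot>\<^sub>M B) = 0 \<and> psdm_adjoint (S \<odot>\<^sub>M B) = - (S \<odot>\<^sub>M B)" if "npoly N B" for B
    using that
  proof (induction B rule: npoly.induct)
    case (add A B)
    thus ?case
      by (simp add: psdm_comp_add dform_add rational_matrix_comp S npoly_rational[OF _ N] psdm_adjoint_add)
  next
    case (const c A)
    have *: "S \<odot>\<^sub>M (psdm_const c \<odot>\<^sub>M A) = psdm_const c \<odot>\<^sub>M (S \<odot>\<^sub>M A)"
      using const(1) by (simp flip: psdm_comp_assoc add: psdm_const_commute)
    have "psdm_adjoint (psdm_const c \<odot>\<^sub>M (S \<odot>\<^sub>M A)) = psdm_const c \<odot>\<^sub>M psdm_adjoint (S \<odot>\<^sub>M A)"
      by (simp add: psdm_adjoint_comp psdm_adjoint_const psdm_const_commute const(1) flip: psdm_comp_assoc)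
    thus ?case using const unfolding *
      by (simp add: dform_const rational_matrix_comp S npoly_rational[OF _ N] array_simps psdm_comp_minus)
  qed (simp add: dSNn SNskew)
  have AN: "npoly N A" using A by (simp add: N_def)
  have AR: "A \<in> \<R>" by (rule npoly_rational[OF AN N])
  \<comment> \<open>A K = K X K is the congruence of a skewadjoint operator by a skewadjoint one,
    hence skewadjoint.\<close>
  define X where "X = S \<odot>\<^sub>M A"
  have "A \<odot>\<^sub>M K = K \<odot>\<^sub>M X \<odot>\<^sub>M K"
    unfolding X_def by (simp flip: psdm_comp_assoc add: KS)
  moreover have "psdm_adjoint X = - X" using closed[OF AN] by (simp add: X_def)
  ultimately show skewA: "psdm_adjoint (A \<odot>\<^sub>M K) = - (A \<odot>\<^sub>M K)"
    by (simp add: psdm_adjoint_comp skew psdm_comp_minus psdm_comp_assoc)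
  \<comment> \<open>The recursion with R = S and A in place of N: S applied to the torsion of A is a
    combination of the derivatives of S, S A and S A A, all of which vanish.\<close>
  have "psdm_left S (torsion A) = 0"
    using dform_recursion[OF S AR S_skew] closed[OF AN] closed[OF npoly_comp[OF AN AN]]
    by (simp add: dS array_simps psdm_comp_assoc)
  hence "psdm_left K (psdm_left S (torsion A)) = 0" by (simp add: left_zero2)
  hence "torsion A = 0" by (simp flip: left_comp add: KS)
  thus "jacobiator (A \<odot>\<^sub>M K) = 0"
    using jacobiator_comp[OF inv AR skewA dS] closed[OF AN] by (simp add: array_simps)
qed

end

section \<open>Extension to the field of fractions\<close>

abbreviation to_fract :: "'a::idom \<Rightarrow> 'a fract" where
  "to_fract a \<equiv> Fract a 1"

lemma diff_hom_to_fract: "diff_hom (to_fract :: 'v::differential_idom \<Rightarrow> _)"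
  by (simp add: diff_hom_def der_Fract One_fract_def)

lemma to_fract_eq_iff [simp]: "to_fract a = to_fract b \<longleftrightarrow> a = b"
  by (simp add: eq_fract)

lemma to_fract_add: "to_fract (a + b) = to_fract a + to_fract b" and to_fract_mult: "to_fract (a * b) = to_fract a * to_fract b"
  by simp_all

lemma to_fract_zero [simp]: "to_fract 0 = 0" and to_fract_one [simp]: "to_fract 1 = 1"
  by (simp_all add: Zero_fract_def One_fract_def)

lemma to_fract_eq_0_iff [simp]: "to_fract a = 0 \<longleftrightarrow> a = 0"
  using to_fract_eq_iff[of a 0] by (simp del: to_fract_eq_iff)

lemma fract_as_quotient:
  obtains a b where "b \<noteq> 0" "q * to_fract b = to_fract a"
proof -
  obtain a b where "q = Fract a b" "b \<noteq> 0" by (cases q)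
  thus ?thesis by (intro that[of b a]) (simp_all add: eq_fract)
qed

text \<open>The quotient rule at a chosen representation q = a / b, with q kept in place of a / b.
  Independence of the choice requires the Leibniz rule for D and is the content of
  \<open>fract_der_eq\<close>.\<close>

definition fract_der :: "('a::idom \<Rightarrow> 'a) \<Rightarrow> 'a fract \<Rightarrow> 'a fract" where
  "fract_der D q = (let (a, b) = (SOME (a, b). b \<noteq> 0 \<and> q * to_fract b = to_fract a)
     in (to_fract (D a) - q * to_fract (D b)) / to_fract b)"

context
  fixes D :: "'a::idom \<Rightarrow> 'a"
  assumes D_add: "D (a + b) = D a + D b" and D_mult: "D (a * b) = D a * b + a * D b"
begin

lemma fract_der_eq:
  assumes "b \<noteq> 0" "q * to_fract b = to_fract a"
  shows "fract_der D q * to_fract b = to_fract (D a) - q * to_fract (D b)"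
proof -
  define p where "p = (\<lambda>(a, b). b \<noteq> 0 \<and> q * to_fract b = to_fract a)"
  obtain c d where cd: "Eps p = (c, d)" by (cases "Eps p")
  have "p (Eps p)" by (rule someI[of p "(a, b)"]) (simp add: p_def assms)
  hence d: "d \<noteq> 0" "q * to_fract d = to_fract c" unfolding cd by (simp_all add: p_def)
  have "to_fract (a * d) = to_fract (c * b)"
    unfolding to_fract_mult assms(2)[symmetric] d(2)[symmetric] by simp
  hence "D (a * d) = D (c * b)" by simp
  hence "to_fract (D a) * to_fract d + to_fract a * to_fract (D d) = to_fract (D c) * to_fract b + to_fract c * to_fract (D b)"
    unfolding D_mult by (simp flip: to_fract_mult to_fract_add)
  hence "(to_fract (D c) - q * to_fract (D d)) * to_fract b = (to_fract (D a) - q * to_fract (D b)) * to_fract d"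
    unfolding assms(2)[symmetric] d(2)[symmetric] by (simp only: left_diff_distrib) algebra
  moreover have "to_fract d \<noteq> 0" using d by simp
  moreover have "x / z * y = w" if "x * y = w * z" "z \<noteq> 0" for x y z w :: "'a fract"
    using that by (simp add: field_simps)
  ultimately have "(to_fract (D c) - q * to_fract (D d)) / to_fract d * to_fract b = to_fract (D a) - q * to_fract (D b)"
    by blast
  thus ?thesis unfolding fract_der_def p_def[symmetric] cd by simp
qed

lemma D_one: "D 1 = 0"
proof -
  have "D 1 = D 1 + D 1" using D_mult[of 1 1] by (simp only: mult_1 mult_1_right)
  thus ?thesis by (metis add_cancel_left_right)
qed

lemma fract_der_to_fract: "fract_der D (to_fract a) = to_fract (D a)"
  using fract_der_eq[of 1 "to_fract a" a] by (simp add: D_one)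

lemma fract_der_add: "fract_der D (q + r) = fract_der D q + fract_der D r"
proof -
  obtain a b where ab: "b \<noteq> 0" "q * to_fract b = to_fract a" by (rule fract_as_quotient)
  obtain c d where cd: "d \<noteq> 0" "r * to_fract d = to_fract c" by (rule fract_as_quotient)
  have "(q + r) * to_fract (b * d) = to_fract (a * d + c * b)"
    unfolding to_fract_add to_fract_mult ab(2)[symmetric] cd(2)[symmetric] by algebra
  hence "fract_der D (q + r) * to_fract (b * d) = to_fract (D (a * d + c * b)) - (q + r) * to_fract (D (b * d))"
    using ab cd by (intro fract_der_eq) simp_all
  also have "\<dots> = (to_fract (D a) - q * to_fract (D b)) * to_fract d + (to_fract (D c) - r * to_fract (D d)) * to_fract b"
    unfolding D_add D_mult to_fract_add to_fract_mult ab(2)[symmetric] cd(2)[symmetric] by algebra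
  also have "\<dots> = (fract_der D q + fract_der D r) * to_fract (b * d)"
    unfolding fract_der_eq[OF ab, symmetric] fract_der_eq[OF cd, symmetric] to_fract_mult by algebra
  finally show ?thesis using ab(1) cd(1) by (simp del: mult_fract)
qed

lemma fract_der_mult: "fract_der D (q * r) = fract_der D q * r + q * fract_der D r"
proof -
  obtain a b where ab: "b \<noteq> 0" "q * to_fract b = to_fract a" by (rule fract_as_quotient)
  obtain c d where cd: "d \<noteq> 0" "r * to_fract d = to_fract c" by (rule fract_as_quotient)
  have "(q * r) * to_fract (b * d) = to_fract (a * c)"
    unfolding to_fract_mult ab(2)[symmetric] cd(2)[symmetric] by algebra
  hence "fract_der D (q * r) * to_fract (b * d) = to_fract (D (a * c)) - (q * r) * to_fract (D (b * d))"
    using ab cd by (intro fract_der_eq) simp_all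
  also have "\<dots> = (to_fract (D a) - q * to_fract (D b)) * (r * to_fract d) + q * to_fract b * (to_fract (D c) - r * to_fract (D d))"
    unfolding D_mult to_fract_add to_fract_mult ab(2)[symmetric] cd(2)[symmetric] by algebra
  also have "\<dots> = (fract_der D q * r + q * fract_der D r) * to_fract (b * d)"
    unfolding fract_der_eq[OF ab, symmetric] fract_der_eq[OF cd, symmetric] to_fract_mult by algebra
  finally show ?thesis using ab(1) cd(1) by (simp del: mult_fract)
qed

lemma fract_der_nonzero:
  assumes "b \<noteq> 0" "q * to_fract b = to_fract a" "fract_der D q \<noteq> 0"
  shows "D a \<noteq> 0 \<or> D b \<noteq> 0"
  using fract_der_eq[OF assms(1,2)] assms(1,3) by auto

end

text \<open>If q b = a, then 0 = C(q b) = C(q) b. Identities between derivations of the field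
  therefore need to be checked on the domain only.\<close>

lemma fract_derivation_eq_0:
  fixes C :: "'a::idom fract \<Rightarrow> 'a fract"
  assumes "\<And>q r. C (q * r) = C q * r + q * C r" "\<And>a. C (to_fract a) = 0"
  shows "C q = 0"
proof -
  obtain a b where ab: "b \<noteq> 0" "q * to_fract b = to_fract a" by (rule fract_as_quotient)
  have "C (q * to_fract b) = 0" unfolding ab(2) by (rule assms(2))
  thus ?thesis using ab(1) by (simp add: assms)
qed

section \<open>Generating series of partial derivatives and the lambda-bracket\<close>

definition pd_symbol :: "(nat \<Rightarrow> 'a \<Rightarrow> 'a::comm_ring_1) \<Rightarrow> 'a \<Rightarrow> 'a fls" where
  "pd_symbol D f = Abs_fls (\<lambda>r. if r \<le> 0 then D (nat (- r)) f else 0)"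

lemma psd_coeff_pd_symbol:
  assumes "finite {n. D n f \<noteq> 0}"
  shows "psd_coeff (pd_symbol D f) n = (if n \<ge> 0 then D (nat n) f else 0)"
proof -
  obtain N where "\<forall>n\<in>{n. D n f \<noteq> 0}. n \<le> N" using assms finite_nat_set_iff_bounded_le by blast
  hence N: "D n f = 0" if "n > N" for n using that by (meson leD mem_Collect_eq)
  have "pd_symbol D f $$ r = (if r \<le> 0 then D (nat (- r)) f else 0)" for r
    unfolding pd_symbol_def by (rule nth_Abs_fls_lower_bound[of "- int N"]) (auto intro: N)
  thus ?thesis by simp
qed

lemma pd_symbol_sum:
  assumes "finite {n. D n f \<noteq> 0}"
  shows "pd_symbol D f = (\<Sum>n | D n f \<noteq> 0. fls_const (D n f) * fls_X_inv ^ n)"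
proof (rule psd_eqI)
  fix m
  have "psd_coeff (\<Sum>n | D n f \<noteq> 0. fls_const (D n f) * fls_X_inv ^ n) m = (\<Sum>n | D n f \<noteq> 0. if int n = m then D n f else 0)"
    unfolding fls_nth_sum by (intro sum.cong) auto
  also have "\<dots> = (\<Sum>n\<in>{n. D n f \<noteq> 0} \<inter> {n. int n = m}. D n f)"
    using assms by (subst sum.inter_restrict) auto
  also have "{n. D n f \<noteq> 0} \<inter> {n. int n = m} = (if m \<ge> 0 \<and> D (nat m) f \<noteq> 0 then {nat m} else {})" by auto
  also have "(\<Sum>n\<in>\<dots>. D n f) = psd_coeff (pd_symbol D f) m"
    by (simp add: psd_coeff_pd_symbol[of D f, OF assms])
  finally show "psd_coeff (pd_symbol D f) m = psd_coeff (\<Sum>n | D n f \<noteq> 0. fls_const (D n f) * fls_X_inv ^ n) m" ..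
qed

lemma pd_symbol_comp:
  assumes "finite {n. D n f \<noteq> 0}"
  shows "(\<Sum>n | D n f \<noteq> 0. fls_const (D n f) * (fls_X_inv ^ n \<odot> B)) = pd_symbol D f \<odot> B"
  by (simp add: pd_symbol_sum[of D f, OF assms] comp_sum_left comp_const_mult_left)

lemma adjoint_X_inv_power: "psd_adjoint (fls_X_inv ^ m) = (- fls_X_inv) ^ m"
proof (induction m)
  case (Suc m)
  have "der ((- fls_X_inv) ^ m :: 'a fls) = 0"
    by (induction m) (simp_all add: der_mult additive_minus[of der, OF der_add])
  thus ?case using Suc by (simp add: fls_X_inv_times_conv_shift(1) adjoint_shift psd_E_def)
qed (simp add: adjoint_one)

text \<open>Each summand of the bracket is the adjoint of a coefficient times a power of lambda:
  -lambda to the power n, composed with f_n, is the adjoint of f_n lambda^n.\<close>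

lemma pd_symbol_adjoint:
  assumes "finite {n. D n f \<noteq> 0}"
  shows "(\<Sum>n | D n f \<noteq> 0. B \<odot> ((- fls_X_inv) ^ n \<odot> fls_const (D n f))) = B \<odot> psd_adjoint (pd_symbol D f)"
  by (simp add: pd_symbol_sum[of D f, OF assms] comp_sum_right adjoint_sum adjoint_const_mult adjoint_X_inv_power)

locale differential_functions_domain = differential_functions smul u pd
  for smul :: "'f::field_char_0 \<Rightarrow> 'v \<Rightarrow> 'v::differential_idom" and u :: "'i::finite \<Rightarrow> nat \<Rightarrow> 'v"
    and pd :: "'i \<Rightarrow> nat \<Rightarrow> 'v \<Rightarrow> 'v"
begin

definition fract_pd :: "'i \<Rightarrow> nat \<Rightarrow> 'v fract \<Rightarrow> 'v fract" where
  "fract_pd i n = fract_der (pd i n)"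

lemma fract_pd_add: "fract_pd i n (q + r) = fract_pd i n q + fract_pd i n r"
  unfolding fract_pd_def by (rule fract_der_add) (rule pd_add pd_mult)+

lemma fract_pd_mult: "fract_pd i n (q * r) = fract_pd i n q * r + q * fract_pd i n r"
  unfolding fract_pd_def by (rule fract_der_mult) (rule pd_add pd_mult)+

lemma fract_pd_to_fract: "fract_pd i n (to_fract f) = to_fract (pd i n f)"
  unfolding fract_pd_def by (rule fract_der_to_fract) (rule pd_add pd_mult)+

lemma finite_pd': "finite {n. pd i n f \<noteq> 0}"
  by (rule finite_subset[OF _ finite_imageI[OF finite_pd[of f], of snd]]) force

lemma finite_fract_pd: "finite {n. fract_pd i n q \<noteq> 0}"
proof -
  obtain a b where ab: "b \<noteq> 0" "q * to_fract b = to_fract a" by (rule fract_as_quotient)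
  have "{n. fract_pd i n q \<noteq> 0} \<subseteq> {n. pd i n a \<noteq> 0} \<union> {n. pd i n b \<noteq> 0}"
    using fract_der_nonzero[of "pd i n" for n, OF pd_add pd_mult ab] by (auto simp: fract_pd_def)
  thus ?thesis using finite_pd' finite_subset by blast
qed

lemma fract_pd_der: "fract_pd i n (der q) = der (fract_pd i n q) + (case n of 0 \<Rightarrow> 0 | Suc m \<Rightarrow> fract_pd i m q)"
proof -
  \<comment> \<open>The defect is itself a derivation in q: the mixed products cancel, and the lower
    partial derivative is a derivation.\<close>
  define C where "C q = fract_pd i n (der q) - der (fract_pd i n q) - (case n of 0 \<Rightarrow> 0 | Suc m \<Rightarrow> fract_pd i m q)" for q
  have "C (q * r) = C q * r + q * C r" for q r
    by (cases n) (simp_all add: C_def der_mult der_add fract_pd_add fract_pd_mult algebra_simps)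
  moreover have "C (to_fract a) = 0" for a
  proof -
    have d: "der (to_fract x) = to_fract (der x)" for x :: 'v by (simp add: der_Fract)
    have "to_fract (pd i n (der a)) - to_fract (der (pd i n a)) = to_fract (case n of 0 \<Rightarrow> 0 | Suc m \<Rightarrow> pd i m a)"
      unfolding pd_der[symmetric] by simp
    thus ?thesis by (cases n) (simp_all add: C_def d fract_pd_to_fract)
  qed
  ultimately have "C q = 0" by (rule fract_derivation_eq_0)
  thus ?thesis by (simp add: C_def algebra_simps)
qed

definition theta :: "'i \<Rightarrow> 'v fract \<Rightarrow> 'v fract fls" where
  "theta i = pd_symbol (fract_pd i)"

lemma psd_coeff_theta: "psd_coeff (theta i q) n = (if n \<ge> 0 then fract_pd i (nat n) q else 0)"
  unfolding theta_def by (rule psd_coeff_pd_symbol[of "fract_pd i" q, OF finite_fract_pd])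

sublocale twisted_derivations theta
proof
  fix i
  have "theta i (der q) = psd_E (theta i q)" for q
  proof (rule psd_eqI)
    fix n
    have "psd_coeff (psd_E (theta i q)) n = psd_coeff (theta i q) (n - 1) + der (psd_coeff (theta i q) n)"
      by (rule psd_coeff_E)
    also have "\<dots> = psd_coeff (theta i (der q)) n"
    proof (cases "n \<ge> 1")
      case True
      hence "nat n = Suc (nat (n - 1))" by simp
      thus ?thesis using True unfolding psd_coeff_theta by (simp add: fract_pd_der)
    qed (cases "n = 0"; simp only: psd_coeff_theta; simp add: fract_pd_der)
    finally show "psd_coeff (theta i (der q)) n = psd_coeff (psd_E (theta i q)) n" ..
  qed
  thus "twisted_der (theta i)"
    unfolding twisted_der_def
    by (auto intro!: psd_eqI simp only: psd_coeff_theta fls_plus_nth fls_mult_const_nth) (simp_all add: fract_pd_add fract_pd_mult)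
qed

lemma pd_zero: "pd i n 0 = 0"
  by (rule additive_zero) (rule pd_add)

lemma fls_map_pd_symbol: "fls_map to_fract (pd_symbol (pd i) f) = theta i (to_fract f)"
proof (rule psd_eqI)
  fix n
  show "psd_coeff (fls_map to_fract (pd_symbol (pd i) f)) n = psd_coeff (theta i (to_fract f)) n"
    unfolding psd_coeff_theta fls_map_nth[of to_fract, OF to_fract_zero] psd_coeff_pd_symbol[of "pd i" f, OF finite_pd']
    by (simp add: fract_pd_to_fract)
qed

lemma lambda_bracket_left: "lambda_bracket pd H (u i 0) g = (\<Sum>s\<in>UNIV. pd_symbol (pd s) g \<odot> H $ s $ i)"
proof -
  have "(\<Sum>j\<in>UNIV. \<Sum>m | pd i' m (u i 0) \<noteq> 0. \<Sum>n | pd j n g \<noteq> 0.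
        fls_const (pd j n g) * (fls_X_inv ^ n \<odot> (H $ j $ i' \<odot> ((- fls_X_inv) ^ m \<odot> fls_const (pd i' m (u i 0))))))
      = (if i' = i then \<Sum>s\<in>UNIV. pd_symbol (pd s) g \<odot> H $ s $ i else 0)" for i'
  proof -
    have "{m. pd i' m (u i 0) \<noteq> 0} = (if i' = i then {0} else {})" by (auto simp: pd_u)
    thus ?thesis by (simp add: pd_u pd_symbol_comp[of "pd s" g for s, OF finite_pd'])
  qed
  thus ?thesis by (simp add: lambda_bracket_def)
qed

lemma lambda_bracket_right: "lambda_bracket pd H f (u k 0) = (\<Sum>s\<in>UNIV. H $ k $ s \<odot> psd_adjoint (pd_symbol (pd s) f))"
proof -
  have "(\<Sum>j\<in>UNIV. \<Sum>m | pd s m f \<noteq> 0. \<Sum>n | pd j n (u k 0) \<noteq> 0.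
        fls_const (pd j n (u k 0)) * (fls_X_inv ^ n \<odot> (H $ j $ s \<odot> ((- fls_X_inv) ^ m \<odot> fls_const (pd s m f)))))
      = H $ k $ s \<odot> psd_adjoint (pd_symbol (pd s) f)" for s
  proof -
    have "{n. pd j n (u k 0) \<noteq> 0} = (if j = k then {0} else {})" for j by (auto simp: pd_u)
    hence "(\<Sum>m | pd s m f \<noteq> 0. \<Sum>n | pd j n (u k 0) \<noteq> 0.
        fls_const (pd j n (u k 0)) * (fls_X_inv ^ n \<odot> (H $ j $ s \<odot> ((- fls_X_inv) ^ m \<odot> fls_const (pd s m f)))))
      = (if j = k then H $ k $ s \<odot> psd_adjoint (pd_symbol (pd s) f) else 0)" for j
      by (simp add: pd_u pd_symbol_adjoint[of "pd s" f for s, OF finite_pd'])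
    thus ?thesis by simp
  qed
  thus ?thesis by (simp add: lambda_bracket_def)
qed

lemma lambda_bracket_generators: "lambda_bracket pd H (u j 0) (u k 0) = H $ k $ j"
proof -
  have "pd_symbol (pd s) (u k 0) \<odot> H $ s $ j = (if s = k then H $ k $ j else 0)" for s
  proof -
    have "{n. pd s n (u k 0) \<noteq> 0} = (if s = k then {0} else {})" by (auto simp: pd_u)
    thus ?thesis by (simp add: pd_symbol_sum[of "pd s" "u k 0", OF finite_pd'] pd_u)
  qed
  thus ?thesis by (simp add: lambda_bracket_left)
qed

end

section \<open>The Jacobi identity over the domain\<close>

lemma three_var_sum: "(\<And>x. x \<in> S \<Longrightarrow> f x \<in> three_var_series) \<Longrightarrow> (\<lambda>a b c. \<Sum>x\<in>S. f x a b c :: 'a::ab_group_add) \<in> three_var_series"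
  by (induction S rule: infinite_finite_induct) (simp_all add: zero_three_var three_var_add)

lemma expand1_sum: "(\<And>x. x \<in> S \<Longrightarrow> f x \<in> three_var_series) \<Longrightarrow> expand1 (\<lambda>a b c. \<Sum>x\<in>S. f x a b c) = (\<Sum>x\<in>S. expand1 (f x))"
  by (induction S rule: infinite_finite_induct) (simp_all add: expand_zero expand1_add three_var_sum)

lemma expand3_sum: "(\<And>x. x \<in> S \<Longrightarrow> f x \<in> three_var_series) \<Longrightarrow> expand3 (\<lambda>a b c. \<Sum>x\<in>S. f x a b c) = (\<Sum>x\<in>S. expand3 (f x))"
  by (induction S rule: infinite_finite_induct) (simp_all add: expand_zero expand3_add three_var_sum)

lemma swap_sum: "swap_vars (\<lambda>a b c. \<Sum>x\<in>S. f x a b c) = (\<lambda>a b c. \<Sum>x\<in>S. swap_vars (f x) a b c)"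
  by (simp add: fun_eq_iff swap_vars_def)

lemma zero_in_quotient_map:
  assumes "zero_in_quotient P" "\<And>a b. f (a + b) = f a + f b"
  shows "zero_in_quotient (\<lambda>a b c. f (P a b c))"
proof -
  obtain G where G: "G \<in> three_var_series" "P = mult_nu_minus_lambda_minus_mu G"
    using assms(1) by (auto simp: zero_in_quotient_def)
  have "(\<lambda>a b c. f (P a b c)) = mult_nu_minus_lambda_minus_mu (\<lambda>a b c. f (G a b c))"
    by (simp add: fun_eq_iff G(2) mult_nu_minus_lambda_minus_mu_def additive_diff[of f, OF assms(2)])
  thus ?thesis using three_var_map[OF G(1), of f] additive_zero[of f, OF assms(2)]
    by (auto simp: zero_in_quotient_def)
qed

lemma fls_map2_comp:
  assumes "f 0 = 0" "g 0 = 0"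
  shows "fls_map (fls_map f) (fls_map (fls_map g) F) = fls_map (fls_map (\<lambda>x. f (g x))) F"
  using assms by (intro psd2_eqI) (simp add: fls_map_zero)

lemma jacobi_identity_iff:
  "jacobi_identity u pd H i j k \<longleftrightarrow>
     (\<exists>P\<in>three_var_series. \<exists>Q\<in>three_var_series. \<exists>R\<in>three_var_series.
        fls_map (\<lambda>g. lambda_bracket pd H (u i 0) g) (lambda_bracket pd H (u j 0) (u k 0)) = expand1 P \<and>
        fls_map (\<lambda>g. lambda_bracket pd H (u j 0) g) (lambda_bracket pd H (u i 0) (u k 0)) = expand1 (swap_vars Q) \<and>
        fls_map (\<lambda>f. lambda_bracket pd H f (u k 0)) (lambda_bracket pd H (u i 0) (u j 0)) = expand3 R \<and>
        zero_in_quotient (\<lambda>a b c. P a b c - Q a b c - R a b c))"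
  unfolding jacobi_identity_def expand_mu_lambda_swap
  by (intro bex_cong refl) (simp only: coeff2_expand1[symmetric] coeff2_expand3[symmetric] three_var_swap coeff2_eq_iff)

section \<open>Passage between the domain and its field of fractions\<close>

definition to_fract_matrix :: "('v::idom, 'i::finite) psd_matrix \<Rightarrow> ('v fract, 'i) psd_matrix" where
  "to_fract_matrix A = (\<chi> i j. to_fraction_psd (A $ i $ j))"

lemma to_fraction_psd_eq: "to_fraction_psd = fls_map to_fract"
  by (simp add: to_fraction_psd_def fun_eq_iff)

lemma fls_map_to_fract_add: "fls_map to_fract (A + B) = fls_map to_fract A + fls_map to_fract B"
  by (rule fls_eqI) simp

lemmas fls_map_to_fract_sum = additive_sum[of "fls_map to_fract", OF fls_map_to_fract_add]
lemmas fls_map_to_fract_comp = fls_map_comp_hom[OF diff_hom_to_fract]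

lemma fls_map_to_fract_inj: "fls_map to_fract A = fls_map to_fract B \<Longrightarrow> A = B"
  by (rule fls_eqI) (metis fls_map_nth to_fract_zero to_fract_eq_iff)

lemma to_fract_matrix_rational: "to_fract_matrix A \<in> rational_fraction_matrices \<longleftrightarrow> A \<in> rational_matrices"
  by (simp add: rational_fraction_matrices_def rational_matrices_def to_fract_matrix_def rational_psd_def)

lemma to_fract_matrix_add: "to_fract_matrix (A + B) = to_fract_matrix A + to_fract_matrix B"
  by (simp add: vec_eq_iff to_fract_matrix_def to_fraction_psd_eq fls_map_to_fract_add)

lemma to_fract_matrix_comp: "to_fract_matrix (A \<odot>\<^sub>M B) = to_fract_matrix A \<odot>\<^sub>M to_fract_matrix B"
  by (simp add: vec_eq_iff to_fract_matrix_def to_fraction_psd_eq psdm_comp_def fls_map_to_fract_sum fls_map_to_fract_comp)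

lemma to_fract_matrix_one: "to_fract_matrix psdm_one = psdm_one"
proof -
  have "fls_map to_fract (1 :: 'a fls) = 1" "fls_map to_fract (0 :: 'a fls) = 0" by (rule fls_eqI; simp)+
  thus ?thesis by (simp add: vec_eq_iff to_fract_matrix_def to_fraction_psd_eq psdm_one_def)
qed

lemma to_fract_matrix_power: "to_fract_matrix (psdm_power A n) = psdm_power (to_fract_matrix A) n"
  by (induction n) (simp_all add: to_fract_matrix_one to_fract_matrix_comp)

lemma to_fract_matrix_adjoint: "to_fract_matrix (psdm_adjoint A) = psdm_adjoint (to_fract_matrix A)"
  by (simp add: vec_eq_iff to_fract_matrix_def to_fraction_psd_eq psdm_adjoint_def fls_map_adjoint_hom[OF diff_hom_to_fract])

lemma to_fract_matrix_inj: "to_fract_matrix A = to_fract_matrix B \<Longrightarrow> A = B"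
  by (auto simp add: vec_eq_iff to_fract_matrix_def to_fraction_psd_eq intro: fls_map_to_fract_inj)

lemmas to_fract_matrix_minus = additive_minus[of to_fract_matrix, OF to_fract_matrix_add]
lemmas to_fract_matrix_zero = additive_zero[of to_fract_matrix, OF to_fract_matrix_add]

lemma to_fract_const_rational: "fls_const (to_fract x) \<in> rational_over_fractions"
proof -
  have "fls_const (to_fract x) = to_fraction_psd (fls_const x)"
    by (rule fls_eqI) (simp add: to_fraction_psd_eq)
  moreover have "fls_const x \<in> differential_operators" by (simp add: differential_operators_def)
  ultimately show ?thesis unfolding rational_over_fractions_def by auto
qed

lemma psdm_const_rational: "psdm_const (to_fract x) \<in> rational_fraction_matrices"
  by (simp add: rational_fraction_matrices_def psdm_const_def to_fract_const_rational rational_zero)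

context differential_functions_domain
begin

abbreviation lift2 :: "'v fls fls \<Rightarrow> 'v fract fls fls" where
  "lift2 \<equiv> fls_map (fls_map to_fract)"

text \<open>On each coefficient, the bracket with \<open>u i 0\<close> on the left is the derivative
  along column i of H.\<close>

lemma lift2_first_term:
  "lift2 (fls_map (\<lambda>g. lambda_bracket pd H (u i 0) g) A) =
     (\<Sum>s\<in>UNIV. fls_map (theta s) (fls_map to_fract A) \<lhd> to_fract_matrix H $ s $ i)"
proof (rule fls_eqI)
  fix n
  have nth: "fls_map (\<lambda>g. lambda_bracket pd H (u i 0) g) A $$ n = lambda_bracket pd H (u i 0) (A $$ n)"
    by (rule fls_map_nth) (simp add: lambda_bracket_def pd_zero)
  show "lift2 (fls_map (\<lambda>g. lambda_bracket pd H (u i 0) g) A) $$ n =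
     (\<Sum>s\<in>UNIV. fls_map (theta s) (fls_map to_fract A) \<lhd> to_fract_matrix H $ s $ i) $$ n"
    unfolding fls_map_nth[of "fls_map to_fract", OF fls_map_zero[of to_fract, OF to_fract_zero]] nth
    by (simp add: fls_nth_sum delta_nth[OF \<theta>] lambda_bracket_left fls_map_to_fract_sum
        fls_map_to_fract_comp fls_map_pd_symbol to_fract_matrix_def to_fraction_psd_eq)
qed

lemma lift2_third_term:
  "lift2 (fls_map (\<lambda>f. lambda_bracket pd H f (u k 0)) A) =
     (\<Sum>s\<in>UNIV. fls_map ((\<odot>) (to_fract_matrix H $ k $ s)) (fls_map psd_adjoint (fls_map (theta s) (fls_map to_fract A))))"
proof (rule fls_eqI)
  fix n
  have nth: "fls_map (\<lambda>f. lambda_bracket pd H f (u k 0)) A $$ n = lambda_bracket pd H (A $$ n) (u k 0)"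
    by (rule fls_map_nth) (simp add: lambda_bracket_def pd_zero)
  show "lift2 (fls_map (\<lambda>f. lambda_bracket pd H f (u k 0)) A) $$ n =
     (\<Sum>s\<in>UNIV. fls_map ((\<odot>) (to_fract_matrix H $ k $ s)) (fls_map psd_adjoint (fls_map (theta s) (fls_map to_fract A)))) $$ n"
    unfolding fls_map_nth[of "fls_map to_fract", OF fls_map_zero[of to_fract, OF to_fract_zero]] nth
    by (simp add: fls_nth_sum delta_nth[OF \<theta>] lambda_bracket_right fls_map_to_fract_sum adjoint_zero
        fls_map_to_fract_comp fls_map_adjoint_hom[OF diff_hom_to_fract] fls_map_pd_symbol to_fract_matrix_def to_fraction_psd_eq)
qed

text \<open>The swapped representative of \<open>represents_swapped\<close> expands to the term as
  it stands; this puts the first term into the space of three-variable series.\<close>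

lemma first_term_representative:
  assumes "to_fract_matrix H \<in> \<R>"
  shows "\<exists>T\<in>three_var_series. expand1 T = (d1 (to_fract_matrix H) \<lhd>\<^sub>M to_fract_matrix H) $ k $ i $ j"
proof -
  let ?H = "to_fract_matrix H"
  have "\<forall>s. \<exists>T\<in>three_var_series. expand1 T = fls_map (theta s) (?H $ k $ j) \<lhd> ?H $ s $ i"
  proof
    fix s
    have "?H $ k $ j \<in> rational_over_fractions" using assms by (simp add: rational_fraction_matrices_def)
    then obtain T where "T \<in> three_var_series" "expand1 (swap_vars T) = fls_map (theta s) (?H $ k $ j) \<lhd> ?H $ s $ i \<rhd> 1"
      using represents_swappedE[OF represents_delta(1)] by metis
    thus "\<exists>T\<in>three_var_series. expand1 T = fls_map (theta s) (?H $ k $ j) \<lhd> ?H $ s $ i"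
      using three_var_swap by (intro bexI[of _ "swap_vars T"]) simp_all
  qed
  then obtain T where T: "\<And>s. T s \<in> three_var_series" "\<And>s. expand1 (T s) = fls_map (theta s) (?H $ k $ j) \<lhd> ?H $ s $ i"
    by metis
  show ?thesis
    by (rule bexI[of _ "\<lambda>a b c. \<Sum>s\<in>UNIV. T s a b c"])
      (simp_all add: expand1_sum three_var_sum T d1_def psdm_slot1_def)
qed

text \<open>One representative serves both purposes: after swapping it gives the bracket in its
  natural domain, and unswapped it gives the re-expansion used by \<open>jacobiator\<close>.\<close>

lemma second_term_representative:
  assumes "to_fract_matrix H \<in> \<R>"
  shows "\<exists>T\<in>three_var_series. expand1 T = (d2 (to_fract_matrix H) \<rhd>\<^sub>M to_fract_matrix H) $ k $ i $ j \<and>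
    expand1 (swap_vars T) = (d1 (to_fract_matrix H) \<lhd>\<^sub>M to_fract_matrix H) $ k $ j $ i"
proof -
  let ?H = "to_fract_matrix H"
  have "\<forall>s. \<exists>T\<in>three_var_series. expand1 T = delta_swapped (theta s) (?H $ k $ i) \<rhd> ?H $ s $ j \<and>
      expand1 (swap_vars T) = fls_map (theta s) (?H $ k $ i) \<lhd> ?H $ s $ j"
  proof
    fix s
    have "?H $ k $ i \<in> rational_over_fractions" using assms by (simp add: rational_fraction_matrices_def)
    then obtain T where "T \<in> three_var_series" "expand1 T = delta_swapped (theta s) (?H $ k $ i) \<lhd> 1 \<rhd> ?H $ s $ j"
      "expand1 (swap_vars T) = fls_map (theta s) (?H $ k $ i) \<lhd> ?H $ s $ j \<rhd> 1"
      using represents_swappedE[OF represents_delta(1)] by metis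
    thus "\<exists>T\<in>three_var_series. expand1 T = delta_swapped (theta s) (?H $ k $ i) \<rhd> ?H $ s $ j \<and>
      expand1 (swap_vars T) = fls_map (theta s) (?H $ k $ i) \<lhd> ?H $ s $ j"
      by (intro bexI[of _ T]) simp_all
  qed
  then obtain T where T: "\<And>s. T s \<in> three_var_series" "\<And>s. expand1 (T s) = delta_swapped (theta s) (?H $ k $ i) \<rhd> ?H $ s $ j"
    "\<And>s. expand1 (swap_vars (T s)) = fls_map (theta s) (?H $ k $ i) \<lhd> ?H $ s $ j"
    by metis
  show ?thesis
    by (rule bexI[of _ "\<lambda>a b c. \<Sum>s\<in>UNIV. T s a b c"])
      (simp_all add: expand1_sum three_var_sum T three_var_swap swap_sum d1_def d2_def psdm_slot1_def psdm_slot2_def)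
qed

text \<open>H is applied to the representative through nu, which becomes composition on the inner
  variable in the natural domain and the left action in the common one.\<close>

lemma third_term_representative:
  assumes "to_fract_matrix H \<in> \<R>"
  shows "\<exists>T\<in>three_var_series. expand1 T = psdm_left (to_fract_matrix H) (d3 (to_fract_matrix H)) $ k $ i $ j \<and>
    expand3 T = (\<Sum>s\<in>UNIV. fls_map ((\<odot>) (to_fract_matrix H $ k $ s))
      (fls_map psd_adjoint (fls_map (theta s) (to_fract_matrix H $ j $ i))))"
proof -
  let ?H = "to_fract_matrix H"
  have "\<forall>s. \<exists>T\<in>three_var_series. expand1 T = psd_sigma (?H $ k $ s) \<odot> delta_dual (theta s) (?H $ j $ i) \<and>
      expand3 T = fls_map ((\<odot>) (?H $ k $ s)) (fls_map psd_adjoint (fls_map (theta s) (?H $ j $ i)))"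
  proof
    fix s
    have "?H $ j $ i \<in> rational_over_fractions" using assms by (simp add: rational_fraction_matrices_def)
    then obtain T where T: "T \<in> three_var_series" "expand1 T = delta_dual (theta s) (?H $ j $ i) \<lhd> 1 \<rhd> 1"
      "expand3 T = fls_map psd_adjoint (psd_sigma (psd_adjoint 1) \<odot> fls_map (theta s) (?H $ j $ i) \<rhd> 1)"
      using represents_dualE[OF represents_delta(2)] by metis
    thus "\<exists>T\<in>three_var_series. expand1 T = psd_sigma (?H $ k $ s) \<odot> delta_dual (theta s) (?H $ j $ i) \<and>
      expand3 T = fls_map ((\<odot>) (?H $ k $ s)) (fls_map psd_adjoint (fls_map (theta s) (?H $ j $ i)))"
      by (intro bexI[of _ "psd_act (?H $ k $ s) T"]) (simp_all add: expand1_act expand3_act three_var_act adjoint_one)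
  qed
  then obtain T where T: "\<And>s. T s \<in> three_var_series" "\<And>s. expand1 (T s) = psd_sigma (?H $ k $ s) \<odot> delta_dual (theta s) (?H $ j $ i)"
    "\<And>s. expand3 (T s) = fls_map ((\<odot>) (?H $ k $ s)) (fls_map psd_adjoint (fls_map (theta s) (?H $ j $ i)))"
    by metis
  show ?thesis
    by (rule bexI[of _ "\<lambda>a b c. \<Sum>s\<in>UNIV. T s a b c"])
      (simp_all add: expand1_sum expand3_sum three_var_sum T d3_def psdm_left_def)
qed

text \<open>The embedding of V into its fractions is injective and linear over the scalar field, so
  a complementary subspace provides a linear left inverse.\<close>

lemma ex_projection:
  obtains \<pi> :: "'v fract \<Rightarrow> 'v" where "\<And>a b. \<pi> (a + b) = \<pi> a + \<pi> b" "\<And>a. \<pi> (to_fract a) = a"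
proof -
  have s: "smul c f = smul c 1 * f" for c f
    using scale_mult[of c 1 f] by simp
  interpret K: vector_space "\<lambda>c q. to_fract (smul c 1) * q"
  proof
    fix a b q
    show "to_fract (smul (a + b) 1) * q = to_fract (smul a 1) * q + to_fract (smul b 1) * q"
      by (simp only: scale_left_distrib to_fract_add distrib_right)
    have "smul (a * b) 1 = smul a 1 * smul b 1" using s[of a "smul b 1"] by simp
    thus "to_fract (smul a 1) * (to_fract (smul b 1) * q) = to_fract (smul (a * b) 1) * q"
      by (simp only: to_fract_mult mult.assoc)
  qed (simp_all add: distrib_left)
  interpret VK: vector_space_pair smul "\<lambda>c q. to_fract (smul c 1) * q" ..
  have "Vector_Spaces.linear smul (\<lambda>c q. to_fract (smul c 1) * q) to_fract"
  proof
    fix a b :: 'v and c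
    show "to_fract (a + b) = to_fract a + to_fract b" by (rule to_fract_add)
    show "to_fract (smul c a) = to_fract (smul c 1) * to_fract a"
      by (subst s) (rule to_fract_mult)
  qed
  from VK.linear_injective_left_inverse[OF this] obtain \<pi>
    where \<pi>: "Vector_Spaces.linear (\<lambda>c q. to_fract (smul c 1) * q) smul \<pi>" "\<pi> \<circ> to_fract = id"
    by (auto simp: inj_def)
  interpret P: Vector_Spaces.linear "\<lambda>c q. to_fract (smul c 1) * q" smul \<pi> by (rule \<pi>(1))
  show ?thesis using that[of \<pi>] P.add \<pi>(2) by (metis comp_apply id_apply)
qed

text \<open>Forwards, representatives over V, read over the fractions, have the same natural
  expansions as T2 and T3 and hence the same expansions in the common domain. Backwards, T1, T2 and
  T3 are projected to V coefficientwise; their natural expansions already have coefficients in V and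
  are preserved.\<close>

lemma jacobi_identity_iff_jacobiator:
  assumes R: "to_fract_matrix H \<in> \<R>"
  shows "jacobi_identity u pd H i j k \<longleftrightarrow> jacobiator (to_fract_matrix H) $ k $ i $ j = 0"
proof -
  let ?H = "to_fract_matrix H"
  define F1 where "F1 = fls_map (\<lambda>g. lambda_bracket pd H (u i 0) g) (H $ k $ j)"
  define F2 where "F2 = fls_map (\<lambda>g. lambda_bracket pd H (u j 0) g) (H $ k $ i)"
  define F3 where "F3 = fls_map (\<lambda>f. lambda_bracket pd H f (u k 0)) (H $ j $ i)"
  have F1: "lift2 F1 = (d1 ?H \<lhd>\<^sub>M ?H) $ k $ i $ j"
    unfolding F1_def lift2_first_term by (simp add: d1_def psdm_slot1_def to_fract_matrix_def to_fraction_psd_eq)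
  have F2: "lift2 F2 = (d1 ?H \<lhd>\<^sub>M ?H) $ k $ j $ i"
    unfolding F2_def lift2_first_term by (simp add: d1_def psdm_slot1_def to_fract_matrix_def to_fraction_psd_eq)
  have F3: "lift2 F3 = (\<Sum>s\<in>UNIV. fls_map ((\<odot>) (?H $ k $ s)) (fls_map psd_adjoint (fls_map (theta s) (?H $ j $ i))))"
    unfolding F3_def lift2_third_term by (simp add: to_fract_matrix_def to_fraction_psd_eq)
  have jac: "jacobi_identity u pd H i j k \<longleftrightarrow>
     (\<exists>P\<in>three_var_series. \<exists>Q\<in>three_var_series. \<exists>R\<in>three_var_series.
        F1 = expand1 P \<and> F2 = expand1 (swap_vars Q) \<and> F3 = expand3 R \<and> zero_in_quotient (\<lambda>a b c. P a b c - Q a b c - R a b c))"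
    unfolding jacobi_identity_iff lambda_bracket_generators F1_def F2_def F3_def ..
  obtain T2 where T2: "T2 \<in> three_var_series" "expand1 T2 = (d2 ?H \<rhd>\<^sub>M ?H) $ k $ i $ j" "expand1 (swap_vars T2) = lift2 F2"
    using second_term_representative[OF R, of k i j] unfolding F2 by blast
  obtain T3 where T3: "T3 \<in> three_var_series" "expand1 T3 = psdm_left ?H (d3 ?H) $ k $ i $ j" "expand3 T3 = lift2 F3"
    using third_term_representative[OF R, of k i j] unfolding F3 by blast
  have J: "jacobiator ?H $ k $ i $ j = lift2 F1 - expand1 T2 - expand1 T3"
    by (simp add: jacobiator_def F1 T2 T3)
  show ?thesis
  proof
    assume "jacobi_identity u pd H i j k"
    then obtain P Q R where PQR: "P \<in> three_var_series" "Q \<in> three_var_series" "R \<in> three_var_series"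
      "F1 = expand1 P" "F2 = expand1 (swap_vars Q)" "F3 = expand3 R" "zero_in_quotient (\<lambda>a b c. P a b c - Q a b c - R a b c)"
      unfolding jac by blast
    let ?f = "\<lambda>T a b c. to_fract (T a b c :: 'v)"
    note f = three_var_map[of _ to_fract, OF _ to_fract_zero]
    have e1: "expand1 (?f T) = lift2 (expand1 T)" and e3: "expand3 (?f T) = lift2 (expand3 T)" if "T \<in> three_var_series" for T
      using expand1_map[OF that, of to_fract] expand3_map[OF that, of to_fract] by (simp_all add: to_fract_add del: add_fract)
    have sw: "swap_vars (?f T) = ?f (swap_vars T)" for T
      by (simp add: fun_eq_iff swap_vars_def)
    have "expand1 (?f Q) = expand1 T2"
      by (rule expand1_cong_swap[OF f[OF PQR(2)] T2(1)])
        (simp only: sw e1[OF three_var_swap[OF PQR(2)]] T2(3) PQR(5))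
    moreover have "expand1 (?f R) = expand1 T3"
      by (rule expand1_cong_expand3[OF f[OF PQR(3)] T3(1)]) (simp only: e3[OF PQR(3)] T3(3) PQR(6))
    moreover have "zero_in_quotient (\<lambda>a b c. ?f P a b c - ?f Q a b c - ?f R a b c)"
      using zero_in_quotient_map[OF PQR(7), of to_fract] by (simp add: to_fract_add del: add_fract)
    hence "expand1 (\<lambda>a b c. ?f P a b c - ?f Q a b c - ?f R a b c) = 0"
      by (rule expand1_eq_0_iff[THEN iffD2, OF three_var_diff[OF three_var_diff[OF f[OF PQR(1)] f[OF PQR(2)]] f[OF PQR(3)]]])
    hence "expand1 (?f P) - expand1 (?f Q) - expand1 (?f R) = 0"
      unfolding expand1_diff[OF three_var_diff[OF f[OF PQR(1)] f[OF PQR(2)]] f[OF PQR(3)]]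
        expand1_diff[OF f[OF PQR(1)] f[OF PQR(2)]] .
    ultimately show "jacobiator ?H $ k $ i $ j = 0"
      by (simp only: J PQR(4) e1[OF PQR(1)])
  next
    assume 0: "jacobiator ?H $ k $ i $ j = 0"
    obtain T1 where T1: "T1 \<in> three_var_series" "expand1 T1 = lift2 F1"
      using first_term_representative[OF R, of k i j] unfolding F1 by blast
    have z: "zero_in_quotient (\<lambda>a b c. T1 a b c - T2 a b c - T3 a b c)"
      using 0 T1 T2(1) T3(1) by (subst expand1_eq_0_iff[symmetric]) (simp_all add: three_var_diff expand1_diff J)
    obtain \<pi> :: "'v fract \<Rightarrow> 'v" where \<pi>: "\<And>a b. \<pi> (a + b) = \<pi> a + \<pi> b" "\<And>a. \<pi> (to_fract a) = a"
      by (rule ex_projection) blast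
    have \<pi>0: "\<pi> 0 = 0" by (rule additive_zero) (rule \<pi>(1))
    let ?p = "\<lambda>T a b c. \<pi> (T a b c)"
    have p: "?p T \<in> three_var_series" if "T \<in> three_var_series" for T
      by (rule three_var_map[of T \<pi>, OF that \<pi>0])
    have retract: "fls_map (fls_map \<pi>) (lift2 F) = F" for F
      by (subst fls_map2_comp) (simp_all add: \<pi>0 \<pi>(2) fls_map_id[abs_def])
    have "F1 = expand1 (?p T1)" "F3 = expand3 (?p T3)"
      by (simp_all only: expand1_map[of T1 \<pi>, OF T1(1) \<pi>(1)] expand3_map[of T3 \<pi>, OF T3(1) \<pi>(1)] T1(2) T3(3) retract)
    moreover have "swap_vars (?p T2) = ?p (swap_vars T2)" by (simp add: fun_eq_iff swap_vars_def)
    hence "F2 = expand1 (swap_vars (?p T2))"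
      by (simp only: expand1_map[of "swap_vars T2" \<pi>, OF three_var_swap[OF T2(1)] \<pi>(1)] T2(3) retract)
    moreover have "zero_in_quotient (\<lambda>a b c. ?p T1 a b c - ?p T2 a b c - ?p T3 a b c)"
      using zero_in_quotient_map[of _ \<pi>, OF z \<pi>(1)] by (simp add: additive_diff[of \<pi>, OF \<pi>(1)])
    ultimately show "jacobi_identity u pd H i j k"
      unfolding jac using p[OF T1(1)] p[OF T2(1)] p[OF T3(1)] by blast
  qed
qed

lemma nonlocal_hamiltonian_iff:
  "nonlocal_hamiltonian u pd H \<longleftrightarrow> to_fract_matrix H \<in> \<R> \<and>
     psdm_adjoint (to_fract_matrix H) = - to_fract_matrix H \<and> jacobiator (to_fract_matrix H) = 0"
proof -
  have "psdm_adjoint H = - H \<longleftrightarrow> psdm_adjoint (to_fract_matrix H) = - to_fract_matrix H"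
    using to_fract_matrix_inj by (auto simp flip: to_fract_matrix_adjoint to_fract_matrix_minus)
  moreover have "(\<forall>i j k. jacobi_identity u pd H i j k) \<longleftrightarrow> jacobiator (to_fract_matrix H) = 0"
    if "to_fract_matrix H \<in> \<R>"
    using jacobi_identity_iff_jacobiator[OF that] by (auto simp: vec_eq_iff)
  ultimately show ?thesis
    unfolding nonlocal_hamiltonian_def to_fract_matrix_rational by blast
qed

lemma to_fract_matrix_scale: "to_fract_matrix (psdm_scale smul c A) = psdm_const (to_fract (smul c 1)) \<odot>\<^sub>M to_fract_matrix A"
proof -
  have s: "smul c f = smul c 1 * f" for f using scale_mult[of c 1 f] by simp
  have "fls_map to_fract (fls_map (smul c) x) = fls_const (to_fract (smul c 1)) * fls_map to_fract x" for x
    by (rule fls_eqI) (simp, subst s, simp)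
  thus ?thesis by (simp add: vec_eq_iff to_fract_matrix_def to_fraction_psd_eq psdm_scale_def psdm_const_comp)
qed

lemma scalar_constant: "der (to_fract (smul c 1)) = 0" "theta s (to_fract (smul c 1)) = 0"
proof -
  have "der (smul c 1) = 0" by (simp add: der_scale)
  thus "der (to_fract (smul c 1)) = 0"
    using diff_hom_der[OF diff_hom_to_fract, of "smul c 1"] by simp
  have "pd s n 1 = pd s n 1 + pd s n 1" for n
    using pd_mult[of s n 1 1] by (simp only: mult_1 mult_1_right)
  hence "pd s n 1 = 0" for n by (metis add_cancel_left_right)
  hence "pd s n (smul c 1) = 0" for n by (simp add: pd_scale)
  thus "theta s (to_fract (smul c 1)) = 0"
    by (intro psd_eqI) (simp only: psd_coeff_theta fract_pd_to_fract, simp)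
qed

theorem hierarchy_compatible:
  assumes HK: "compatible_structures smul u pd {H, K}" and inv: "rational_invertible K"
  shows "(\<forall>n. hierarchy H K n \<in> rational_matrices) \<and> compatible_structures smul u pd (range (hierarchy H K))"
proof -
  define S where "S = rational_inverse K"
  have "rational_inverse_of K S"
    using inv unfolding rational_invertible_def S_def rational_inverse_def by (metis someI)
  hence S: "S \<in> rational_matrices" "K \<odot>\<^sub>M S = psdm_one" "S \<odot>\<^sub>M K = psdm_one"
    by (auto simp: rational_inverse_of_def)
  let ?m = to_fract_matrix
  let ?N = "?m H \<odot>\<^sub>M ?m S"
  have mS: "?m S \<in> \<R>" "?m K \<odot>\<^sub>M ?m S = psdm_one" "?m S \<odot>\<^sub>M ?m K = psdm_one"
    using S by (simp_all add: to_fract_matrix_rational to_fract_matrix_one flip: to_fract_matrix_comp)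
  have Hh: "nonlocal_hamiltonian u pd H" and Kh: "nonlocal_hamiltonian u pd K"
    using HK by (auto simp: compatible_structures_def)
  have comb: "nonlocal_hamiltonian u pd (\<Sum>A\<in>{H, K}. psdm_scale smul (c A) A)" for c
    using HK by (auto simp: compatible_structures_def)
  have "nonlocal_hamiltonian u pd (K + H)"
  \<comment> \<open>If H = K, the set of the two structures is a singleton and carries a single
    coefficient, so the sum arises with coefficient 2.\<close>
  proof (cases "H = K")
    case True
    have "psdm_scale smul 2 K = K + K"
    proof -
      have "smul 2 f = f + f" for f using scale_left_distrib[of 1 1 f] by simp
      thus ?thesis by (auto simp: vec_eq_iff psdm_scale_def intro!: fls_eqI)
    qed
    thus ?thesis using comb[of "\<lambda>_. 2"] True by simp
  next
    case False
    have "psdm_scale smul 1 A = A" for A :: "('v, 'i) psd_matrix"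
      by (auto simp: vec_eq_iff psdm_scale_def intro!: fls_eqI)
    thus ?thesis using comb[of "\<lambda>_. 1"] False by (simp add: add.commute)
  qed
  note ham = this[unfolded nonlocal_hamiltonian_iff] Hh[unfolded nonlocal_hamiltonian_iff] Kh[unfolded nonlocal_hamiltonian_iff]
  have N: "?N \<in> \<R>" using ham mS by (intro rational_matrix_comp) auto
  have poly: "nonlocal_hamiltonian u pd L" if "?m L = A \<odot>\<^sub>M ?m K" "npoly ?N A" for L A
    unfolding nonlocal_hamiltonian_iff that(1)
    using jacobiator_npoly[OF _ mS _ _ _ _ _ _ that(2)] npoly_rational[OF that(2) N] ham
    by (auto simp: to_fract_matrix_add rational_matrix_comp)
  \<comment> \<open>Uniform description of the hierarchy: N K = H, so for positive n the power n - 1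
    of N followed by H equals the power n of N followed by K.\<close>
  have hier: "?m (hierarchy H K n) = psdm_power ?N n \<odot>\<^sub>M ?m K" for n
  proof (cases n)
    case 0
    thus ?thesis by (simp add: hierarchy_def)
  next
    case (Suc n')
    have "psdm_power ?N (Suc n') \<odot>\<^sub>M ?m K = psdm_power ?N n' \<odot>\<^sub>M (?N \<odot>\<^sub>M ?m K)"
      by (simp flip: psdm_power_commute psdm_comp_assoc)
    also have "?N \<odot>\<^sub>M ?m K = ?m H" by (simp add: psdm_comp_assoc mS)
    finally show ?thesis
      using Suc by (simp add: hierarchy_def to_fract_matrix_comp to_fract_matrix_power flip: S_def)
  qed
  have single: "nonlocal_hamiltonian u pd (hierarchy H K n)" for n
    by (rule poly[OF hier npoly.power])
  have const: "npoly ?N (psdm_const (to_fract (smul c 1)) \<odot>\<^sub>M A)" if "npoly ?N A" for c A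
    using that scalar_constant psdm_const_rational by (intro npoly.const) auto
  have "\<exists>A. npoly ?N A \<and> ?m (\<Sum>A\<in>\<S>. psdm_scale smul (c A) A) = A \<odot>\<^sub>M ?m K"
    if "finite \<S>" "\<S> \<subseteq> range (hierarchy H K)" for \<S> c
    using that
  proof (induction \<S>)
    case empty
    \<comment> \<open>The zero polynomial is obtained as 0 times the zeroth power.\<close>
    have "psdm_const (to_fract (smul 0 1)) \<odot>\<^sub>M psdm_power ?N 0 \<odot>\<^sub>M ?m K = 0"
      by (simp add: psdm_comp_assoc psdm_const_comp vec_eq_iff)
    from const[OF npoly.power] this[symmetric] show ?case
      unfolding sum.empty to_fract_matrix_zero by (intro exI conjI)
  next
    case (insert L \<S>)
    then obtain A n where A: "npoly ?N A" "?m (\<Sum>A\<in>\<S>. psdm_scale smul (c A) A) = A \<odot>\<^sub>M ?m K" "L = hierarchy H K n"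
      by auto
    let ?B = "psdm_const (to_fract (smul (c L) 1)) \<odot>\<^sub>M psdm_power ?N n"
    have "?m (\<Sum>A\<in>insert L \<S>. psdm_scale smul (c A) A) = (?B + A) \<odot>\<^sub>M ?m K"
      using insert(1,2) A(2) hier[of n]
      by (simp add: to_fract_matrix_add to_fract_matrix_scale psdm_comp_add psdm_comp_assoc flip: A(3))
    thus ?case using npoly.add[OF const[OF npoly.power] A(1)] by blast
  qed
  hence sums: "nonlocal_hamiltonian u pd (\<Sum>A\<in>\<S>. psdm_scale smul (c A) A)"
    if "finite \<S>" "\<S> \<subseteq> range (hierarchy H K)" for \<S> c
    using that poly by blast
  show ?thesis
    unfolding compatible_structures_def
  proof (intro conjI allI ballI impI)
    show "hierarchy H K n \<in> rational_matrices" for n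
      using single by (simp add: nonlocal_hamiltonian_def)
  qed (use single sums in auto)
qed

end

theorem theorem5p1:
  fixes smul :: "'f::field_char_0 \<Rightarrow> 'v \<Rightarrow> 'v::differential_idom"
    and u :: "'i::finite \<Rightarrow> nat \<Rightarrow> 'v"
    and pd :: "'i \<Rightarrow> nat \<Rightarrow> 'v \<Rightarrow> 'v"
    and H K :: "('v, 'i) psd_matrix"
  assumes "differential_functions smul u pd"
    and "compatible_structures smul u pd {H, K}"
    and "rational_invertible K"
  shows "(\<forall>n. hierarchy H K n \<in> rational_matrices) \<and>
         compatible_structures smul u pd (range (hierarchy H K))"
proof -
  interpret differential_functions_domain smul u pd
    using assms(1) by (rule differential_functions_domain.intro)
  show ?thesis using assms(2,3) by (rule hierarchy_compatible)
qed

end
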